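(* Let $X$ be a Banach space with norm topology $\tau_{\|\cdot\|}$, let $\tau\subseteq\tau_{\|\cdot\|}$ be a Hausdorff locally convex topology on $X$ such that $(X,\tau)'\subseteq(X,\tau_{\|\cdot\|})'$ is norming for $X$, and suppose that $(X,\gamma)$ is a C-sequential space, where $\gamma:=\gamma(\tau,\tau_{\|\cdot\|})$ is the mixed topology. Let $(T_t)_{t\ge0}$ be a uniformly bounded locally bi-continuous (respectively, bi-continuous) semigroup on $X$ with respect to $\tau$ with generator $-A$, and let $f$ be a Bernstein function. Then the subordinated semigroup $(S_t)_{t\ge0}$ to $(T_t)_{t\geq 0}$ with respect to $f$ is uniformly bounded and locally bi-continuous (respectively, bi-continuous) with respect to $\tau$ as well, and its generator $-f(A)$ is given by the sequential closure of $-A_f$.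
   Context: Norming: $\|x\|=\sup\{|\langle x',x\rangle|: x'\in(X,\tau)',\ \|x'\|\le1\}$ for all $x\in X$. The mixed topology $\gamma(\tau,\tau_{\|\cdot\|})$ is the finest linear topology on $X$ that coincides with $\tau$ on $\|\cdot\|$-bounded sets; it is Hausdorff locally convex and $\tau\subseteq\gamma\subseteq\tau_{\|\cdot\|}$. A topological vector space is C-sequential if every convex sequentially open subset is open ($U$ is sequentially open if every sequence converging to a point of $U$ is eventually in $U$). A semigroup $(T_t)_{t\ge0}$ of bounded linear operators on $X$ ($T_0=I$, $T_{s+t}=T_sT_t$) is locally bi-continuous w.r.t. a Hausdorff locally convex topology $\tau$ if: (a) $\tau\subseteq\tau_{\|\cdot\|}$, every $\|\cdot\|$-bounded $\tau$-Cauchy sequence is $\tau$-convergent, and $(X,\tau)'$ is norming for $X$; (b) there are $M\ge1$, $\omega\in\mathbb R$ with $\|T_t\|\le Me^{\omega t}$ for all $t\ge0$; (c) $\tau\text{-}\lim_{t\to0+}T_tx=x$ for all $x\in X$; (d) for every $\|\cdot\|$-bounded sequence $(x_n)$ with $\tau\text{-}\lim x_n=x$ one has $\tau\text{-}\lim_n T_t(x_n-x)=0$ uniformly for $t$ in compact subsets of $[0,\infty)$. It is bi-continuous if in (d) convergence is uniform for $t\in[0,\infty)$. It is uniformly bounded if $\sup_{t\ge0}\|T_t\|<\infty$. Such a semigroup is a $C_0$-semigroup on $(X,\gamma)$ (i.e. $\gamma\text{-}\lim_{t\to0+}T_tx=x$), and its generator $-A$ is given by $\mathcal D(A)=\{x:\gamma\text{-}\lim_{t\to0+}\frac1t(T_tx-x)\text{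 exists}\}$, $-Ax=\gamma\text{-}\lim_{t\to0+}\frac1t(T_tx-x)$. A Bernstein function is $f\in C^\infty(0,\infty)$, $f\colon(0,\infty)\to[0,\infty)$, with $(-1)^{k-1}f^{(k)}\ge0$ for all $k\in\{1,2,\dots\}$. Its Lévy triplet $(a,b,\mu)$ is the unique triple with $a,b\ge0$, $\mu$ a positive Radon measure on $(0,\infty)$, $\int_{(0,\infty)}\min(1,t)\,\mu(\mathrm{d}t)<\infty$ and $f(\lambda)=a+b\lambda+\int_{(0,\infty)}(1-e^{-\lambda t})\,\mu(\mathrm{d}t)$ ($\lambda>0$). There is a unique vaguely continuous convolution semigroup $(\mu_t)_{t\ge0}$ of Radon measures on $[0,\infty)$ with total mass $\le1$ ($\mu_0=\delta_0$, $\mu_t*\mu_s=\mu_{t+s}$) such that $\int_{[0,\infty)}e^{-\lambda s}\mu_t(\mathrm{d}s)=e^{-tf(\lambda)}$. The subordinated semigroup is $S_tx:=\int_{[0,\infty)}T_sx\,\mu_t(\mathrm{d}s)$, and $A_f$ is the operator with $\mathcal D(A_f)=\mathcal D(A)$, $A_fx=ax+bAx+\int_{(0,\infty)}(x-T_tx)\,\mu(\mathrm{d}t)$; both integrals are Pettis integrals in $(X,\gamma)$ ($x=\int g\,\mathrm{d}\mu$ means $\langle x',x\rangle=\int\langle x',g\rangle\,\mathrm{d}\mu$ for all $x'\in(X,\gamma)'$, all integrands being in $L^1(\mu)$). The generator of $(S_t)$ is denoted $-f(A)$. The sequential closure of an operator (here in $(X,\gamma)$) is the operator whose graph is the smallest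 sequentially closed subset of $X\times X$ containing its graph. *)

theory Defs
  imports "HOL-Probability.Probability"
begin

text \<open>
  The Banach space is a type \<open>'a::banach\<close>. Its scalar field is a type
  \<open>'k::{real_normed_field,euclidean_space}\<close>, i.e. the reals or the complex numbers (the only finite
  dimensional commutative real division algebras), acting through \<open>smul\<close>, which extends the real
  scalar multiplication. For \<open>'k = real\<close> this forces \<open>smul = scaleR\<close>; for \<open>'k = complex\<close> one gets
  exactly the complex Banach spaces. A second topology on the space is a value of type \<open>'a topology\<close>.
\<close>

definition normed_scaling ::
    "('k::{real_normed_field,euclidean_space} \<Rightarrow> 'a::real_normed_vector \<Rightarrow> 'a) \<Rightarrow> bool" where
  "normed_scaling smul \<longleftrightarrow>
     vector_space smul \<and>
     (\<forall>r x. smul (of_real r) x = r *\<^sub>R x) \<and>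
     (\<forall>c x. norm (smul c x) = norm c * norm x)"

definition coarser_topology :: "'a topology \<Rightarrow> 'a topology \<Rightarrow> bool" where
  "coarser_topology \<sigma> \<tau> \<longleftrightarrow> (\<forall>U. openin \<sigma> U \<longrightarrow> openin \<tau> U)"

definition linear_topology ::
    "('k::{real_normed_field,euclidean_space} \<Rightarrow> 'a::real_normed_vector \<Rightarrow> 'a) \<Rightarrow> 'a topology \<Rightarrow> bool" where
  "linear_topology smul \<tau> \<longleftrightarrow>
     topspace \<tau> = UNIV \<and>
     continuous_map (prod_topology \<tau> \<tau>) \<tau> (\<lambda>(x, y). x + y) \<and>
     continuous_map (prod_topology euclidean \<tau>) \<tau> (\<lambda>(c, x). smul c x)"

definition locally_convex_topology ::
    "('k::{real_normed_field,euclidean_space} \<Rightarrow> 'a::real_normed_vector \<Rightarrow> 'a) \<Rightarrow> 'a topology \<Rightarrow> bool" where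
  "locally_convex_topology smul \<tau> \<longleftrightarrow> linear_topology smul \<tau> \<and> neighbourhood_base_at 0 convex \<tau>"

definition top_dual ::
    "('k::{real_normed_field,euclidean_space} \<Rightarrow> 'a::real_normed_vector \<Rightarrow> 'a) \<Rightarrow> 'a topology \<Rightarrow>
     ('a \<Rightarrow> 'k) set" where
  "top_dual smul \<tau> = {\<phi>. Vector_Spaces.linear smul (*) \<phi> \<and> continuous_map \<tau> euclidean \<phi>}"

text \<open>
  Used only if \<open>\<tau>\<close> is coarser than the norm topology; then every \<open>\<phi>\<close> below is norm-bounded, so that
  \<open>onorm\<close> is its dual norm and the supremum is over a set bounded by \<open>norm x\<close>.
\<close>
definition norming ::
    "('k::{real_normed_field,euclidean_space} \<Rightarrow> 'a::real_normed_vector \<Rightarrow> 'a) \<Rightarrow> 'a topology \<Rightarrow> bool" where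
  "norming smul \<tau> \<longleftrightarrow>
     (\<forall>x. norm x = (SUP \<phi> \<in> {\<phi> \<in> top_dual smul \<tau>. onorm \<phi> \<le> 1}. norm (\<phi> x)))"

definition coincide_on_bounded :: "'a::real_normed_vector topology \<Rightarrow> 'a topology \<Rightarrow> bool" where
  "coincide_on_bounded \<sigma> \<tau> \<longleftrightarrow> (\<forall>B. bounded B \<longrightarrow> subtopology \<sigma> B = subtopology \<tau> B)"

definition is_mixed_topology ::
    "('k::{real_normed_field,euclidean_space} \<Rightarrow> 'a::real_normed_vector \<Rightarrow> 'a) \<Rightarrow>
     'a topology \<Rightarrow> 'a topology \<Rightarrow> bool" where
  "is_mixed_topology smul \<tau> \<gamma> \<longleftrightarrow>
     linear_topology smul \<gamma> \<and> coincide_on_bounded \<gamma> \<tau> \<and>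
     (\<forall>\<sigma>. linear_topology smul \<sigma> \<and> coincide_on_bounded \<sigma> \<tau> \<longrightarrow> coarser_topology \<sigma> \<gamma>)"

text \<open>Well defined by \<open>is_mixed_topology_mixed_topology\<close> and \<open>is_mixed_topology_unique\<close> below.\<close>
definition mixed_topology ::
    "('k::{real_normed_field,euclidean_space} \<Rightarrow> 'a::real_normed_vector \<Rightarrow> 'a) \<Rightarrow>
     'a topology \<Rightarrow> 'a topology" where
  "mixed_topology smul \<tau> = (THE \<gamma>. is_mixed_topology smul \<tau> \<gamma>)"

lemma is_mixed_topology_unique:
  assumes "is_mixed_topology smul \<tau> \<gamma>" "is_mixed_topology smul \<tau> \<gamma>'"
  shows "\<gamma> = \<gamma>'"
  using assms unfolding is_mixed_topology_def coarser_topology_def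
  by (meson topology_eq)

lemma is_mixed_topology_exists:
  fixes smul :: "'k::{real_normed_field,euclidean_space} \<Rightarrow> 'a::real_normed_vector \<Rightarrow> 'a"
  assumes lin: "linear_topology smul \<tau>"
  shows "\<exists>\<gamma>. is_mixed_topology smul \<tau> \<gamma>"
proof -
  define P where "P \<sigma> \<longleftrightarrow> linear_topology smul \<sigma> \<and> coincide_on_bounded \<sigma> \<tau>" for \<sigma>
  define F where "F = {U. \<exists>\<sigma>. P \<sigma> \<and> openin \<sigma> U}"
  define \<gamma> where "\<gamma> = topology_generated_by F"
  have P\<tau>: "P \<tau>" using lin by (simp add: P_def coincide_on_bounded_def)
  have top\<tau>: "topspace \<tau> = UNIV" using lin by (simp add: linear_topology_def)
  have "UNIV \<in> F" using P\<tau> top\<tau> openin_topspace[of \<tau>] by (auto simp: F_def)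
  then have UF: "\<Union>F = UNIV" by blast
  have top\<gamma>: "topspace \<gamma> = UNIV" unfolding \<gamma>_def topology_generated_by_topspace UF ..
  have fine: "openin \<gamma> U" if "P \<sigma>" "openin \<sigma> U" for \<sigma> U
    unfolding \<gamma>_def by (rule topology_generated_by_Basis) (use that in \<open>auto simp: F_def\<close>)
  have id: "continuous_map \<gamma> \<sigma> (\<lambda>x. x)" if "P \<sigma>" for \<sigma>
    using that fine top\<gamma> by (auto simp: continuous_map_def P_def linear_topology_def)
  have gen: "continuous_map X \<gamma> f" if "\<And>\<sigma>. P \<sigma> \<Longrightarrow> continuous_map X \<sigma> f" for X :: "'b topology" and f
    unfolding \<gamma>_def
  proof (rule continuous_on_generated_topo)
    show "f ` topspace X \<subseteq> \<Union>F" by (simp add: UF)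
  next
    fix U assume "U \<in> F"
    then obtain \<sigma> where "P \<sigma>" "openin \<sigma> U" by (auto simp: F_def)
    then show "openin X (f -` U \<inter> topspace X)"
      using that[of \<sigma>] by (simp add: continuous_map_alt)
  qed
  have add: "continuous_map (prod_topology \<gamma> \<gamma>) \<gamma> (\<lambda>(x, y). x + y)"
  proof (rule gen)
    fix \<sigma> assume s: "P \<sigma>"
    have "continuous_map (prod_topology \<gamma> \<gamma>) (prod_topology \<sigma> \<sigma>) (\<lambda>z. (fst z, snd z))"
      by (intro continuous_map_pairedI)
         (use continuous_map_compose[OF continuous_map_fst id[OF s]]
              continuous_map_compose[OF continuous_map_snd id[OF s]] in \<open>auto simp: o_def\<close>)
    moreover have "continuous_map (prod_topology \<sigma> \<sigma>) \<sigma> (\<lambda>(x, y). x + y)"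
      using s by (simp add: P_def linear_topology_def)
    ultimately have "continuous_map (prod_topology \<gamma> \<gamma>) \<sigma> ((\<lambda>(x, y). x + y) \<circ> (\<lambda>z. (fst z, snd z)))"
      by (rule continuous_map_compose)
    then show "continuous_map (prod_topology \<gamma> \<gamma>) \<sigma> (\<lambda>(x, y). x + y)"
      by (simp add: o_def split_def)
  qed
  have scl: "continuous_map (prod_topology euclidean \<gamma>) \<gamma> (\<lambda>(c, x). smul c x)"
  proof (rule gen)
    fix \<sigma> assume s: "P \<sigma>"
    have "continuous_map (prod_topology euclidean \<gamma>) (prod_topology euclidean \<sigma>) (\<lambda>z. (fst z, snd z))"
      by (intro continuous_map_pairedI continuous_map_fst)
         (use continuous_map_compose[OF continuous_map_snd id[OF s]] in \<open>auto simp: o_def\<close>)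
    moreover have "continuous_map (prod_topology euclidean \<sigma>) \<sigma> (\<lambda>(c, x). smul c x)"
      using s by (simp add: P_def linear_topology_def)
    ultimately have "continuous_map (prod_topology euclidean \<gamma>) \<sigma>
        ((\<lambda>(c, x). smul c x) \<circ> (\<lambda>z. (fst z, snd z)))"
      by (rule continuous_map_compose)
    then show "continuous_map (prod_topology euclidean \<gamma>) \<sigma> (\<lambda>(c, x). smul c x)"
      by (simp add: o_def split_def)
  qed
  have "subtopology \<gamma> B = subtopology \<tau> B" if B: "bounded B" for B
  proof -
    have "continuous_map (subtopology \<tau> B) \<gamma> (\<lambda>x. x)"
    proof (rule gen)
      fix \<sigma> assume s: "P \<sigma>"
      then have "subtopology \<tau> B = subtopology \<sigma> B"
        using B by (simp add: P_def coincide_on_bounded_def)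
      then show "continuous_map (subtopology \<tau> B) \<sigma> (\<lambda>x. x)"
        by (simp add: continuous_map_from_subtopology)
    qed
    then have *: "openin (subtopology \<tau> B) (U \<inter> B)" if "openin \<gamma> U" for U
      using that top\<tau> by (auto simp: continuous_map_alt vimage_def Int_def)
    show ?thesis
      unfolding topology_eq
    proof
      fix S
      show "openin (subtopology \<gamma> B) S = openin (subtopology \<tau> B) S"
        using * fine[OF P\<tau>] by (auto simp: openin_subtopology)
    qed
  qed
  then have "is_mixed_topology smul \<tau> \<gamma>"
    using add scl top\<gamma> fine
    by (auto simp: is_mixed_topology_def linear_topology_def coincide_on_bounded_def
        coarser_topology_def P_def)
  then show ?thesis ..
qed

lemma is_mixed_topology_mixed_topology:
  assumes "linear_topology smul \<tau>"
  shows "is_mixed_topology smul \<tau> (mixed_topology smul \<tau>)"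
  unfolding mixed_topology_def
  using is_mixed_topology_exists[OF assms] is_mixed_topology_unique
  by (metis (no_types, lifting) theI)

definition sequentially_openin :: "'a topology \<Rightarrow> 'a set \<Rightarrow> bool" where
  "sequentially_openin X U \<longleftrightarrow>
     U \<subseteq> topspace X \<and>
     (\<forall>s l. l \<in> U \<and> limitin X s l sequentially \<longrightarrow> (\<forall>\<^sub>F n in sequentially. s n \<in> U))"

definition C_sequential :: "'a::real_vector topology \<Rightarrow> bool" where
  "C_sequential X \<longleftrightarrow> (\<forall>U. convex U \<and> sequentially_openin X U \<longrightarrow> openin X U)"

definition sequentially_closedin :: "'a topology \<Rightarrow> 'a set \<Rightarrow> bool" where
  "sequentially_closedin X C \<longleftrightarrow>
     C \<subseteq> topspace X \<and>
     (\<forall>s l. (\<forall>n. s n \<in> C) \<and> limitin X s l sequentially \<longrightarrow> l \<in> C)"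

text \<open>A semigroup is a function on all of \<open>real\<close>; its values at negative times are irrelevant.\<close>

definition operator_semigroup ::
    "('k::{real_normed_field,euclidean_space} \<Rightarrow> 'a::real_normed_vector \<Rightarrow> 'a) \<Rightarrow>
     (real \<Rightarrow> 'a \<Rightarrow> 'a) \<Rightarrow> bool" where
  "operator_semigroup smul T \<longleftrightarrow>
     (\<forall>t\<ge>0. bounded_linear (T t) \<and> Vector_Spaces.linear smul smul (T t)) \<and>
     T 0 = id \<and>
     (\<forall>s\<ge>0. \<forall>t\<ge>0. T (s + t) = T s \<circ> T t)"

definition uniformly_bounded :: "(real \<Rightarrow> 'a::real_normed_vector \<Rightarrow> 'a) \<Rightarrow> bool" where
  "uniformly_bounded T \<longleftrightarrow> bdd_above ((\<lambda>t. onorm (T t)) ` {0..})"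

definition Cauchy_sequence_in :: "'a::real_normed_vector topology \<Rightarrow> (nat \<Rightarrow> 'a) \<Rightarrow> bool" where
  "Cauchy_sequence_in \<tau> s \<longleftrightarrow>
     (\<forall>U. openin \<tau> U \<and> 0 \<in> U \<longrightarrow> (\<exists>N. \<forall>m\<ge>N. \<forall>n\<ge>N. s m - s n \<in> U))"

definition uniformly_null ::
    "'a::real_normed_vector topology \<Rightarrow> real set \<Rightarrow> (nat \<Rightarrow> real \<Rightarrow> 'a) \<Rightarrow> bool" where
  "uniformly_null \<tau> I y \<longleftrightarrow>
     (\<forall>U. openin \<tau> U \<and> 0 \<in> U \<longrightarrow> (\<forall>\<^sub>F n in sequentially. \<forall>t\<in>I. y n t \<in> U))"

text \<open>
  \<open>\<I>\<close> is the family of time sets on which the equicontinuity condition is uniform: the compact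
  subsets of \<open>{0..}\<close> in the local case and \<open>{0..}\<close> itself in the global case.
\<close>
definition bicontinuous_on ::
    "real set set \<Rightarrow> ('k::{real_normed_field,euclidean_space} \<Rightarrow> 'a::real_normed_vector \<Rightarrow> 'a) \<Rightarrow>
     'a topology \<Rightarrow> (real \<Rightarrow> 'a \<Rightarrow> 'a) \<Rightarrow> bool" where
  "bicontinuous_on \<I> smul \<tau> T \<longleftrightarrow>
     operator_semigroup smul T \<and>
     coarser_topology \<tau> euclidean \<and>
     (\<forall>s. bounded (range s) \<and> Cauchy_sequence_in \<tau> s \<longrightarrow> (\<exists>l. limitin \<tau> s l sequentially)) \<and>
     norming smul \<tau> \<and>
     (\<exists>M\<ge>1. \<exists>\<omega>. \<forall>t\<ge>0. onorm (T t) \<le> M * exp (\<omega> * t)) \<and>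
     (\<forall>x. limitin \<tau> (\<lambda>t. T t x) x (at_right 0)) \<and>
     (\<forall>s x. bounded (range s) \<and> limitin \<tau> s x sequentially \<longrightarrow>
        (\<forall>I\<in>\<I>. uniformly_null \<tau> I (\<lambda>n t. T t (s n - x))))"

definition locally_bicontinuous ::
    "('k::{real_normed_field,euclidean_space} \<Rightarrow> 'a::real_normed_vector \<Rightarrow> 'a) \<Rightarrow>
     'a topology \<Rightarrow> (real \<Rightarrow> 'a \<Rightarrow> 'a) \<Rightarrow> bool" where
  "locally_bicontinuous = bicontinuous_on {K. compact K \<and> K \<subseteq> {0..}}"

definition bicontinuous ::
    "('k::{real_normed_field,euclidean_space} \<Rightarrow> 'a::real_normed_vector \<Rightarrow> 'a) \<Rightarrow>
     'a topology \<Rightarrow> (real \<Rightarrow> 'a \<Rightarrow> 'a) \<Rightarrow> bool" where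
  "bicontinuous = bicontinuous_on {{0..}}"

lemma bicontinuous_imp_locally_bicontinuous:
  assumes "bicontinuous smul \<tau> T"
  shows "locally_bicontinuous smul \<tau> T"
proof -
  have *: "uniformly_null \<tau> I y" if "uniformly_null \<tau> J y" "I \<subseteq> J" for I J y
    unfolding uniformly_null_def
  proof (intro allI impI)
    fix U assume "openin \<tau> U \<and> 0 \<in> U"
    with that(1) have "\<forall>\<^sub>F n in sequentially. \<forall>t\<in>J. y n t \<in> U"
      unfolding uniformly_null_def by blast
    then show "\<forall>\<^sub>F n in sequentially. \<forall>t\<in>I. y n t \<in> U"
      by (rule eventually_mono) (use that(2) in blast)
  qed
  then show ?thesis
    using assms unfolding bicontinuous_def locally_bicontinuous_def bicontinuous_on_def
    by (auto intro: *[where J = "{0..}"])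
qed

definition generator_graph ::
    "'a::real_normed_vector topology \<Rightarrow> (real \<Rightarrow> 'a \<Rightarrow> 'a) \<Rightarrow> ('a \<times> 'a) set" where
  "generator_graph \<gamma> T = {(x, y). limitin \<gamma> (\<lambda>t. (1 / t) *\<^sub>R (T t x - x)) y (at_right 0)}"

definition neg_graph :: "('a \<times> 'a::ab_group_add) set \<Rightarrow> ('a \<times> 'a) set" where
  "neg_graph G = {(x, - y) | x y. (x, y) \<in> G}"

definition sequential_closure :: "'a topology \<Rightarrow> ('a \<times> 'a) set \<Rightarrow> ('a \<times> 'a) set" where
  "sequential_closure \<gamma> G =
     \<Inter>{C. sequentially_closedin (prod_topology \<gamma> \<gamma>) C \<and> G \<subseteq> C}"

definition has_pettis_integral ::
    "('k::{real_normed_field,euclidean_space} \<Rightarrow> 'a::real_normed_vector \<Rightarrow> 'a) \<Rightarrow> 'a topology \<Rightarrow>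
     real measure \<Rightarrow> real set \<Rightarrow> (real \<Rightarrow> 'a) \<Rightarrow> 'a \<Rightarrow> bool" where
  "has_pettis_integral smul \<gamma> M S g x \<longleftrightarrow>
     (\<forall>\<phi> \<in> top_dual smul \<gamma>. set_integrable M S (\<lambda>s. \<phi> (g s)) \<and> \<phi> x = (LINT s:S|M. \<phi> (g s)))"

definition pettis_integrable ::
    "('k::{real_normed_field,euclidean_space} \<Rightarrow> 'a::real_normed_vector \<Rightarrow> 'a) \<Rightarrow> 'a topology \<Rightarrow>
     real measure \<Rightarrow> real set \<Rightarrow> (real \<Rightarrow> 'a) \<Rightarrow> bool" where
  "pettis_integrable smul \<gamma> M S g \<longleftrightarrow> (\<exists>x. has_pettis_integral smul \<gamma> M S g x)"

text \<open>Unspecified unless \<open>g\<close> is Pettis integrable and the dual of \<open>\<gamma>\<close> separates points.\<close>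
definition pettis_integral ::
    "('k::{real_normed_field,euclidean_space} \<Rightarrow> 'a::real_normed_vector \<Rightarrow> 'a) \<Rightarrow> 'a topology \<Rightarrow>
     real measure \<Rightarrow> real set \<Rightarrow> (real \<Rightarrow> 'a) \<Rightarrow> 'a" where
  "pettis_integral smul \<gamma> M S g = (THE x. has_pettis_integral smul \<gamma> M S g x)"

definition Bernstein_function :: "(real \<Rightarrow> real) \<Rightarrow> bool" where
  "Bernstein_function f \<longleftrightarrow>
     (\<forall>x>0. f x \<ge> 0) \<and>
     (\<forall>k. \<forall>x>0. ((deriv ^^ k) f) field_differentiable (at x)) \<and>
     (\<forall>k\<ge>1. \<forall>x>0. (-1) ^ (k - 1) * (deriv ^^ k) f x \<ge> 0)"

text \<open>
  Measures on an interval \<open>S\<close> are represented by Borel measures on the line that do not charge the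
  complement of \<open>S\<close>, so that \<open>\<star>\<close> applies. For Borel measures on an interval, finiteness on compact
  sets already implies regularity.
\<close>
definition Radon_measure_on :: "real set \<Rightarrow> real measure \<Rightarrow> bool" where
  "Radon_measure_on S M \<longleftrightarrow>
     sets M = sets borel \<and> emeasure M (- S) = 0 \<and>
     (\<forall>K. compact K \<and> K \<subseteq> S \<longrightarrow> emeasure M K < \<infinity>)"

definition Levy_triplet :: "(real \<Rightarrow> real) \<Rightarrow> real \<Rightarrow> real \<Rightarrow> real measure \<Rightarrow> bool" where
  "Levy_triplet f a b \<mu> \<longleftrightarrow>
     a \<ge> 0 \<and> b \<ge> 0 \<and> Radon_measure_on {0<..} \<mu> \<and>
     (\<integral>\<^sup>+t\<in>{0<..}. ennreal (min 1 t) \<partial>\<mu>) < \<infinity> \<and>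
     (\<forall>l>0. f l = a + b * l + (LINT t:{0<..}|\<mu>. 1 - exp (- l * t)))"

definition vaguely_continuous :: "(real \<Rightarrow> real measure) \<Rightarrow> bool" where
  "vaguely_continuous \<nu> \<longleftrightarrow>
     (\<forall>g :: real \<Rightarrow> real. continuous_on {0..} g \<and> (\<exists>R. \<forall>s>R. g s = 0) \<longrightarrow>
        continuous_on {0..} (\<lambda>t. LINT s:{0..}|\<nu> t. g s))"

definition convolution_semigroup :: "(real \<Rightarrow> real measure) \<Rightarrow> bool" where
  "convolution_semigroup \<nu> \<longleftrightarrow>
     (\<forall>t\<ge>0. Radon_measure_on {0..} (\<nu> t) \<and> emeasure (\<nu> t) {0..} \<le> 1) \<and>
     \<nu> 0 = return borel 0 \<and>
     (\<forall>s\<ge>0. \<forall>t\<ge>0. \<nu> t \<star> \<nu> s = \<nu> (t + s))"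

definition associated_convolution_semigroup ::
    "(real \<Rightarrow> real) \<Rightarrow> (real \<Rightarrow> real measure) \<Rightarrow> bool" where
  "associated_convolution_semigroup f \<nu> \<longleftrightarrow>
     convolution_semigroup \<nu> \<and> vaguely_continuous \<nu> \<and>
     (\<forall>t\<ge>0. \<forall>l>0. (LINT s:{0..}|\<nu> t. exp (- l * s)) = exp (- t * f l))"

definition subordinated_semigroup ::
    "('k::{real_normed_field,euclidean_space} \<Rightarrow> 'a::real_normed_vector \<Rightarrow> 'a) \<Rightarrow> 'a topology \<Rightarrow>
     (real \<Rightarrow> real measure) \<Rightarrow> (real \<Rightarrow> 'a \<Rightarrow> 'a) \<Rightarrow> real \<Rightarrow> 'a \<Rightarrow> 'a" where
  "subordinated_semigroup smul \<gamma> \<nu> T t x = pettis_integral smul \<gamma> (\<nu> t) {0..} (\<lambda>s. T s x)"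

text \<open>
  The graph of the operator \<open>x \<mapsto> a x + b A x + \<integral> (x - T\<^sub>t x) \<mu>(dt)\<close> with the domain of \<open>A\<close>, where
  \<open>- A\<close> is the generator of \<open>T\<close>.
\<close>
definition Phillips_graph ::
    "('k::{real_normed_field,euclidean_space} \<Rightarrow> 'a::real_normed_vector \<Rightarrow> 'a) \<Rightarrow> 'a topology \<Rightarrow>
     real \<Rightarrow> real \<Rightarrow> real measure \<Rightarrow> (real \<Rightarrow> 'a \<Rightarrow> 'a) \<Rightarrow> ('a \<times> 'a) set" where
  "Phillips_graph smul \<gamma> a b \<mu> T =
     {(x, a *\<^sub>R x + b *\<^sub>R Ax + pettis_integral smul \<gamma> \<mu> {0<..} (\<lambda>t. x - T t x)) | x Ax.
        (x, Ax) \<in> neg_graph (generator_graph \<gamma> T)}"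

end

theory Submission
  imports Defs "HOL-Real_Asymp.Real_Asymp"
begin

text \<open>
  A sequence converges in the mixed topology iff it is norm bounded and \<open>\<tau>\<close>-convergent, so everything can
  be phrased with such sequences, with the continuous seminorms of \<open>\<tau>\<close>, and with the sequentially
  continuous functionals \<open>\<Phi>\<close>, which contain the dual of the mixed topology.

  A bounded continuous \<open>G\<close> on \<open>[0, \<infinity>)\<close> is integrated against a finite measure \<open>\<rho>\<close> by integrating its Bernstein
  polynomials in the variable \<open>exp (- s)\<close>: their integrals form a bounded \<open>\<tau>\<close>-Cauchy sequence. As these
  polynomials see \<open>\<rho>\<close> only through its Laplace transform, pointwise convergence of Laplace transforms
  implies convergence of the integrals of \<open>G\<close> in \<open>\<tau>\<close>. All operators \<open>x \<mapsto> \<integral> T\<^sub>s x \<rho>(ds)\<close> commute and are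
  sequentially continuous; \<open>S\<^sub>t\<close> is one of them, and local equicontinuity of \<open>S\<close> comes from uniform tightness of \<open>\<nu>\<^sub>t\<close>
  for bounded \<open>t\<close>.

  For \<open>x\<close> in the domain of the generator of \<open>T\<close>, the quotient \<open>(S\<^sub>t x - x) / t\<close> is, up to the killing term, the
  integral of \<open>(T\<^sub>s x - x) / (1 - exp (- s))\<close> against \<open>(1 - exp (- s)) \<nu>\<^sub>t(ds) / t\<close>, and these measures converge to
  \<open>b \<delta>\<^sub>0 + (1 - exp (- s)) \<mu>(ds)\<close>. Hence \<open>- A\<^sub>f\<close> is a restriction of the generator of \<open>S\<close>, which is
  sequentially closed. Conversely the averages \<open>n \<integral>\<^sub>0\<^sup>1\<^sup>/\<^sup>n T\<^sub>s x ds\<close> lie in the domain of \<open>A\<close> and, if \<open>x\<close> is in the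
  domain of the generator of \<open>S\<close>, converge to \<open>x\<close> in its graph.
\<close>

section \<open>Seminorms of a locally convex topology\<close>

text \<open>Only sequences are under control: the mixed topology is known through its convergent
  sequences, and completeness concerns bounded sequences. A vector integral must therefore be the
  limit of one explicit sequence. Bernstein sums provide it with error estimates that hold for all
  finite measures at once, so that limits in the degree and limits in the measure can be
  interchanged.

  The factor \<open>1 - exp (- s)\<close> is chosen for three reasons. It is comparable to
  \<open>min 1 s\<close>, hence makes the Levy measure finite; dividing \<open>T s x - x\<close> by
  it leaves a bounded continuous function for \<open>x\<close> in the domain; and
  \<open>(1 - exp (- s)) * exp (- l * s)\<close> is a difference of two exponentials, so that the
  Laplace transforms of the weighted measures are expressed by the increments of \<open>f\<close>
  from \<open>l\<close> to \<open>l + 1\<close>.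

  Time averages can approximate in the graph of the generator of \<open>S\<close> because they too
  are integrals of orbits against finite measures and hence commute with \<open>S\<close>.\<close>

definition seminorm :: "('a::real_vector \<Rightarrow> real) \<Rightarrow> bool" where
  "seminorm p \<longleftrightarrow> (\<forall>x y. p (x + y) \<le> p x + p y) \<and> (\<forall>r x. p (r *\<^sub>R x) = \<bar>r\<bar> * p x)"

context
  fixes p :: "'a::real_vector \<Rightarrow> real"
  assumes p: "seminorm p"
begin

lemma seminorm_triangle: "p (x + y) \<le> p x + p y"
  using p by (simp add: seminorm_def)

lemma seminorm_scaleR: "p (r *\<^sub>R x) = \<bar>r\<bar> * p x"
  using p by (simp add: seminorm_def)

lemma seminorm_zero: "p 0 = 0"
  using seminorm_scaleR[of 0 0] by simp

lemma seminorm_uminus: "p (- x) = p x"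
  using seminorm_scaleR[of "-1" x] by simp

lemma seminorm_nonneg: "0 \<le> p x"
  using seminorm_triangle[of x "- x"] by (simp add: seminorm_zero seminorm_uminus)

lemma seminorm_diff_commute: "p (x - y) = p (y - x)"
  using seminorm_uminus[of "x - y"] by simp

lemma seminorm_triangle_diff: "p (x - z) \<le> p (x - y) + p (y - z)"
  using seminorm_triangle[of "x - y" "y - z"] by simp

lemma seminorm_reverse_triangle: "\<bar>p x - p y\<bar> \<le> p (x - y)"
  using seminorm_triangle[of "x - y" y] seminorm_triangle[of "y - x" x]
  by (simp add: seminorm_diff_commute[of y x])

lemma seminorm_sum: "p (\<Sum>i\<in>A. g i) \<le> (\<Sum>i\<in>A. p (g i))"
proof (induction A rule: infinite_finite_induct)
  case (insert i A)
  then show ?case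
    using seminorm_triangle[of "g i" "sum g A"] by simp
qed (simp_all add: seminorm_zero)

end

text \<open>Continuity is recorded as openness of the balls about 0. Homogeneity is real although
  the scalars may be complex: the gauges built below come from symmetrized convex sets, which need
  not be balanced.\<close>

definition top_seminorms :: "'a::real_vector topology \<Rightarrow> ('a \<Rightarrow> real) set" where
  "top_seminorms \<tau> = {p. seminorm p \<and> (\<forall>e>0. openin \<tau> {x. p x < e})}"

lemma top_seminorms_seminorm: "p \<in> top_seminorms \<tau> \<Longrightarrow> seminorm p"
  by (simp add: top_seminorms_def)

lemma seminorm_bounded_if_euclidean_open:
  fixes p :: "'a::real_normed_vector \<Rightarrow> real"
  assumes p: "seminorm p" and "open {x. p x < 1}"
  shows "\<exists>c>0. \<forall>x. p x \<le> c * norm x"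
proof -
  have "0 \<in> {x. p x < 1}" by (simp add: seminorm_zero[OF p])
  then obtain d where d: "d > 0" "ball 0 d \<subseteq> {x. p x < 1}"
    using assms(2) open_contains_ball by blast
  have "p x \<le> (2 / d) * norm x" for x
  proof (cases "x = 0")
    case True
    then show ?thesis by (simp add: seminorm_zero[OF p])
  next
    case False
    define r where "r = d / (2 * norm x)"
    have r: "r > 0" using d False by (simp add: r_def)
    have "norm (r *\<^sub>R x) = d / 2" using False d by (simp add: r_def)
    then have "r *\<^sub>R x \<in> ball 0 d" using d(1) by simp
    then have "p (r *\<^sub>R x) < 1" using d(2) by blast
    then have "r * p x < 1" using r by (simp add: seminorm_scaleR[OF p])
    then have "p x < 1 / r" using r by (simp add: field_simps)
    also have "1 / r = (2 / d) * norm x" by (simp add: r_def)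
    finally show ?thesis by simp
  qed
  then show ?thesis using d(1) by (intro exI[of _ "2 / d"]) auto
qed

lemma coarser_euclideanD: "coarser_topology \<tau> euclidean \<Longrightarrow> openin \<tau> U \<Longrightarrow> open U"
  by (auto simp: coarser_topology_def)

lemma top_seminorms_bounded:
  fixes \<tau> :: "'a::real_normed_vector topology"
  assumes "coarser_topology \<tau> euclidean" "p \<in> top_seminorms \<tau>"
  shows "\<exists>c>0. \<forall>x. p x \<le> c * norm x"
  using assms coarser_euclideanD[OF assms(1)]
  by (intro seminorm_bounded_if_euclidean_open) (auto simp: top_seminorms_def)

locale linear_top =
  fixes smul :: "'k::{real_normed_field,euclidean_space} \<Rightarrow> 'a::real_normed_vector \<Rightarrow> 'a"
    and \<tau> :: "'a topology"
  assumes scaling: "normed_scaling smul"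
    and lin: "linear_topology smul \<tau>"
begin

lemma smul_of_real: "smul (of_real r) x = r *\<^sub>R x"
  using scaling by (simp add: normed_scaling_def)

lemma topspace_UNIV [simp]: "topspace \<tau> = UNIV"
  using lin by (simp add: linear_topology_def)

lemma continuous_map_plus:
  assumes "continuous_map X \<tau> g" "continuous_map X \<tau> h"
  shows "continuous_map X \<tau> (\<lambda>x. g x + h x)"
proof -
  have "continuous_map X (prod_topology \<tau> \<tau>) (\<lambda>x. (g x, h x))"
    using assms by (rule continuous_map_pairedI)
  moreover have "continuous_map (prod_topology \<tau> \<tau>) \<tau> (\<lambda>(x, y). x + y)"
    using lin by (simp add: linear_topology_def)
  ultimately show ?thesis using continuous_map_compose by (fastforce simp: o_def)
qed

lemma continuous_map_smul:
  assumes "continuous_map X euclidean c" "continuous_map X \<tau> g"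
  shows "continuous_map X \<tau> (\<lambda>x. smul (c x) (g x))"
proof -
  have "continuous_map X (prod_topology euclidean \<tau>) (\<lambda>x. (c x, g x))"
    using assms by (rule continuous_map_pairedI)
  moreover have "continuous_map (prod_topology euclidean \<tau>) \<tau> (\<lambda>(c, x). smul c x)"
    using lin by (simp add: linear_topology_def)
  ultimately show ?thesis using continuous_map_compose by (fastforce simp: o_def)
qed

lemma continuous_add: "continuous_map \<tau> \<tau> (\<lambda>x. x + v)"
  by (simp add: continuous_map_plus)

lemma continuous_scaleR: "continuous_map \<tau> \<tau> (\<lambda>x. r *\<^sub>R x)"
  using continuous_map_smul[of \<tau> "\<lambda>_. of_real r" "\<lambda>x. x"] by (simp add: smul_of_real)

lemma open_vimage: "continuous_map \<tau> \<tau> g \<Longrightarrow> openin \<tau> U \<Longrightarrow> openin \<tau> {x. g x \<in> U}"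
  using openin_continuous_map_preimage[of \<tau> \<tau> g U] by simp

lemma open_translate: "openin \<tau> U \<Longrightarrow> openin \<tau> {x. x + v \<in> U}"
  by (rule open_vimage[OF continuous_add])

lemma open_affine: "openin \<tau> U \<Longrightarrow> openin \<tau> {x. r *\<^sub>R (x - v) \<in> U}"
  using open_translate[OF open_vimage[OF continuous_scaleR, of U r], of "- v"] by simp

text \<open>The Minkowski functional of a symmetrized convex neighbourhood.\<close>
lemma convex_nbhd_seminorm:
  assumes coarser: "coarser_topology \<tau> euclidean"
    and base: "neighbourhood_base_at 0 convex \<tau>" and W: "openin \<tau> W" "0 \<in> W"
  shows "\<exists>p\<in>top_seminorms \<tau>. {x. p x < 1} \<subseteq> W"
proof -
  obtain U0 V0 where UV0: "openin \<tau> U0" "convex V0" "0 \<in> U0" "U0 \<subseteq> V0" "V0 \<subseteq> W"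
    using base[unfolded neighbourhood_base_at_def, rule_format, of W] W by auto
  \<comment> \<open>The base only yields a convex set between an open set and \<open>W\<close>.
    \<open>U\<close> retains openness, \<open>V\<close> convexity, and both are made
    symmetric.\<close>
  define U where "U = U0 \<inter> {x. (-1) *\<^sub>R (x - 0) \<in> U0}"
  define V where "V = V0 \<inter> uminus ` V0"
  have U: "openin \<tau> U" "0 \<in> U"
    unfolding U_def by (intro openin_Int open_affine UV0) (use UV0 in auto)
  have V: "convex V" "0 \<in> V" unfolding V_def using UV0
    by (auto intro!: convex_Int convex_negations image_eqI[of 0 uminus 0])
  have sym: "- x \<in> V" if "x \<in> V" for x using that unfolding V_def by force
  have UV: "U \<subseteq> V" unfolding U_def V_def using UV0 by force
  obtain d where d: "d > 0" "ball 0 d \<subseteq> U"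
    using coarser_euclideanD[OF coarser U(1)] U(2) open_contains_ball by blast
  define S where "S x = {r. r > 0 \<and> inverse r *\<^sub>R x \<in> V}" for x
  define p where "p x = Inf (S x)" for x
  have bdd: "bdd_below (S x)" for x unfolding S_def by (intro bdd_belowI[of _ 0]) auto
  \<comment> \<open>The gauge is finite because \<open>V\<close> contains a norm ball,
    \<open>\<tau>\<close> being coarser than the norm topology. The \<open>+ 1\<close> keeps the
    scale positive at \<open>x = 0\<close>.\<close>
  have ne: "S x \<noteq> {}" for x
  proof -
    have "norm (inverse (2 * (norm x + 1) / d) *\<^sub>R x) < d"
    proof -
      have "norm (inverse (2 * (norm x + 1) / d) *\<^sub>R x) = d * (norm x / (2 * (norm x + 1)))"
        using d(1) by (simp add: divide_simps)
      also have "\<dots> < d * 1"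
        using d(1) by (intro mult_strict_left_mono) (auto simp: divide_simps add_nonneg_pos)
      finally show ?thesis by simp
    qed
    then have "inverse (2 * (norm x + 1) / d) *\<^sub>R x \<in> ball 0 d" by simp
    then have "inverse (2 * (norm x + 1) / d) *\<^sub>R x \<in> V" using d UV by blast
    then have "2 * (norm x + 1) / d \<in> S x" using d(1) by (auto simp: S_def divide_simps add_nonneg_pos)
    then show ?thesis by blast
  qed
  have p_le: "p x \<le> r" if "r > 0" "inverse r *\<^sub>R x \<in> V" for x r
    unfolding p_def by (rule cInf_lower[OF _ bdd]) (use that in \<open>simp add: S_def\<close>)
  have p_nonneg: "0 \<le> p x" for x
    unfolding p_def by (rule cInf_greatest[OF ne]) (auto simp: S_def)
  have p_less: "\<exists>r. 0 < r \<and> r < e \<and> inverse r *\<^sub>R x \<in> V" if "p x < e" for x e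
    using that cInf_lessD[OF ne, of x e] by (auto simp: p_def S_def)
  have add: "p (x + y) \<le> p x + p y" for x y
  proof (rule field_le_epsilon)
    fix e :: real assume e: "0 < e"
    obtain r where r: "0 < r" "r < p x + e/2" "inverse r *\<^sub>R x \<in> V"
      using p_less[of x "p x + e/2"] e by auto
    obtain s where s: "0 < s" "s < p y + e/2" "inverse s *\<^sub>R y \<in> V"
      using p_less[of y "p y + e/2"] e by auto
    have rs: "0 \<le> r / (r + s)" "0 \<le> s / (r + s)" "r / (r + s) + s / (r + s) = 1"
      using r(1) s(1) by (auto simp: add_divide_distrib[symmetric])
    have "(r / (r + s)) *\<^sub>R (inverse r *\<^sub>R x) + (s / (r + s)) *\<^sub>R (inverse s *\<^sub>R y) \<in> V"
      by (rule convexD[OF V(1) r(3) s(3) rs])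
    also have "(r / (r + s)) *\<^sub>R (inverse r *\<^sub>R x) + (s / (r + s)) *\<^sub>R (inverse s *\<^sub>R y)
        = inverse (r + s) *\<^sub>R (x + y)"
      using r(1) s(1) by (simp add: field_simps scaleR_add_right)
    finally have "p (x + y) \<le> r + s" using r s by (intro p_le) auto
    then show "p (x + y) \<le> p x + p y + e" using r s by linarith
  qed
  have zero: "p 0 = 0"
  proof (rule antisym[OF _ p_nonneg])
    show "p 0 \<le> 0" by (rule field_le_epsilon) (use p_le[of _ 0] V in auto)
  qed
  have pos1: "p (c *\<^sub>R x) \<le> c * p x" if c: "c > 0" for c x
  proof (rule field_le_epsilon)
    fix e :: real assume e: "0 < e"
    obtain r where r: "0 < r" "r < p x + e/c" "inverse r *\<^sub>R x \<in> V"
      using p_less[of x "p x + e/c"] e c by auto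
    have "p (c *\<^sub>R x) \<le> c * r"
    proof (rule p_le)
      have "inverse (c * r) *\<^sub>R (c *\<^sub>R x) = inverse r *\<^sub>R x" using c by (simp add: field_simps)
      then show "inverse (c * r) *\<^sub>R (c *\<^sub>R x) \<in> V" using r(3) by (simp only:)
    qed (use r c in simp)
    also have "\<dots> \<le> c * (p x + e/c)" using r(2) c by (intro mult_left_mono) auto
    also have "\<dots> = c * p x + e" using c by (simp add: field_simps)
    finally show "p (c *\<^sub>R x) \<le> c * p x + e" .
  qed
  have pos: "p (c *\<^sub>R x) = c * p x" if c: "c > 0" for c x
  proof (rule antisym[OF pos1[OF c]])
    have "p (inverse c *\<^sub>R (c *\<^sub>R x)) \<le> inverse c * p (c *\<^sub>R x)" by (rule pos1) (use c in simp)
    then show "c * p x \<le> p (c *\<^sub>R x)" using c by (simp add: field_simps)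
  qed
  have neg: "p (- x) = p x" for x
  proof -
    have "S (- x) = S x" for x
      unfolding S_def using sym by (metis (no_types, lifting) minus_minus scaleR_minus_right)
    then show ?thesis by (simp add: p_def)
  qed
  have scale: "p (r *\<^sub>R x) = \<bar>r\<bar> * p x" for r x
  proof (cases r "0::real" rule: linorder_cases)
    case less
    then show ?thesis using pos[of "- r" x] neg[of "r *\<^sub>R x"] by simp
  next
    case greater
    then show ?thesis by (simp add: pos)
  qed (simp add: zero)
  have sn: "seminorm p" unfolding seminorm_def using add scale by blast
  have opn: "openin \<tau> {x. p x < e}" for e
  proof (subst openin_subopen, safe)
    fix x assume x: "p x < e"
    define c where "c = (e - p x) / 2"
    have c: "c > 0" using x by (simp add: c_def)
    have "p y < e" if "inverse c *\<^sub>R (y - x) \<in> U" for y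
    proof -
      have "p (y - x) \<le> c" by (rule p_le) (use that UV c in auto)
      then have "p y \<le> p x + c" using add[of "y - x" x] by simp
      then show ?thesis using x by (simp add: c_def field_simps)
    qed
    then show "\<exists>T. openin \<tau> T \<and> x \<in> T \<and> T \<subseteq> {x. p x < e}"
      using open_affine[OF U(1), of "inverse c" x] U(2)
      by (intro exI[of _ "{y. inverse c *\<^sub>R (y - x) \<in> U}"]) auto
  qed
  have "x \<in> W" if "p x < 1" for x
  proof -
    obtain r where r: "0 < r" "r < 1" "inverse r *\<^sub>R x \<in> V" using p_less[OF \<open>p x < 1\<close>] by blast
    have "r *\<^sub>R (inverse r *\<^sub>R x) + (1 - r) *\<^sub>R 0 \<in> V"
      by (rule convexD[OF V(1) r(3) V(2)]) (use r in auto)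
    then show ?thesis using r UV0 by (auto simp: V_def)
  qed
  then show ?thesis using sn opn by (intro bexI[of _ p]) (auto simp: top_seminorms_def)
qed

lemma limitin_seminorms:
  assumes "coarser_topology \<tau> euclidean" "neighbourhood_base_at 0 convex \<tau>"
  shows "limitin \<tau> s l F \<longleftrightarrow> (\<forall>p\<in>top_seminorms \<tau>. ((\<lambda>n. p (s n - l)) \<longlongrightarrow> 0) F)"
proof (intro iffI ballI)
  fix p assume l: "limitin \<tau> s l F" and p: "p \<in> top_seminorms \<tau>"
  have sn: "seminorm p" using p by (rule top_seminorms_seminorm)
  show "((\<lambda>n. p (s n - l)) \<longlongrightarrow> 0) F"
  proof (rule tendstoI)
    fix e :: real assume e: "e > 0"
    have "openin \<tau> {x. x + - l \<in> {x. p x < e}}"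
      by (rule open_translate) (use p e in \<open>simp add: top_seminorms_def\<close>)
    from limitinD[OF l this] show "eventually (\<lambda>n. dist (p (s n - l)) 0 < e) F"
      using e by (simp add: seminorm_zero[OF sn] seminorm_nonneg[OF sn])
  qed
next
  assume *: "\<forall>p\<in>top_seminorms \<tau>. ((\<lambda>n. p (s n - l)) \<longlongrightarrow> 0) F"
  show "limitin \<tau> s l F"
    unfolding limitin_def
  proof (intro conjI allI impI)
    fix U assume U: "openin \<tau> U \<and> l \<in> U"
    obtain p where p: "p \<in> top_seminorms \<tau>" "{x. p x < 1} \<subseteq> {x. x + l \<in> U}"
      using convex_nbhd_seminorm[OF assms, of "{x. x + l \<in> U}"] open_translate[of U l] U by auto
    have "eventually (\<lambda>n. p (s n - l) < 1) F"
      using * p(1) order_tendstoD(2)[of "\<lambda>n. p (s n - l)" 0 F 1] by auto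
    then show "eventually (\<lambda>n. s n \<in> U) F"
      by (rule eventually_mono) (use p(2) in force)
  qed simp
qed

lemma Cauchy_sequence_in_seminorms:
  assumes "coarser_topology \<tau> euclidean" "neighbourhood_base_at 0 convex \<tau>"
    and s: "\<And>p e. p \<in> top_seminorms \<tau> \<Longrightarrow> e > 0 \<Longrightarrow> \<exists>N. \<forall>m\<ge>N. \<forall>n\<ge>N. p (s m - s n) < e"
  shows "Cauchy_sequence_in \<tau> s"
  unfolding Cauchy_sequence_in_def
proof (intro allI impI)
  fix U assume "openin \<tau> U \<and> 0 \<in> U"
  then obtain p where p: "p \<in> top_seminorms \<tau>" "{x. p x < 1} \<subseteq> U"
    using convex_nbhd_seminorm[OF assms(1,2)] by blast
  obtain N where "\<forall>m\<ge>N. \<forall>n\<ge>N. p (s m - s n) < 1" using s[OF p(1), of 1] by auto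
  then show "\<exists>N. \<forall>m\<ge>N. \<forall>n\<ge>N. s m - s n \<in> U" using p(2) by blast
qed

lemma top_dual_scaleR:
  assumes "Vector_Spaces.linear smul (*) \<phi>"
  shows "\<phi> (r *\<^sub>R x) = r *\<^sub>R \<phi> x"
proof -
  have "\<phi> (smul (of_real r) x) = of_real r * \<phi> x"
    using assms by (simp add: Vector_Spaces.linear_iff)
  then show ?thesis by (simp add: smul_of_real scaleR_conv_of_real)
qed

lemma linear_seminorm:
  assumes "Vector_Spaces.linear smul (*) \<phi>"
  shows "seminorm (\<lambda>x. norm (\<phi> x))"
  unfolding seminorm_def
  using top_dual_scaleR[OF assms] assms
  by (auto simp: Vector_Spaces.linear_iff intro: norm_triangle_ineq)

lemma top_dual_seminorm:
  assumes "\<phi> \<in> top_dual smul \<tau>"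
  shows "(\<lambda>x. norm (\<phi> x)) \<in> top_seminorms \<tau>"
  unfolding top_seminorms_def
proof (intro CollectI conjI allI impI)
  show "seminorm (\<lambda>x. norm (\<phi> x))" using assms linear_seminorm by (auto simp: top_dual_def)
  fix e :: real
  have "continuous_map \<tau> euclidean \<phi>" using assms by (simp add: top_dual_def)
  then have "openin \<tau> {x \<in> topspace \<tau>. \<phi> x \<in> ball 0 e}"
    by (rule openin_continuous_map_preimage) simp
  then show "openin \<tau> {x. norm (\<phi> x) < e}" by simp
qed

lemma top_dual_bounded_linear:
  assumes "coarser_topology \<tau> euclidean" "\<phi> \<in> top_dual smul \<tau>"
  shows "bounded_linear \<phi>"
proof -
  have l: "Vector_Spaces.linear smul (*) \<phi>" using assms(2) by (simp add: top_dual_def)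
  obtain c where "\<forall>x. norm (\<phi> x) \<le> c * norm x"
    using top_seminorms_bounded[OF assms(1) top_dual_seminorm[OF assms(2)]] by blast
  then show ?thesis
    using top_dual_scaleR[OF l] l
    by (intro bounded_linear_intro[of _ c]) (auto simp: Vector_Spaces.linear_iff mult.commute)
qed

text \<open>Estimates use the norming property in this form; with \<open>C = 0\<close> it separates
  points. The zero functional makes the supremum range over a nonempty set.\<close>

lemma norming_bound:
  assumes coarser: "coarser_topology \<tau> euclidean" and nrm: "norming smul \<tau>"
    and bound: "\<And>\<phi>. \<phi> \<in> top_dual smul \<tau> \<Longrightarrow> (\<And>y. norm (\<phi> y) \<le> norm y) \<Longrightarrow> norm (\<phi> x) \<le> C"
  shows "norm x \<le> C"
proof -
  let ?A = "{\<phi> \<in> top_dual smul \<tau>. onorm \<phi> \<le> 1}"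
  have "(\<lambda>_. 0) \<in> ?A"
  proof -
    have "Vector_Spaces.linear smul (*) (\<lambda>_. 0)"
      using scaling vector_space_over_itself.vector_space_axioms
      by (auto simp: normed_scaling_def Vector_Spaces.linear_iff)
    then show ?thesis by (simp add: top_dual_def onorm_zero)
  qed
  moreover have "norm (\<phi> x) \<le> C" if "\<phi> \<in> ?A" for \<phi>
  proof (rule bound)
    fix y
    have "norm (\<phi> y) \<le> onorm \<phi> * norm y"
      using that by (intro onorm top_dual_bounded_linear[OF coarser]) auto
    also have "\<dots> \<le> 1 * norm y" using that by (intro mult_right_mono) auto
    finally show "norm (\<phi> y) \<le> norm y" by simp
  qed (use that in auto)
  ultimately have "(SUP \<phi>\<in>?A. norm (\<phi> x)) \<le> C" by (intro cSUP_least) auto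
  then show ?thesis using nrm by (simp add: norming_def)
qed

end

section \<open>Sequences in the mixed topology\<close>

text \<open>The filter \<open>at_right a\<close> has a countable base, so sequences decide
  convergence along it in an arbitrary \<open>X\<close>. Generators and strong continuity are
  defined by this filter, whereas the mixed topology is understood along sequences.\<close>

lemma limitin_at_right_sequential:
  fixes g :: "real \<Rightarrow> 'a"
  shows "limitin X g l (at_right a) \<longleftrightarrow>
    (\<forall>r. (\<forall>n. a < r n) \<and> r \<longlonglongrightarrow> a \<longrightarrow> limitin X (\<lambda>n. g (r n)) l sequentially)"
proof (intro iffI allI impI)
  fix r :: "nat \<Rightarrow> real"
  assume l: "limitin X g l (at_right a)" and r: "(\<forall>n. a < r n) \<and> r \<longlonglongrightarrow> a"
  have "filterlim r (at_right a) sequentially"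
    using r by (auto simp: filterlim_at intro!: always_eventually)
  then show "limitin X (\<lambda>n. g (r n)) l sequentially"
    using l by (auto simp: limitin_def filterlim_iff)
next
  assume *: "\<forall>r. (\<forall>n. a < r n) \<and> r \<longlonglongrightarrow> a \<longrightarrow> limitin X (\<lambda>n. g (r n)) l sequentially"
  have "l \<in> topspace X"
  proof -
    have "(\<lambda>n. a + inverse (real (Suc n))) \<longlonglongrightarrow> a"
      using tendsto_add[OF tendsto_const[of a] LIMSEQ_inverse_real_of_nat] by simp
    then show ?thesis
      using *[rule_format, of "\<lambda>n. a + inverse (real (Suc n))"] by (simp add: limitin_def)
  qed
  moreover have "eventually (\<lambda>x. g x \<in> U) (at_right a)" if "openin X U" "l \<in> U" for U
    by (rule sequentially_imp_eventually_at_right[of a "a + 1"])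
       (use * that in \<open>auto simp: limitin_def\<close>)
  ultimately show "limitin X g l (at_right a)" by (simp add: limitin_def)
qed

text \<open>The coarsest refinement of \<open>\<tau>\<close> for which the seminorm \<open>q\<close> is continuous.\<close>
definition refined_topology :: "'a::real_normed_vector topology \<Rightarrow> ('a \<Rightarrow> real) \<Rightarrow> 'a topology" where
  "refined_topology \<tau> q =
     topology (\<lambda>U. \<forall>x\<in>U. \<exists>V e. openin \<tau> V \<and> x \<in> V \<and> 0 < e \<and> (\<forall>y\<in>V. q (y - x) < e \<longrightarrow> y \<in> U))"

lemma openin_refined_topology:
  "openin (refined_topology \<tau> q) U \<longleftrightarrow>
     (\<forall>x\<in>U. \<exists>V e. openin \<tau> V \<and> x \<in> V \<and> 0 < e \<and> (\<forall>y\<in>V. q (y - x) < e \<longrightarrow> y \<in> U))"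
proof -
  define P where "P U \<longleftrightarrow>
    (\<forall>x\<in>U. \<exists>V e. openin \<tau> V \<and> x \<in> V \<and> 0 < e \<and> (\<forall>y\<in>V. q (y - x) < e \<longrightarrow> y \<in> U))" for U
  have PD: "\<exists>V e. openin \<tau> V \<and> x \<in> V \<and> 0 < e \<and> (\<forall>y\<in>V. q (y - x) < e \<longrightarrow> y \<in> U)"
    if "P U" "x \<in> U" for U x using that unfolding P_def by blast
  have "istopology P"
    unfolding istopology_def
  proof (intro conjI allI impI)
    fix S T assume ST: "P S" "P T"
    show "P (S \<inter> T)"
      unfolding P_def
    proof
      fix x assume "x \<in> S \<inter> T"
      then obtain V e V' e' where
        "openin \<tau> V" "x \<in> V" "0 < e" "\<forall>y\<in>V. q (y - x) < e \<longrightarrow> y \<in> S"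
        "openin \<tau> V'" "x \<in> V'" "0 < e'" "\<forall>y\<in>V'. q (y - x) < e' \<longrightarrow> y \<in> T"
        using PD[OF ST(1)] PD[OF ST(2)] by (metis Int_iff)
      then show "\<exists>V e. openin \<tau> V \<and> x \<in> V \<and> 0 < e \<and> (\<forall>y\<in>V. q (y - x) < e \<longrightarrow> y \<in> S \<inter> T)"
        by (intro exI[of _ "V \<inter> V'"] exI[of _ "min e e'"]) auto
    qed
  next
    fix K assume K: "\<forall>S\<in>K. P S"
    show "P (\<Union>K)"
      unfolding P_def
    proof
      fix x assume "x \<in> \<Union>K"
      then obtain S where "S \<in> K" "x \<in> S" by blast
      then obtain V e where "openin \<tau> V" "x \<in> V" "0 < e" "\<forall>y\<in>V. q (y - x) < e \<longrightarrow> y \<in> S"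
        using K PD by metis
      then show "\<exists>V e. openin \<tau> V \<and> x \<in> V \<and> 0 < e \<and> (\<forall>y\<in>V. q (y - x) < e \<longrightarrow> y \<in> \<Union>K)"
        using \<open>S \<in> K\<close> by blast
    qed
  qed
  then show ?thesis
    unfolding refined_topology_def P_def by (simp add: topology_inverse')
qed

context linear_top
begin

context
  fixes q :: "'a \<Rightarrow> real"
  assumes q: "seminorm q" and q_smul: "\<And>c x. q (smul c x) = norm c * q x"
begin

abbreviation "\<sigma> \<equiv> refined_topology \<tau> q"

lemma openin_refined_if_openin: "openin \<tau> U \<Longrightarrow> openin \<sigma> U"
  unfolding openin_refined_topology by (metis zero_less_one)

lemma topspace_refined: "topspace \<sigma> = UNIV"
  using openin_refined_if_openin[of UNIV] openin_topspace[of \<tau>] openin_subset by fastforce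

lemma openin_refined_ball: "openin \<sigma> {x. q (x - v) < e}"
  unfolding openin_refined_topology
proof
  fix x assume "x \<in> {x. q (x - v) < e}"
  then show "\<exists>V d. openin \<tau> V \<and> x \<in> V \<and> 0 < d \<and> (\<forall>y\<in>V. q (y - x) < d \<longrightarrow> y \<in> {x. q (x - v) < e})"
    using openin_topspace[of \<tau>] seminorm_triangle_diff[OF q, of _ v x]
    by (intro exI[of _ UNIV] exI[of _ "e - q (x - v)"]) (auto simp: less_diff_eq intro: le_less_trans)
qed

lemma continuous_map_refined:
  assumes g: "continuous_map X \<tau> g"
    and qg: "\<And>z e. z \<in> topspace X \<Longrightarrow> 0 < e \<Longrightarrow>
      \<exists>W. openin X W \<and> z \<in> W \<and> (\<forall>w\<in>W. q (g w - g z) < e)"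
  shows "continuous_map X \<sigma> g"
  unfolding continuous_map_alt
proof (intro conjI allI impI)
  fix U assume U: "openin \<sigma> U"
  show "openin X (g -` U \<inter> topspace X)"
  proof (subst openin_subopen, safe)
    fix z assume z: "g z \<in> U" "z \<in> topspace X"
    obtain V e where V: "openin \<tau> V" "g z \<in> V" "0 < e" "\<forall>y\<in>V. q (y - g z) < e \<longrightarrow> y \<in> U"
      using U z(1) unfolding openin_refined_topology by blast
    obtain W where W: "openin X W" "z \<in> W" "\<forall>w\<in>W. q (g w - g z) < e"
      using qg[OF z(2) V(3)] by blast
    have "openin X (W \<inter> {x \<in> topspace X. g x \<in> V})"
      by (intro openin_Int W openin_continuous_map_preimage[OF g] V)
    then show "\<exists>T. openin X T \<and> z \<in> T \<and> T \<subseteq> g -` U \<inter> topspace X"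
      using W V z by (intro exI[of _ "W \<inter> {x \<in> topspace X. g x \<in> V}"]) auto
  qed
qed (simp add: topspace_refined)

lemma continuous_map_refined_id: "continuous_map \<sigma> \<tau> (\<lambda>x. x)"
  using openin_refined_if_openin by (auto simp: continuous_map_def topspace_refined)

lemma linear_topology_refined: "linear_topology smul \<sigma>"
  unfolding linear_topology_def
proof (intro conjI topspace_refined continuous_map_refined)
  have snd: "continuous_map (prod_topology X \<sigma>) \<tau> snd" for X :: "'x topology"
    using continuous_map_compose[OF continuous_map_snd continuous_map_refined_id] by (simp add: o_def)
  have fst: "continuous_map (prod_topology \<sigma> \<sigma>) \<tau> fst"
    using continuous_map_compose[OF continuous_map_fst continuous_map_refined_id] by (simp add: o_def)
  show "continuous_map (prod_topology \<sigma> \<sigma>) \<tau> (\<lambda>(x, y). x + y)"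
    "continuous_map (prod_topology euclidean \<sigma>) \<tau> (\<lambda>(c, x). smul c x)"
    using continuous_map_plus[OF fst snd] continuous_map_smul[OF continuous_map_fst snd]
    by (simp_all add: split_def)
next
  fix z :: "'a \<times> 'a" and e :: real assume "0 < e"
  let ?W = "{x. q (x - fst z) < e/2} \<times> {x. q (x - snd z) < e/2}"
  have "openin (prod_topology \<sigma> \<sigma>) ?W"
    by (subst openin_prod_Times_iff) (intro disjI2 conjI openin_refined_ball)
  moreover have "z \<in> ?W" using \<open>0 < e\<close> by (cases z) (simp add: seminorm_zero[OF q])
  moreover have "q (case_prod (+) w - case_prod (+) z) < e" if "w \<in> ?W" for w
  proof -
    have "case_prod (+) w - case_prod (+) z = (fst w - fst z) + (snd w - snd z)"
      by (simp add: split_def)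
    then have "q (case_prod (+) w - case_prod (+) z) \<le> q (fst w - fst z) + q (snd w - snd z)"
      by (metis seminorm_triangle[OF q])
    then show ?thesis using that by (auto simp: mem_Times_iff)
  qed
  ultimately show "\<exists>W. openin (prod_topology \<sigma> \<sigma>) W \<and> z \<in> W \<and>
      (\<forall>w\<in>W. q (case_prod (+) w - case_prod (+) z) < e)"
    by blast
next
  fix z :: "'k \<times> 'a" and e :: real assume e: "0 < e"
  obtain c0 x0 where z: "z = (c0, x0)" by fastforce
  \<comment> \<open>The increment is split as \<open>smul c (x - x0) + smul (c - c0) x0\<close>.
    \<open>d\<close> makes the second term at most \<open>e / 2\<close> and forces
    \<open>norm c \<le> norm c0 + 1\<close>; \<open>d'\<close> then makes the first term less than
    \<open>e / 2\<close>.\<close>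
  define d where "d = min 1 (e / (2 * (q x0 + 1)))"
  define d' where "d' = e / (2 * (norm c0 + 1))"
  have q0: "q x0 \<ge> 0" by (rule seminorm_nonneg[OF q])
  have d: "0 < d" "0 < d'" "d \<le> 1" using e q0 by (auto simp: d_def d'_def add_nonneg_pos)
  have dq: "d * q x0 \<le> e / 2"
  proof -
    have "d * q x0 \<le> e / (2 * (q x0 + 1)) * q x0" using q0 by (intro mult_right_mono) (auto simp: d_def)
    also have "\<dots> \<le> e / 2" using e q0 by (simp add: divide_simps)
    finally show ?thesis .
  qed
  let ?W = "ball c0 d \<times> {x. q (x - x0) < d'}"
  have "openin (prod_topology euclidean \<sigma>) ?W"
    by (subst openin_prod_Times_iff) (intro disjI2 conjI openin_refined_ball; simp)
  moreover have "z \<in> ?W" using d by (simp add: z seminorm_zero[OF q])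
  moreover have "q (case_prod smul w - case_prod smul z) < e" if "w \<in> ?W" for w
  proof -
    obtain c x where w: "w = (c, x)" by fastforce
    have cx: "norm (c - c0) < d" "q (x - x0) < d'"
      using that by (auto simp: w dist_norm norm_minus_commute)
    have vs: "vector_space smul" using scaling by (simp add: normed_scaling_def)
    have "case_prod smul w - case_prod smul z = smul c (x - x0) + smul (c - c0) x0"
      by (simp add: w z vector_space.vector_space_assms[OF vs] module.scale_right_diff_distrib
          module.scale_left_diff_distrib vs[unfolded vector_space_def] module_def)
    then have "q (case_prod smul w - case_prod smul z) \<le> norm c * q (x - x0) + norm (c - c0) * q x0"
      using seminorm_triangle[OF q, of "smul c (x - x0)" "smul (c - c0) x0"] by (simp only: q_smul)
    moreover have "norm c \<le> norm c0 + 1"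
      using cx(1) d(3) norm_triangle_ineq2[of c c0] by linarith
    then have "norm c * q (x - x0) \<le> (norm c0 + 1) * q (x - x0)"
      by (intro mult_right_mono seminorm_nonneg[OF q])
    moreover have "(norm c0 + 1) * q (x - x0) < (norm c0 + 1) * d'"
      using cx by (intro mult_strict_left_mono) (auto simp: add_nonneg_pos)
    moreover have "(norm c0 + 1) * d' = e / 2"
      by (simp add: d'_def divide_simps) (smt (verit) norm_ge_zero)
    moreover have "norm (c - c0) * q x0 \<le> d * q x0"
      using cx q0 by (intro mult_right_mono) auto
    ultimately show ?thesis using dq by linarith
  qed
  ultimately show "\<exists>W. openin (prod_topology euclidean \<sigma>) W \<and> z \<in> W \<and>
      (\<forall>w\<in>W. q (case_prod smul w - case_prod smul z) < e)"
    by blast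
qed

lemma coincide_on_bounded_refined:
  assumes "\<And>B z e. bounded B \<Longrightarrow> z \<in> B \<Longrightarrow> 0 < e \<Longrightarrow>
    \<exists>W. openin \<tau> W \<and> z \<in> W \<and> (\<forall>w\<in>W \<inter> B. q (w - z) < e)"
  shows "coincide_on_bounded \<sigma> \<tau>"
  unfolding coincide_on_bounded_def
proof (intro allI impI)
  fix B :: "'a set" assume B: "bounded B"
  have "continuous_map (subtopology \<tau> B) \<sigma> (\<lambda>x. x)"
  proof (rule continuous_map_refined)
    fix z e assume "z \<in> topspace (subtopology \<tau> B)" and e: "(0::real) < e"
    then have "z \<in> B" by simp
    moreover obtain W where "openin \<tau> W" "z \<in> W" "\<forall>w\<in>W \<inter> B. q (w - z) < e"
      using assms[OF B \<open>z \<in> B\<close> e] by blast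
    ultimately show "\<exists>W. openin (subtopology \<tau> B) W \<and> z \<in> W \<and> (\<forall>w\<in>W. q (w - z) < e)"
      by (intro exI[of _ "W \<inter> B"]) (auto simp: openin_subtopology)
  qed (simp add: continuous_map_from_subtopology)
  then have *: "openin (subtopology \<tau> B) (U \<inter> B)" if "openin \<sigma> U" for U
    using that by (auto simp: continuous_map_alt vimage_def Int_def)
  show "subtopology \<sigma> B = subtopology \<tau> B"
    unfolding topology_eq
  proof
    fix S
    show "openin (subtopology \<sigma> B) S = openin (subtopology \<tau> B) S"
      using * openin_refined_if_openin by (auto simp: openin_subtopology)
  qed
qed

end

text \<open>The last hypothesis says that \<open>q\<close> is \<open>\<tau>\<close>-continuous on
  bounded sets, so refining \<open>\<tau>\<close> by \<open>q\<close> changes nothing there. The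
  refinement is linear, and the mixed topology is the finest linear topology agreeing with
  \<open>\<tau>\<close> on bounded sets. Maximality thus supplies open sets without a neighbourhood
  base.\<close>

lemma mixed_seminorm_open:
  assumes "seminorm q" and "\<And>c x. q (smul c x) = norm c * q x"
    and "\<And>B z e. bounded B \<Longrightarrow> z \<in> B \<Longrightarrow> 0 < e \<Longrightarrow>
      \<exists>W. openin \<tau> W \<and> z \<in> W \<and> (\<forall>w\<in>W \<inter> B. q (w - z) < e)"
  shows "openin (mixed_topology smul \<tau>) {x. q (x - v) < e}"
  using is_mixed_topology_mixed_topology[OF lin] linear_topology_refined[OF assms(1,2)]
    coincide_on_bounded_refined[OF assms] openin_refined_ball[OF assms(1,2)]
  unfolding is_mixed_topology_def coarser_topology_def by blast

lemma mixed_finer: "openin \<tau> U \<Longrightarrow> openin (mixed_topology smul \<tau>) U"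
  using is_mixed_topology_mixed_topology[OF lin] lin
  unfolding is_mixed_topology_def coarser_topology_def coincide_on_bounded_def by blast

lemma topspace_mixed [simp]: "topspace (mixed_topology smul \<tau>) = UNIV"
  using is_mixed_topology_mixed_topology[OF lin]
  by (simp add: is_mixed_topology_def linear_topology_def)

lemma limitin_mixed_imp: "limitin (mixed_topology smul \<tau>) s l F \<Longrightarrow> limitin \<tau> s l F"
  by (auto simp: limitin_def mixed_finer)

text \<open>If \<open>w = s - l\<close> is unbounded along \<open>r\<close>, choose \<open>\<phi>\<^sub>k\<close> of norm at most 1 nearly norming \<open>w (r k)\<close>. As
  \<open>a\<^sub>k = norm (w (r k)) / 2\<close> tends to infinity, the seminorm \<open>sup\<^sub>k |\<phi>\<^sub>k| / a\<^sub>k\<close> is a uniform limit of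
  \<open>\<tau>\<close>-continuous ones on bounded sets, hence continuous in the mixed topology, but it is at least 1 at \<open>w (r k)\<close>.\<close>
lemma limitin_mixed_bounded:
  assumes coarser: "coarser_topology \<tau> euclidean" and nrm: "norming smul \<tau>"
    and lim: "limitin (mixed_topology smul \<tau>) s l sequentially"
  shows "bounded (range s)"
proof (rule ccontr)
  assume unbdd: "\<not> bounded (range s)"
  define w where "w n = s n - l" for n
  have large: "\<exists>n>m. norm (w n) > C" for m C
  proof (rule ccontr)
    assume "\<not> ?thesis"
    then have *: "norm (w n) \<le> C" if "n > m" for n using that by force
    define K where "K = Max ((\<lambda>n. norm (s n)) ` {..m})"
    have "norm (s n) \<le> max K (C + norm l)" for n
    proof (cases "n \<le> m")
      case True
      then have "norm (s n) \<le> K" unfolding K_def by (intro Max_ge) auto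
      then show ?thesis by simp
    next
      case False
      then show ?thesis
        using *[of n] norm_triangle_ineq[of "w n" l] by (auto simp: w_def)
    qed
    then show False using unbdd by (auto simp: bounded_iff)
  qed
  \<comment> \<open>The thresholds give \<open>norm (w (r k)) > 2 * (k + 1)\<close>. The indices
    increase strictly, so that convergence of \<open>s\<close> is inherited along
    \<open>r\<close>.\<close>
  define r where "r = rec_nat (SOME n. norm (w n) > 2) (\<lambda>k m. SOME n. n > m \<and> norm (w n) > 2 * (real k + 2))"
  have "\<exists>n. norm (w n) > 2" using large[of 0 2] by auto
  then have r0: "norm (w (r 0)) > 2"
    unfolding r_def by (simp only: nat.rec) (rule someI_ex)
  have rSuc: "r (Suc k) > r k \<and> norm (w (r (Suc k))) > 2 * (real k + 2)" for k
  proof -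
    have "r (Suc k) = (SOME n. n > r k \<and> norm (w n) > 2 * (real k + 2))"
      unfolding r_def by (simp only: nat.rec)
    then show ?thesis using someI_ex[OF large[of "r k" "2 * (real k + 2)"]] by (simp only:)
  qed
  have mono: "strict_mono r" using rSuc by (simp add: strict_mono_Suc_iff)
  have wr: "norm (w (r k)) > 2 * (real k + 1)" for k
  proof (cases k)
    case (Suc j)
    then show ?thesis using rSuc[of j] by simp
  qed (use r0 in simp)
  \<comment> \<open>Half the norm leaves room for a functional of norm at most 1 whose value at
    \<open>w (r k)\<close> exceeds \<open>a k\<close>, while \<open>a k > k + 1\<close> makes
    \<open>h k x\<close> decay like \<open>norm x / (k + 1)\<close>.\<close>
  define a where "a k = norm (w (r k)) / 2" for k
  have a: "a k > real k + 1" for k using wr[of k] by (simp add: a_def)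
  have "\<exists>\<phi>. \<phi> \<in> top_dual smul \<tau> \<and> (\<forall>y. norm (\<phi> y) \<le> norm y) \<and> norm (\<phi> (w (r k))) > a k" for k
  proof (rule ccontr)
    assume "\<not> ?thesis"
    then have "norm (w (r k)) \<le> a k"
      by (intro norming_bound[OF coarser nrm]) force
    then show False using wr[of k] by (simp add: a_def)
  qed
  then obtain \<phi> where \<phi>: "\<And>k. \<phi> k \<in> top_dual smul \<tau>" "\<And>k y. norm (\<phi> k y) \<le> norm y"
    "\<And>k. norm (\<phi> k (w (r k))) > a k" by metis
  have lin\<phi>: "Vector_Spaces.linear smul (*) (\<phi> k)" for k using \<phi>(1) by (simp add: top_dual_def)
  define h where "h k x = norm (\<phi> k x) / a k" for k x
  have apos: "a k > 0" for k using a[of k] by linarith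
  have h_le: "h k x \<le> norm x / (real k + 1)" for k x
    unfolding h_def using \<phi>(2)[of k x] a[of k] apos[of k]
    by (intro frac_le) auto
  have h_le': "h k x \<le> norm x" for k x
  proof -
    have "norm x / (real k + 1) \<le> norm x / 1" by (intro divide_left_mono) auto
    then show ?thesis using h_le[of k x] by simp
  qed
  have h_nonneg: "0 \<le> h k x" for k x using apos[of k] by (simp add: h_def)
  have bdd: "bdd_above (range (\<lambda>k. h k x))" for x
    by (intro bdd_aboveI[of _ "norm x"]) (use h_le' in auto)
  define q where "q x = (SUP k. h k x)" for x
  have hq: "h k x \<le> q x" for k x unfolding q_def by (rule cSUP_upper[OF _ bdd]) simp
  have q_le: "q x \<le> C" if "\<And>k. h k x \<le> C" for x C
    unfolding q_def by (rule cSUP_least) (use that in auto)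
  have h_add: "h k (x + y) \<le> h k x + h k y" for k x y
    using linear_seminorm[OF lin\<phi>[of k]] apos[of k]
    by (simp add: h_def seminorm_def add_divide_distrib[symmetric] divide_right_mono)
  have h_smul: "h k (smul c x) = norm c * h k x" for k c x
    using lin\<phi>[of k] by (simp add: h_def Vector_Spaces.linear_iff norm_mult)
  have q_add: "q (x + y) \<le> q x + q y" for x y
    by (rule q_le) (meson h_add hq add_mono order_trans)
  have q_smul_le: "q (smul c x) \<le> norm c * q x" for c x
    by (rule q_le) (simp add: h_smul hq mult_left_mono)
  have vs: "vector_space smul" using scaling by (simp add: normed_scaling_def)
  have q_smul: "q (smul c x) = norm c * q x" for c x
  proof (cases "c = 0")
    case True
    have "h k (smul 0 x) = 0" for k by (simp add: h_smul)
    then show ?thesis using True by (simp add: q_def)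
  next
    case False
    have "q (smul (inverse c) (smul c x)) \<le> norm (inverse c) * q (smul c x)" by (rule q_smul_le)
    also have "smul (inverse c) (smul c x) = x"
      using False vector_space.vector_space_assms(3)[OF vs, of "inverse c" c x]
        vector_space.vector_space_assms(4)[OF vs, of x] by simp
    finally have "norm c * q x \<le> q (smul c x)"
      using False unfolding norm_inverse by (simp add: inverse_eq_divide pos_le_divide_eq mult.commute)
    then show ?thesis using q_smul_le[of c x] by simp
  qed
  have q: "seminorm q"
    unfolding seminorm_def using q_add q_smul[of "of_real _"] by (simp add: smul_of_real)
  have "openin (mixed_topology smul \<tau>) {x. q (x - l) < 1}"
  proof (rule mixed_seminorm_open[OF q q_smul])
    fix B :: "'a set" and z e assume B: "bounded B" "z \<in> B" and e: "(0::real) < e"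
    obtain C where C: "\<And>x. x \<in> B \<Longrightarrow> norm x \<le> C" using B(1) by (auto simp: bounded_iff)
    have C0: "C \<ge> 0" using C[OF B(2)] norm_ge_zero order_trans by blast
    \<comment> \<open>Beyond index \<open>K\<close> the values \<open>h k (w - z)\<close> are
      uniformly small on \<open>B\<close>; the finitely many remaining conditions are
      \<open>\<tau>\<close>-open and define \<open>W\<close>.\<close>
    obtain K where K: "real K > 2 * (2 * C) / e" using reals_Archimedean2 by blast
    define W where "W = (\<Inter>k\<in>{..K}. {x. x + (- z) \<in> {x. norm (\<phi> k x) < e / 2 * a k}})"
    have "openin \<tau> W"
      unfolding W_def
    proof (intro openin_INT2 open_translate)
      fix k
      show "openin \<tau> {x. norm (\<phi> k x) < e / 2 * a k}"
        using top_dual_seminorm[OF \<phi>(1)[of k]] e apos[of k]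
        by (auto simp: top_seminorms_def simp del: times_divide_eq_left)
    qed auto
    moreover have "z \<in> W"
      using e apos seminorm_zero[OF linear_seminorm[OF lin\<phi>]] by (simp add: W_def)
    moreover have "q (w - z) < e" if "w \<in> W \<inter> B" for w
    proof -
      have "h k (w - z) \<le> e / 2" for k
      proof (cases "k \<le> K")
        case True
        then have "norm (\<phi> k (w - z)) < e / 2 * a k" using that by (auto simp: W_def)
        then show ?thesis using apos[of k] by (simp add: h_def divide_simps mult.commute)
      next
        case False
        have "norm (w - z) \<le> 2 * C"
          using C[of w] C[of z] B(2) that norm_triangle_ineq4[of w z] by simp
        then have "norm (w - z) / (real k + 1) \<le> (2 * C) / (real K + 1)"
          using False C0 by (intro frac_le) auto
        also have "\<dots> \<le> e / 2"
          using K e C0 by (simp add: field_simps)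
        finally show ?thesis using h_le[of k "w - z"] by linarith
      qed
      then have "q (w - z) \<le> e / 2" by (rule q_le)
      then show ?thesis using e by linarith
    qed
    ultimately show "\<exists>W. openin \<tau> W \<and> z \<in> W \<and> (\<forall>w\<in>W \<inter> B. q (w - z) < e)" by blast
  qed
  then have "eventually (\<lambda>n. s n \<in> {x. q (x - l) < 1}) sequentially"
    by (rule limitinD[OF lim]) (simp add: seminorm_zero[OF q])
  then have "eventually (\<lambda>k. q (w (r k)) < 1) sequentially"
    using eventually_subseq[OF mono] by (fastforce simp: w_def)
  then obtain k where "q (w (r k)) < 1" by (auto simp: eventually_sequentially)
  moreover have "h k (w (r k)) > 1" using \<phi>(3)[of k] apos[of k] by (simp add: h_def)
  ultimately show False using hq[of k "w (r k)"] by linarith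
qed

text \<open>For the converse, \<open>insert l (range s)\<close> is bounded and contains the limit;
  the two topologies induce the same subspace on it, and convergence is decided there.\<close>

lemma limitin_mixed_sequentially:
  assumes coarser: "coarser_topology \<tau> euclidean" and nrm: "norming smul \<tau>"
  shows "limitin (mixed_topology smul \<tau>) s l sequentially \<longleftrightarrow>
    bounded (range s) \<and> limitin \<tau> s l sequentially"
proof (intro iffI conjI; (elim conjE)?)
  assume "limitin (mixed_topology smul \<tau>) s l sequentially"
  then show "bounded (range s)" "limitin \<tau> s l sequentially"
    using limitin_mixed_bounded[OF coarser nrm] limitin_mixed_imp by blast+
next
  assume b: "bounded (range s)" and l: "limitin \<tau> s l sequentially"
  let ?B = "insert l (range s)"
  have "limitin (subtopology \<tau> ?B) s l sequentially"
    using l by (simp add: limitin_subtopology)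
  moreover have "subtopology (mixed_topology smul \<tau>) ?B = subtopology \<tau> ?B"
    using is_mixed_topology_mixed_topology[OF lin] b
    by (simp add: is_mixed_topology_def coincide_on_bounded_def)
  ultimately show "limitin (mixed_topology smul \<tau>) s l sequentially"
    using limitin_subtopology by metis
qed

end

section \<open>Measures on the half line and Bernstein approximation\<close>

lemma tendsto_0_sandwich:
  fixes f :: "nat \<Rightarrow> real"
  assumes "g \<longlonglongrightarrow> 0" "\<And>n. 0 \<le> f n" "\<And>n. f n \<le> g n"
  shows "f \<longlonglongrightarrow> 0"
  by (rule Lim_null_comparison[OF _ assms(1)]) (use assms in auto)

definition half_line_measure :: "real measure \<Rightarrow> bool" where
  "half_line_measure \<rho> \<longleftrightarrow> finite_measure \<rho> \<and> sets \<rho> = sets borel \<and> emeasure \<rho> (- {0..}) = 0"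

definition laplace :: "real measure \<Rightarrow> real \<Rightarrow> real" where
  "laplace \<rho> l = (LINT s:{0..}|\<rho>. exp (- l * s))"

context
  fixes \<rho> :: "real measure"
  assumes \<rho>: "half_line_measure \<rho>"
begin

interpretation finite_measure \<rho> using \<rho> by (simp add: half_line_measure_def)

lemma half_line_sets [measurable_cong]: "sets \<rho> = sets borel"
  using \<rho> by (simp add: half_line_measure_def)

lemma half_line_space: "space \<rho> = UNIV"
  using sets_eq_imp_space_eq[OF half_line_sets] by simp

lemma half_line_AE: "AE s in \<rho>. 0 \<le> s"
proof (rule AE_I')
  show "- {0..} \<in> null_sets \<rho>"
    using \<rho> by (auto simp: null_sets_def half_line_measure_def)
qed auto

lemma half_line_integrable:
  fixes F :: "real \<Rightarrow> 'e::euclidean_space"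
  assumes "continuous_on {0..} F" "\<And>s. 0 \<le> s \<Longrightarrow> norm (F s) \<le> C"
  shows "set_integrable \<rho> {0..} F"
  unfolding set_integrable_def
proof (rule integrable_const_bound)
  show "AE s in \<rho>. norm (indicat_real {0..} s *\<^sub>R F s) \<le> C"
    using half_line_AE by eventually_elim (use assms(2) in auto)
  show "(\<lambda>s. indicat_real {0..} s *\<^sub>R F s) \<in> borel_measurable \<rho>"
    using borel_measurable_continuous_on_indicator[OF _ assms(1)]
    by (simp add: measurable_cong_sets[OF half_line_sets refl])
qed

lemma half_line_lint_const: "(LINT s:{0..}|\<rho>. c) = c * measure \<rho> UNIV"
proof -
  have "(LINT s:{0..}|\<rho>. c) = (LINT s|\<rho>. c)"
    unfolding set_lebesgue_integral_def
  proof (rule integral_cong_AE)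
    show "AE s in \<rho>. indicat_real {0..} s *\<^sub>R c = c"
      using half_line_AE by eventually_elim simp
  qed (auto simp: measurable_cong_sets[OF half_line_sets refl])
  then show ?thesis by (simp add: half_line_space mult.commute)
qed

lemma half_line_lint_mono:
  fixes F :: "real \<Rightarrow> real"
  assumes "set_integrable \<rho> {0..} F" "set_integrable \<rho> {0..} F'" "\<And>s. 0 \<le> s \<Longrightarrow> F s \<le> F' s"
  shows "(LINT s:{0..}|\<rho>. F s) \<le> (LINT s:{0..}|\<rho>. F' s)"
  using assms by (intro set_integral_mono) auto

lemma half_line_lint_le_const:
  fixes F :: "real \<Rightarrow> real"
  assumes "set_integrable \<rho> {0..} F" "\<And>s. 0 \<le> s \<Longrightarrow> F s \<le> C"
  shows "(LINT s:{0..}|\<rho>. F s) \<le> C * measure \<rho> UNIV"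
proof -
  have "set_integrable \<rho> {0..} (\<lambda>_. C)" by (rule half_line_integrable[of _ "\<bar>C\<bar>"]) auto
  from half_line_lint_mono[OF assms(1) this assms(2)] show ?thesis
    by (simp add: half_line_lint_const)
qed

text \<open>\<open>I\<close> is an arbitrary Borel set because the equicontinuity estimate for orbit
  integrals uses either a bounded range of times or all times. The tail estimate is the case
  \<open>{..R}\<close>.\<close>

lemma half_line_lint_split:
  fixes F :: "real \<Rightarrow> real"
  assumes I: "I \<in> sets borel" and F: "set_integrable \<rho> {0..} F"
    and "\<And>s. 0 \<le> s \<Longrightarrow> s \<in> I \<Longrightarrow> F s \<le> e" "\<And>s. 0 \<le> s \<Longrightarrow> F s \<le> C" "0 \<le> e" "0 \<le> C"
  shows "(LINT s:{0..}|\<rho>. F s) \<le> e * measure \<rho> UNIV + C * measure \<rho> (- I)"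
proof -
  have I': "- I \<in> sets \<rho>" using I borel_comp by (simp add: half_line_sets)
  have i1: "integrable \<rho> (\<lambda>s. e)" by simp
  have i2: "integrable \<rho> (\<lambda>s. C * indicator (- I) s)"
    using I' by (intro integrable_mult_right integrable_real_indicator)
      (auto simp: emeasure_finite less_top[symmetric])
  have "(LINT s:{0..}|\<rho>. F s) \<le> (LINT s|\<rho>. e + C * indicator (- I) s)"
    unfolding set_lebesgue_integral_def
    by (intro integral_mono i1 i2 Bochner_Integration.integrable_add)
      (use assms in \<open>auto simp: set_integrable_def split: split_indicator intro: order_trans add_increasing add_increasing2\<close>)
  also have "\<dots> = e * measure \<rho> UNIV + C * measure \<rho> (- I)"
    using i1 i2 I' by (subst Bochner_Integration.integral_add) (auto simp: half_line_space mult.commute)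
  finally show ?thesis .
qed

lemma half_line_lint_tail:
  fixes F :: "real \<Rightarrow> real"
  assumes "set_integrable \<rho> {0..} F" "\<And>s. 0 \<le> s \<Longrightarrow> s \<le> R \<Longrightarrow> F s \<le> e"
    and "\<And>s. 0 \<le> s \<Longrightarrow> F s \<le> C" "0 \<le> e" "0 \<le> C"
  shows "(LINT s:{0..}|\<rho>. F s) \<le> e * measure \<rho> UNIV + C * measure \<rho> {R<..}"
  using half_line_lint_split[of "{..R}" F e C] assms by simp

lemma half_line_tail_tendsto: "(\<lambda>n. measure \<rho> {real n<..}) \<longlonglongrightarrow> 0"
proof -
  have "(\<lambda>n. measure \<rho> {real n<..}) \<longlonglongrightarrow> measure \<rho> (\<Inter>n. {real n<..})"
    by (rule finite_Lim_measure_decseq) (auto simp: half_line_sets decseq_def)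
  also have "(\<Inter>n. {real n<..}) = {}"
  proof -
    have "x \<notin> (\<Inter>n. {real n<..})" for x
    proof -
      obtain n where "x < real n" using reals_Archimedean2 by blast
      then have "x \<notin> {real n<..}" by simp
      then show ?thesis by blast
    qed
    then show ?thesis by blast
  qed
  finally show ?thesis by simp
qed

lemma half_line_tail_small:
  assumes "0 < e"
  shows "\<exists>R\<ge>0. measure \<rho> {R<..} < e"
proof -
  have "eventually (\<lambda>n. measure \<rho> {real n<..} < e) sequentially"
    using order_tendstoD(2)[OF half_line_tail_tendsto assms] .
  then obtain n where "measure \<rho> {real n<..} < e" by (auto simp: eventually_sequentially)
  then show ?thesis by (intro exI[of _ "real n"]) simp
qed

lemma half_line_small:
  assumes "0 < e" "0 \<le> K"
  shows "\<exists>d R. 0 < d \<and> d * measure \<rho> UNIV + K * measure \<rho> {R<..} < e"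
proof -
  define d where "d = e / (2 * (measure \<rho> UNIV + 1))"
  obtain R where R: "measure \<rho> {R<..} < e / (2 * (K + 1))"
    using half_line_tail_small[of "e / (2 * (K + 1))"] assms by auto
  have "d * measure \<rho> UNIV \<le> e / 2" "0 < d"
    using assms by (auto simp: d_def divide_simps add_nonneg_pos)
  moreover have "K * measure \<rho> {R<..} \<le> K * (e / (2 * (K + 1)))"
    using R assms by (intro mult_left_mono) auto
  moreover have "K * (e / (2 * (K + 1))) < e / 2" using assms by (simp add: field_simps)
  ultimately have "0 < d \<and> d * measure \<rho> UNIV + K * measure \<rho> {R<..} < e" by linarith
  then show ?thesis by blast
qed

lemma half_line_exp_integrable:
  assumes "0 \<le> l"
  shows "set_integrable \<rho> {0..} (\<lambda>s. exp (- l * s))"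
  by (rule half_line_integrable[of _ 1]) (use assms in \<open>auto intro!: continuous_intros\<close>)

lemma laplace_0: "laplace \<rho> 0 = measure \<rho> UNIV"
  by (simp add: laplace_def half_line_lint_const)

text \<open>Markov's inequality for \<open>1 - exp (- s / R)\<close>, which is nonnegative on the
  half line and at least \<open>1 - exp (-1)\<close> beyond \<open>R\<close>. It converts continuity
  of the Laplace transform at 0 into small tails.\<close>

lemma laplace_tail:
  assumes "0 < R"
  shows "(1 - exp (-1)) * measure \<rho> {R<..} \<le> laplace \<rho> 0 - laplace \<rho> (1 / R)"
proof -
  have i0: "set_integrable \<rho> {0..} (\<lambda>s. 1 :: real)" by (rule half_line_integrable[of _ 1]) auto
  have i1: "set_integrable \<rho> {0..} (\<lambda>s. exp (- (1 / R) * s))"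
    using half_line_exp_integrable[of "1 / R"] assms by simp
  have i2: "integrable \<rho> (\<lambda>s. (1 - exp (-1)) * indicat_real {R<..} s)"
    by (intro integrable_mult_right integrable_real_indicator)
      (auto simp: half_line_sets emeasure_finite less_top[symmetric])
  have "(1 - exp (-1)) * measure \<rho> {R<..} = (LINT s|\<rho>. (1 - exp (-1)) * indicat_real {R<..} s)"
    by (simp add: half_line_space half_line_sets)
  also have "\<dots> \<le> (LINT s:{0..}|\<rho>. 1 - exp (- (1 / R) * s))"
    unfolding set_lebesgue_integral_def
  proof (rule integral_mono[OF i2])
    show "integrable \<rho> (\<lambda>s. indicat_real {0..} s *\<^sub>R (1 - exp (- (1 / R) * s)))"
      using set_integral_diff(1)[OF i0 i1] by (simp add: set_integrable_def)
  qed (use assms in \<open>auto split: split_indicator simp: field_simps\<close>)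
  also have "\<dots> = laplace \<rho> 0 - laplace \<rho> (1 / R)"
    using set_integral_diff(2)[OF i0 i1] by (simp add: laplace_def)
  finally show ?thesis .
qed

lemma laplace_tendsto_0: "(\<lambda>n. laplace \<rho> (1 / real (Suc n))) \<longlonglongrightarrow> laplace \<rho> 0"
  unfolding laplace_def set_lebesgue_integral_def
proof (rule integral_dominated_convergence[where w = "\<lambda>_. 1"])
  show "AE s in \<rho>. (\<lambda>n. indicat_real {0..} s *\<^sub>R exp (- (1 / real (Suc n)) * s))
      \<longlonglongrightarrow> indicat_real {0..} s *\<^sub>R exp (- 0 * s)"
  proof (intro always_eventually allI)
    fix s
    have "(\<lambda>n. - (1 / real (Suc n)) * s) \<longlonglongrightarrow> - 0 * s"
      unfolding inverse_eq_divide[symmetric]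
      by (intro tendsto_mult tendsto_minus tendsto_const LIMSEQ_inverse_real_of_nat)
    then show "(\<lambda>n. indicat_real {0..} s *\<^sub>R exp (- (1 / real (Suc n)) * s))
      \<longlonglongrightarrow> indicat_real {0..} s *\<^sub>R exp (- 0 * s)"
      by (intro tendsto_scaleR tendsto_const tendsto_exp)
  qed
  show "AE s in \<rho>. norm (indicat_real {0..} s *\<^sub>R exp (- (1 / real (Suc n)) * s)) \<le> 1" for n
    by (intro always_eventually allI) (auto split: split_indicator)
qed (auto simp: measurable_cong_sets[OF half_line_sets refl])

end

text \<open>The sum is the variance \<open>x * (1 - x) / n\<close> of a binomial frequency. The
  square is expanded into factorial moments, whose Bernstein sums are known.\<close>

lemma sum_Bernstein_variance_le:
  assumes "0 \<le> x" "x \<le> 1" "0 < n"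
  shows "(\<Sum>k\<le>n. Bernstein n k x * (real k / real n - x)\<^sup>2) \<le> 1 / real n"
proof -
  have *: "real n ^ 2 * (Bernstein n k x * (real k / real n - x)\<^sup>2)
      = real k * (real k - 1) * Bernstein n k x + (1 - 2 * real n * x) * (real k * Bernstein n k x)
        + (real n * x)\<^sup>2 * Bernstein n k x" for k
    using assms(3) by (simp add: power2_eq_square field_simps)
  have "real n ^ 2 * (\<Sum>k\<le>n. Bernstein n k x * (real k / real n - x)\<^sup>2)
      = real n * (real n - 1) * x\<^sup>2 + (1 - 2 * real n * x) * (real n * x) + (real n * x)\<^sup>2 * 1"
    unfolding sum_distrib_left * sum.distrib
    by (simp only: sum_distrib_left[symmetric] sum_kk_Bernstein sum_k_Bernstein sum_Bernstein)
  also have "\<dots> = real n * (x * (1 - x))" by (simp add: power2_eq_square algebra_simps)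
  also have "\<dots> \<le> real n * 1" using assms by (intro mult_left_mono mult_le_one) auto
  finally show ?thesis using assms(3) by (simp add: power2_eq_square field_simps)
qed

section \<open>Bounded sequential convergence, its functionals, and Bernstein sums in
  \<open>exp (- s)\<close>\<close>

definition seq_conv :: "('a::real_normed_vector \<Rightarrow> real) set \<Rightarrow> (nat \<Rightarrow> 'a) \<Rightarrow> 'a \<Rightarrow> bool" where
  "seq_conv P s l \<longleftrightarrow> bounded (range s) \<and> (\<forall>p\<in>P. (\<lambda>n. p (s n - l)) \<longlonglongrightarrow> 0)"

text \<open>Sequential continuity is required in place of continuity because \<open>T t\<close> is
  only known to preserve \<open>seq_conv\<close>: composing a functional with \<open>T t\<close>
  stays in this class.\<close>

definition seq_dual ::
    "('k::{real_normed_field,euclidean_space} \<Rightarrow> 'a::real_normed_vector \<Rightarrow> 'a) \<Rightarrow> ('a \<Rightarrow> real) set \<Rightarrow> ('a \<Rightarrow> 'k) set" where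
  "seq_dual smul P =
     {\<phi>. Vector_Spaces.linear smul (*) \<phi> \<and> (\<forall>s l. seq_conv P s l \<longrightarrow> (\<lambda>n. \<phi> (s n)) \<longlonglongrightarrow> \<phi> l)}"

text \<open>A Banach space with a coarser locally convex topology, reduced to what bounded sequences
  see. Completeness is stated through the seminorms in \<open>P\<close>, and the norming clause
  ranges over the sequentially continuous functionals. Concrete topologies reappear only when the
  theorem is translated back.\<close>

locale saks_space =
  fixes smul :: "'k::{real_normed_field,euclidean_space} \<Rightarrow> 'a::banach \<Rightarrow> 'a"
    and P :: "('a \<Rightarrow> real) set"
  assumes scaling: "normed_scaling smul"
    and P_seminorm: "p \<in> P \<Longrightarrow> seminorm p"
    and P_bounded: "p \<in> P \<Longrightarrow> \<exists>c>0. \<forall>x. p x \<le> c * norm x"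
    and P_complete: "bounded (range s) \<Longrightarrow>
      (\<And>p e. p \<in> P \<Longrightarrow> 0 < e \<Longrightarrow> \<exists>N. \<forall>m\<ge>N. \<forall>n\<ge>N. p (s m - s n) < e) \<Longrightarrow> \<exists>l. seq_conv P s l"
    and P_norming: "(\<And>\<phi>. \<phi> \<in> seq_dual smul P \<Longrightarrow> (\<And>y. norm (\<phi> y) \<le> norm y) \<Longrightarrow> norm (\<phi> x) \<le> C)
      \<Longrightarrow> norm x \<le> C"
begin

abbreviation "sconv \<equiv> seq_conv P"
abbreviation "\<Phi> \<equiv> seq_dual smul P"

lemma smul_of_real: "smul (of_real r) x = r *\<^sub>R x"
  using scaling by (simp add: normed_scaling_def)

lemma \<Phi>_linear: "\<phi> \<in> \<Phi> \<Longrightarrow> Vector_Spaces.linear smul (*) \<phi>"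
  by (simp add: seq_dual_def)

lemma \<Phi>_conv: "\<phi> \<in> \<Phi> \<Longrightarrow> sconv s l \<Longrightarrow> (\<lambda>n. \<phi> (s n)) \<longlonglongrightarrow> \<phi> l"
  by (simp add: seq_dual_def)

lemma \<Phi>_smul: "\<phi> \<in> \<Phi> \<Longrightarrow> \<phi> (smul c x) = c * \<phi> x"
  using \<Phi>_linear by (auto simp: Vector_Spaces.linear_iff)

lemma \<Phi>_add: "\<phi> \<in> \<Phi> \<Longrightarrow> \<phi> (x + y) = \<phi> x + \<phi> y"
  using \<Phi>_linear by (auto simp: Vector_Spaces.linear_iff)

lemma \<Phi>_scaleR: "\<phi> \<in> \<Phi> \<Longrightarrow> \<phi> (r *\<^sub>R x) = r *\<^sub>R \<phi> x"
  using \<Phi>_smul[of \<phi> "of_real r" x] by (simp add: smul_of_real scaleR_conv_of_real)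

lemma \<Phi>_real_linear: "\<phi> \<in> \<Phi> \<Longrightarrow> linear \<phi>"
  by (intro linearI \<Phi>_add \<Phi>_scaleR)

lemma \<Phi>_diff: "\<phi> \<in> \<Phi> \<Longrightarrow> \<phi> (x - y) = \<phi> x - \<phi> y"
  using \<Phi>_real_linear linear_diff by blast

lemma \<Phi>_sum: "\<phi> \<in> \<Phi> \<Longrightarrow> \<phi> (\<Sum>i\<in>A. g i) = (\<Sum>i\<in>A. \<phi> (g i))"
  using \<Phi>_real_linear linear_sum by blast

lemma \<Phi>_seminorm: "\<phi> \<in> \<Phi> \<Longrightarrow> seminorm (\<lambda>x. norm (\<phi> x))"
  by (auto simp: seminorm_def \<Phi>_add \<Phi>_scaleR intro: norm_triangle_ineq)

lemma eq_by_\<Phi>: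
  assumes "\<And>\<phi>. \<phi> \<in> \<Phi> \<Longrightarrow> \<phi> x = \<phi> y"
  shows "x = y"
proof -
  have "norm (x - y) \<le> 0" by (rule P_norming) (simp add: \<Phi>_diff assms)
  then show ?thesis by simp
qed

lemma sconv_bounded: "sconv s l \<Longrightarrow> bounded (range s)"
  by (simp add: seq_conv_def)

lemma sconv_boundedE:
  assumes "sconv s l"
  obtains C where "0 \<le> C" "\<And>n. norm (s n) \<le> C"
  using sconv_bounded[OF assms] by (auto simp: bounded_iff) (meson norm_ge_zero order_trans)

lemma sconvI:
  assumes "\<And>n. norm (s n) \<le> C" "\<And>p. p \<in> P \<Longrightarrow> (\<lambda>n. p (s n - l)) \<longlonglongrightarrow> 0"
  shows "sconv s l"
  using assms by (auto simp: seq_conv_def bounded_iff)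

lemma sconv_unique: "sconv s l \<Longrightarrow> sconv s l' \<Longrightarrow> l = l'"
  by (rule eq_by_\<Phi>) (meson LIMSEQ_unique \<Phi>_conv)

lemma sconv_const: "sconv (\<lambda>_. x) x"
  by (rule sconvI[of _ "norm x"]) (auto simp: seminorm_zero P_seminorm)

lemma sconv_add:
  assumes "sconv s l" "sconv s' l'"
  shows "sconv (\<lambda>n. s n + s' n) (l + l')"
proof -
  obtain C C' where C: "\<And>n. norm (s n) \<le> C" "\<And>n. norm (s' n) \<le> C'"
    using assms sconv_boundedE by metis
  show ?thesis
  proof (rule sconvI)
    show "norm (s n + s' n) \<le> C + C'" for n
      using norm_triangle_ineq[of "s n" "s' n"] C(1)[of n] C(2)[of n] by linarith
    fix p assume p: "p \<in> P"
    have sn: "seminorm p" using p by (rule P_seminorm)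
    have "(\<lambda>n. p (s n - l) + p (s' n - l')) \<longlonglongrightarrow> 0"
      using assms p by (intro tendsto_add_zero) (auto simp: seq_conv_def)
    then show "(\<lambda>n. p (s n + s' n - (l + l'))) \<longlonglongrightarrow> 0"
      by (rule tendsto_0_sandwich) (simp_all add: add_diff_add seminorm_triangle[OF sn] seminorm_nonneg[OF sn])
  qed
qed

lemma sconv_scaleR:
  assumes s: "sconv s l" and c: "c \<longlonglongrightarrow> c0"
  shows "sconv (\<lambda>n. c n *\<^sub>R s n) (c0 *\<^sub>R l)"
proof -
  obtain C where C: "0 \<le> C" "\<And>n. norm (s n) \<le> C" using s sconv_boundedE by metis
  obtain K where K: "0 < K" "\<And>n. norm (c n) \<le> K"
    using convergent_imp_Bseq[OF convergentI[OF c]] by (auto elim: BseqE)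
  show ?thesis
  proof (rule sconvI)
    show "norm (c n *\<^sub>R s n) \<le> K * C" for n
      using C K(2)[of n] K(1) by (auto intro!: mult_mono)
    fix p assume p: "p \<in> P"
    have sn: "seminorm p" using p by (rule P_seminorm)
    have "(\<lambda>n. K * p (s n - l) + \<bar>c n - c0\<bar> * p l) \<longlonglongrightarrow> K * 0 + \<bar>c0 - c0\<bar> * p l"
      using s p by (intro tendsto_intros c) (auto simp: seq_conv_def)
    then have "(\<lambda>n. K * p (s n - l) + \<bar>c n - c0\<bar> * p l) \<longlonglongrightarrow> 0" by simp
    then show "(\<lambda>n. p (c n *\<^sub>R s n - c0 *\<^sub>R l)) \<longlonglongrightarrow> 0"
    proof (rule tendsto_0_sandwich)
      show "p (c n *\<^sub>R s n - c0 *\<^sub>R l) \<le> K * p (s n - l) + \<bar>c n - c0\<bar> * p l" for n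
      proof -
        have "c n *\<^sub>R s n - c0 *\<^sub>R l = c n *\<^sub>R (s n - l) + (c n - c0) *\<^sub>R l"
          by (simp add: algebra_simps)
        then have "p (c n *\<^sub>R s n - c0 *\<^sub>R l) \<le> \<bar>c n\<bar> * p (s n - l) + \<bar>c n - c0\<bar> * p l"
          by (metis seminorm_triangle[OF sn] seminorm_scaleR[OF sn])
        also have "\<bar>c n\<bar> * p (s n - l) \<le> K * p (s n - l)"
          using K(2)[of n] by (intro mult_right_mono seminorm_nonneg[OF sn]) simp
        finally show ?thesis by simp
      qed
    qed (rule seminorm_nonneg[OF sn])
  qed
qed

lemma sconv_uminus: "sconv s l \<Longrightarrow> sconv (\<lambda>n. - s n) (- l)"
  using sconv_scaleR[of s l "\<lambda>_. -1" "-1"] by simp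

lemma sconv_diff: "sconv s l \<Longrightarrow> sconv s' l' \<Longrightarrow> sconv (\<lambda>n. s n - s' n) (l - l')"
  using sconv_add[OF _ sconv_uminus, of s l s' l'] by simp

lemma sconv_tendsto:
  assumes "s \<longlonglongrightarrow> l"
  shows "sconv s l"
proof -
  obtain C where C: "\<And>n. norm (s n) \<le> C"
    using convergent_imp_bounded[of s] assms by (auto simp: bounded_iff)
  show ?thesis
  proof (rule sconvI[OF C])
    fix p assume p: "p \<in> P"
    obtain c where c: "\<And>x. p x \<le> c * norm x" using P_bounded[OF p] by blast
    have "(\<lambda>n. c * norm (s n - l)) \<longlonglongrightarrow> 0"
      using assms by (intro tendsto_mult_right_zero tendsto_norm_zero) (simp add: LIM_zero)
    then show "(\<lambda>n. p (s n - l)) \<longlonglongrightarrow> 0"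
      by (rule tendsto_0_sandwich) (use c seminorm_nonneg[OF P_seminorm[OF p]] in auto)
  qed
qed

text \<open>Covers both the seminorms in \<open>P\<close> and the absolute values of functionals in
  \<open>\<Phi>\<close>, which need not belong to \<open>P\<close>, so that the Bernstein estimates
  are proved once for both.\<close>

definition admissible :: "('a \<Rightarrow> real) \<Rightarrow> bool" where
  "admissible q \<longleftrightarrow> seminorm q \<and> (\<exists>c>0. \<forall>x. q x \<le> c * norm x) \<and>
     (\<forall>s l. sconv s l \<longrightarrow> (\<lambda>n. q (s n - l)) \<longlonglongrightarrow> 0)"

lemma admissible_P: "p \<in> P \<Longrightarrow> admissible p"
  using P_seminorm P_bounded by (simp add: admissible_def seq_conv_def)

text \<open>Norm convergence implies \<open>sconv\<close>. An unbounded functional would take values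
  of modulus 1 on vectors of norm at most \<open>1 / (n + 1)\<close>.\<close>

lemma \<Phi>_bounded:
  assumes \<phi>: "\<phi> \<in> \<Phi>"
  shows "\<exists>c>0. \<forall>x. norm (\<phi> x) \<le> c * norm x"
proof (rule ccontr)
  assume "\<not> ?thesis"
  then have "\<exists>x. norm (\<phi> x) > real (Suc n) * norm x" for n
    by (metis not_less of_nat_0_less_iff zero_less_Suc)
  then obtain x where x: "\<And>n. norm (\<phi> (x n)) > real (Suc n) * norm (x n)" by metis
  define y where "y n = (1 / norm (\<phi> (x n))) *\<^sub>R x n" for n
  have pos: "norm (\<phi> (x n)) > 0" for n
    using x[of n] by (smt (verit) mult_nonneg_nonneg norm_ge_zero of_nat_0_le_iff)
  have "norm (y n) \<le> inverse (real (Suc n))" for n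
    using x[of n] pos[of n] by (simp add: y_def field_simps)
  then have "y \<longlonglongrightarrow> 0"
    by (intro Lim_null_comparison[OF _ LIMSEQ_inverse_real_of_nat]) simp
  then have "(\<lambda>n. \<phi> (y n)) \<longlonglongrightarrow> \<phi> 0" by (intro \<Phi>_conv[OF \<phi>] sconv_tendsto)
  then have "(\<lambda>n. norm (\<phi> (y n))) \<longlonglongrightarrow> norm (\<phi> 0)" by (rule tendsto_norm)
  moreover have "norm (\<phi> (y n)) = 1" for n using pos[of n] by (simp add: y_def \<Phi>_scaleR[OF \<phi>])
  moreover have "\<phi> 0 = 0" using linear_0[OF \<Phi>_real_linear[OF \<phi>]] .
  ultimately show False by (simp add: LIMSEQ_const_iff)
qed

lemma admissible_\<Phi>:
  assumes "\<phi> \<in> \<Phi>"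
  shows "admissible (\<lambda>x. norm (\<phi> x))"
  using \<Phi>_seminorm[OF assms] \<Phi>_bounded[OF assms] \<Phi>_conv[OF assms]
  by (auto simp: admissible_def \<Phi>_diff[OF assms] tendsto_norm_zero_iff LIM_zero)

lemma admissible_seminorm: "admissible q \<Longrightarrow> seminorm q"
  by (simp add: admissible_def)

lemma admissible_bound:
  assumes "admissible q" "0 \<le> C"
  shows "\<exists>K\<ge>0. \<forall>x. norm x \<le> C \<longrightarrow> q x \<le> K"
proof -
  obtain c where c: "0 < c" "\<And>x. q x \<le> c * norm x" using assms by (auto simp: admissible_def)
  have "q x \<le> c * C" if "norm x \<le> C" for x
    using c(2)[of x] mult_left_mono[OF that, of c] c(1) by linarith
  then show ?thesis using c assms by (intro exI[of _ "c * C"]) auto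
qed

definition bcont :: "(real \<Rightarrow> 'a) \<Rightarrow> bool" where
  "bcont G \<longleftrightarrow> (\<exists>C. \<forall>s\<ge>0. norm (G s) \<le> C) \<and>
     (\<forall>r s. (\<forall>n. 0 \<le> r n) \<and> r \<longlonglongrightarrow> s \<longrightarrow> sconv (\<lambda>n. G (r n)) (G s))"

lemma bcont_boundE:
  assumes "bcont G"
  obtains C where "0 \<le> C" "\<And>s. 0 \<le> s \<Longrightarrow> norm (G s) \<le> C"
proof -
  obtain C where "\<forall>s\<ge>0. norm (G s) \<le> C" using assms by (auto simp: bcont_def)
  then show ?thesis using that[of "max C 0"] by (meson max.cobounded2 max.coboundedI1)
qed

lemma bcont_seminorm_boundE:
  assumes "bcont G" "admissible q"
  obtains K where "0 \<le> K" "\<And>s. 0 \<le> s \<Longrightarrow> q (G s) \<le> K"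
  using bcont_boundE[OF assms(1)] admissible_bound[OF assms(2)] by metis

lemma bcont_sconv: "bcont G \<Longrightarrow> (\<And>n. 0 \<le> r n) \<Longrightarrow> r \<longlonglongrightarrow> s \<Longrightarrow> sconv (\<lambda>n. G (r n)) (G s)"
  by (simp add: bcont_def)

lemma bcont_\<Phi>_continuous:
  assumes "bcont G" "\<phi> \<in> \<Phi>"
  shows "continuous_on {0..} (\<lambda>s. \<phi> (G s))"
  unfolding continuous_on_sequentially
  using \<Phi>_conv[OF assms(2) bcont_sconv[OF assms(1)]] by (simp add: o_def)

lemma bcont_seminorm_continuous:
  assumes "bcont G" "admissible q"
  shows "continuous_on {0..} (\<lambda>s. q (G s))"
  unfolding continuous_on_sequentially o_def
proof (intro allI ballI impI)
  fix r :: "nat \<Rightarrow> real" and s assume r: "(\<forall>n. r n \<in> {0..}) \<and> r \<longlonglongrightarrow> s"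
  have sn: "seminorm q" using assms(2) by (simp add: admissible_def)
  have "(\<lambda>n. q (G (r n) - G s)) \<longlonglongrightarrow> 0"
    using bcont_sconv[OF assms(1)] r assms(2) by (simp add: admissible_def)
  then have "(\<lambda>n. q (G (r n)) - q (G s)) \<longlonglongrightarrow> 0"
    by (rule Lim_null_comparison[rotated]) (simp add: seminorm_reverse_triangle[OF sn])
  then show "(\<lambda>n. q (G (r n))) \<longlonglongrightarrow> q (G s)" by (simp add: LIM_zero_cancel)
qed

lemma bcont_add: "bcont G \<Longrightarrow> bcont G' \<Longrightarrow> bcont (\<lambda>s. G s + G' s)"
  unfolding bcont_def by (auto intro!: sconv_add) (meson add_mono norm_triangle_ineq order_trans)

lemma bcont_const: "bcont (\<lambda>_. x)"
  by (auto simp: bcont_def sconv_const)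

lemma bcont_diff_const: "bcont G \<Longrightarrow> bcont (\<lambda>s. G s - x)"
  using bcont_add[OF _ bcont_const[of "- x"], of G] by simp

text \<open>Functions on the half line are transported to the unit interval by \<open>u = exp (- s)\<close>; the value at
  \<open>u = 0\<close>, that is at infinity, is arbitrary.\<close>
definition node :: "(real \<Rightarrow> 'a) \<Rightarrow> real \<Rightarrow> 'a" where
  "node G u = (if u \<le> 0 then 0 else G (- ln u))"

lemma node_exp: "node G (exp (- s)) = G s"
  by (simp add: node_def)

lemma node_bound:
  assumes "\<And>s. 0 \<le> s \<Longrightarrow> norm (G s) \<le> C" "0 \<le> C" "u \<le> 1"
  shows "norm (node G u) \<le> C"
  using assms by (auto simp: node_def)

text \<open>Uniform continuity by compactness, argued with sequences. At \<open>u = 0\<close>, the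
  image of infinity, \<open>node G\<close> may jump, so \<open>u\<close> is confined to
  \<open>{c..1}\<close>; \<open>v\<close> is free, but in the contradiction argument it has the same
  positive limit as \<open>u\<close>.\<close>

lemma node_uniform:
  assumes G: "bcont G" and q: "admissible q" and e: "0 < e" and c: "0 < c"
  shows "\<exists>d>0. \<forall>u\<in>{c..1}. \<forall>v\<in>{0..1}. \<bar>u - v\<bar> < d \<longrightarrow> q (node G v - node G u) < e"
proof (rule ccontr)
  have sn: "seminorm q" using q by (simp add: admissible_def)
  assume "\<not> ?thesis"
  then have "\<exists>u v. u \<in> {c..1} \<and> v \<in> {0..1} \<and> \<bar>u - v\<bar> < inverse (real (Suc n)) \<and> \<not> q (node G v - node G u) < e" for n
    by (metis inverse_positive_iff_positive of_nat_0_less_iff zero_less_Suc)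
  then obtain u v where uv: "\<And>n. u n \<in> {c..1}" "\<And>n. v n \<in> {0..1}"
    "\<And>n. \<bar>u n - v n\<bar> < inverse (real (Suc n))" "\<And>n. \<not> q (node G (v n) - node G (u n)) < e"
    by metis
  obtain l r where lr: "l \<in> {c..1}" "strict_mono r" "(u \<circ> r) \<longlonglongrightarrow> l"
    using compact_Icc[of c 1, unfolded compact_eq_seq_compact_metric] uv(1) seq_compactE by metis
  have "(\<lambda>n. u n - v n) \<longlonglongrightarrow> 0"
    by (rule Lim_null_comparison[OF _ LIMSEQ_inverse_real_of_nat])
      (use less_imp_le[OF uv(3)] in \<open>auto simp del: of_nat_Suc\<close>)
  then have "(\<lambda>n. u (r n) - v (r n)) \<longlonglongrightarrow> 0"
    using LIMSEQ_subseq_LIMSEQ[OF _ lr(2)] by (fastforce simp: o_def)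
  from tendsto_diff[OF lr(3) this] have vl: "(\<lambda>n. v (r n)) \<longlonglongrightarrow> l" by (simp add: o_def)
  have lim: "(\<lambda>n. q (node G (x n) - node G l)) \<longlonglongrightarrow> 0"
    if x: "\<And>n. x n \<le> 1" "x \<longlonglongrightarrow> l" for x
  proof -
    have l: "0 < l" "l \<le> 1" using lr(1) c by auto
    \<comment> \<open>Truncation at \<open>l / 2\<close> keeps all terms positive, where
      \<open>node G u\<close> is \<open>G (- ln u)\<close>, and alters only finitely many of
      them.\<close>
    define y where "y n = max (x n) (l / 2)" for n
    have y: "y n > 0" "y n \<le> 1" for n using l x(1)[of n] by (auto simp: y_def)
    have "y \<longlonglongrightarrow> max l (l / 2)" unfolding y_def by (intro tendsto_intros x)
    then have yl: "y \<longlonglongrightarrow> l" using l by (simp add: max_def)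
    have "(\<lambda>n. - ln (y n)) \<longlonglongrightarrow> - ln l" by (intro tendsto_intros yl) (use l in auto)
    then have "sconv (\<lambda>n. G (- ln (y n))) (G (- ln l))"
      by (intro bcont_sconv[OF G]) (use y in \<open>auto simp: ln_le_zero_iff\<close>)
    then have "(\<lambda>n. q (node G (y n) - node G l)) \<longlonglongrightarrow> 0"
      using q y(1) l by (simp add: admissible_def node_def not_le[symmetric])
    moreover have "eventually (\<lambda>n. x n > l / 2) sequentially"
      by (rule order_tendstoD(1)[OF x(2)]) (use l in simp)
    then have "eventually (\<lambda>n. q (node G (y n) - node G l) = q (node G (x n) - node G l)) sequentially"
      by eventually_elim (simp add: y_def)
    ultimately show ?thesis by (rule Lim_transform_eventually)
  qed
  have "(\<lambda>n. q (node G (v (r n)) - node G l) + q (node G (u (r n)) - node G l)) \<longlonglongrightarrow> 0 + 0"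
    using lr(3) vl uv by (intro tendsto_add lim) (auto simp: o_def)
  then have "eventually (\<lambda>n. q (node G (v (r n)) - node G l) + q (node G (u (r n)) - node G l) < e) sequentially"
    using order_tendstoD(2)[of _ "0::real"] e by fastforce
  then obtain n where "q (node G (v (r n)) - node G l) + q (node G (u (r n)) - node G l) < e"
    by (auto simp: eventually_sequentially)
  then show False
    using uv(4)[of "r n"] seminorm_triangle_diff[OF sn, of "node G (v (r n))" "node G (u (r n))" "node G l"]
    by (simp add: seminorm_diff_commute[OF sn, of "node G l"])
qed

lemma node_diff_bound:
  assumes "bcont G" "admissible q"
  obtains K where "0 \<le> K" "\<And>u v. u \<le> 1 \<Longrightarrow> v \<le> 1 \<Longrightarrow> q (node G u - node G v) \<le> K"
proof -
  obtain C where C: "0 \<le> C" "\<And>s. 0 \<le> s \<Longrightarrow> norm (G s) \<le> C" using bcont_boundE[OF assms(1)] by metis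
  obtain K where K: "0 \<le> K" "\<And>x. norm x \<le> C + C \<Longrightarrow> q x \<le> K"
    using admissible_bound[OF assms(2), of "C + C"] C(1) by auto
  have "norm (node G u - node G v) \<le> C + C" if "u \<le> 1" "v \<le> 1" for u v
    using node_bound[of G C, OF C(2) C(1)] that by (intro norm_triangle_le_diff add_mono) auto
  then show ?thesis using that K by blast
qed

definition weight :: "nat \<Rightarrow> nat \<Rightarrow> real \<Rightarrow> real" where
  "weight n k s = Bernstein n k (exp (- s))"

lemma weight_nonneg: "0 \<le> s \<Longrightarrow> 0 \<le> weight n k s"
  by (simp add: weight_def Bernstein_nonneg)

lemma weight_sum: "(\<Sum>k\<le>n. weight n k s) = 1"
  by (simp add: weight_def)

lemma weight_le_1:
  assumes "0 \<le> s" "k \<le> n"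
  shows "weight n k s \<le> 1"
proof -
  have "weight n k s \<le> (\<Sum>k\<le>n. weight n k s)"
    using assms by (intro member_le_sum) (auto simp: weight_nonneg)
  then show ?thesis by (simp add: weight_sum)
qed

lemma weight_continuous: "continuous_on A (weight n k)"
  unfolding weight_def Bernstein_def by (intro continuous_intros)

text \<open>A real majorant for the \<open>q\<close>-distance between \<open>G s\<close> and the
  Bernstein sum at \<open>s\<close>. Being scalar, it can be integrated before any vector integral
  is known to exist.\<close>

definition err :: "('a \<Rightarrow> real) \<Rightarrow> (real \<Rightarrow> 'a) \<Rightarrow> nat \<Rightarrow> real \<Rightarrow> real" where
  "err q G n s = (\<Sum>k\<le>n. weight n k s * q (node G (k / n) - G s))"

lemma err_nonneg: "admissible q \<Longrightarrow> 0 \<le> s \<Longrightarrow> 0 \<le> err q G n s"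
  unfolding err_def using seminorm_nonneg[OF admissible_seminorm]
  by (auto intro!: sum_nonneg mult_nonneg_nonneg weight_nonneg)

lemma err_le:
  assumes "0 \<le> s" "\<And>u v. u \<le> 1 \<Longrightarrow> v \<le> 1 \<Longrightarrow> q (node G u - node G v) \<le> K"
  shows "err q G n s \<le> K"
proof -
  have "err q G n s \<le> (\<Sum>k\<le>n. weight n k s * K)"
    unfolding err_def using assms(2)[of _ "exp (- s)"] assms(1)
    by (intro sum_mono mult_left_mono weight_nonneg) (auto simp: node_exp divide_le_eq)
  then show ?thesis by (simp add: sum_distrib_right[symmetric] weight_sum)
qed

text \<open>Bernstein's proof of the Weierstrass theorem: nodes near \<open>exp (- s)\<close> are
  controlled by uniform continuity, distant ones by Chebyshev's inequality. The range of
  \<open>s\<close> is bounded because \<open>exp (- s)\<close> must stay away from 0.\<close>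

lemma err_uniform:
  assumes G: "bcont G" and q: "admissible q" and e: "0 < e"
  shows "\<exists>N. \<forall>n\<ge>N. \<forall>s. 0 \<le> s \<and> s \<le> R \<longrightarrow> err q G n s \<le> e"
proof -
  obtain K where K0: "0 \<le> K" and K: "\<And>v u. v \<le> 1 \<Longrightarrow> u \<le> 1 \<Longrightarrow> q (node G v - node G u) \<le> K"
    using node_diff_bound[OF G q] by blast
  obtain d where d: "0 < d"
    "\<And>u v. u \<in> {exp (-R)..1} \<Longrightarrow> v \<in> {0..1} \<Longrightarrow> \<bar>u - v\<bar> < d \<Longrightarrow> q (node G v - node G u) < e/2"
    using node_uniform[OF G q, of "e/2" "exp (-R)"] e by auto
  obtain N where N: "real N > 2 * K / (d\<^sup>2 * e)" using reals_Archimedean2 by blast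
  show ?thesis
  proof (intro exI allI impI)
    \<comment> \<open>The estimate starts at \<open>Suc N\<close> so that the degree is positive, as
      the variance bound demands.\<close>
    fix n s assume n: "Suc N \<le> n" and s: "0 \<le> s \<and> s \<le> R"
    define u where "u = exp (- s)"
    have u: "u \<in> {exp (-R)..1}" "0 \<le> u" "u \<le> 1" using s by (auto simp: u_def)
    \<comment> \<open>One inequality for both kinds of nodes: the quadratic term reaches
      \<open>K\<close> as soon as the distance reaches \<open>d\<close>.\<close>
    have "q (node G (k / n) - G s) \<le> e/2 + K / d\<^sup>2 * (real k / real n - u)\<^sup>2" if "k \<le> n" for k
    proof -
      have kn: "real k / real n \<in> {0..1}" using that n by (auto simp: divide_simps)
      show ?thesis
      proof (cases "\<bar>u - real k / real n\<bar> < d")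
        case True
        then have "q (node G (k / n) - node G u) < e/2" using d(2)[OF u(1) kn] by simp
        then show ?thesis using K0 by (simp add: u_def node_exp add_increasing2)
      next
        case False
        then have "d\<^sup>2 \<le> (real k / real n - u)\<^sup>2"
          using d(1) abs_le_square_iff[of d "real k / real n - u"] by (simp add: abs_minus_commute)
        then have "K * 1 \<le> K * ((real k / real n - u)\<^sup>2 / d\<^sup>2)"
          using K0 d(1) by (intro mult_left_mono) auto
        moreover have "q (node G (k / n) - G s) \<le> K"
          using K[of "k / n" u] kn u by (simp add: u_def node_exp)
        ultimately show ?thesis using e by simp
      qed
    qed
    then have "err q G n s
        \<le> (\<Sum>k\<le>n. weight n k s * (e/2 + K / d\<^sup>2 * (real k / real n - u)\<^sup>2))"
      unfolding err_def using s by (intro sum_mono mult_left_mono weight_nonneg) auto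
    also have "\<dots> = e/2 * (\<Sum>k\<le>n. weight n k s) + K / d\<^sup>2 * (\<Sum>k\<le>n. weight n k s * (real k / real n - u)\<^sup>2)"
      by (simp add: distrib_left sum.distrib sum_distrib_left mult_ac)
    also have "(\<Sum>k\<le>n. weight n k s * (real k / real n - u)\<^sup>2) \<le> 1 / real n"
      unfolding weight_def u_def[symmetric] using n u by (intro sum_Bernstein_variance_le) auto
    also have "e/2 * (\<Sum>k\<le>n. weight n k s) + K / d\<^sup>2 * (1 / real n) \<le> e/2 + e/2"
    proof -
      have "2 * K / (d\<^sup>2 * e) \<le> real n" using N n by linarith
      then have "K / d\<^sup>2 * (1 / real n) \<le> e/2" using d(1) e n by (simp add: field_simps)
      then show ?thesis unfolding weight_sum by linarith
    qed
    finally show "err q G n s \<le> e"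
      using K0 d(1) by (simp add: mult_left_mono divide_right_mono)
  qed
qed

end

section \<open>Integrals of bounded continuous functions\<close>

context saks_space
begin

definition approx_integral :: "real measure \<Rightarrow> (real \<Rightarrow> 'a) \<Rightarrow> nat \<Rightarrow> 'a" where
  "approx_integral \<rho> G n = (\<Sum>k\<le>n. (LINT s:{0..}|\<rho>. weight n k s) *\<^sub>R node G (k / n))"

lemma weight_integrable:
  assumes "half_line_measure \<rho>" "k \<le> n"
  shows "set_integrable \<rho> {0..} (weight n k)"
  using assms weight_le_1 weight_nonneg
  by (intro half_line_integrable[of _ _ 1] weight_continuous) auto

lemma set_lint_sum:
  fixes F :: "'i \<Rightarrow> real \<Rightarrow> 'e::euclidean_space"
  assumes "\<And>i. i \<in> I \<Longrightarrow> set_integrable M A (F i)"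
  shows "(LINT s:A|M. \<Sum>i\<in>I. F i s) = (\<Sum>i\<in>I. LINT s:A|M. F i s)"
    "set_integrable M A (\<lambda>s. \<Sum>i\<in>I. F i s)"
  using assms unfolding set_lebesgue_integral_def set_integrable_def scaleR_sum_right
  by (auto intro!: Bochner_Integration.integral_sum Bochner_Integration.integrable_sum)

lemma set_lint_scaleR_left:
  fixes x :: "'e::euclidean_space"
  assumes "set_integrable M A g"
  shows "(LINT s:A|M. g s *\<^sub>R x) = (LINT s:A|M. g s) *\<^sub>R x"
    "set_integrable M A (\<lambda>s. g s *\<^sub>R x)"
  using assms integrable_scaleR_left[of x M "\<lambda>s. indicator A s *\<^sub>R g s"]
    integral_scaleR_left[of x M "\<lambda>s. indicator A s *\<^sub>R g s"]
  unfolding set_lebesgue_integral_def set_integrable_def by (auto simp: mult.assoc)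

lemma seminorm_weighted_sum:
  fixes \<rho> :: "real measure"
  assumes q: "seminorm q" and I: "finite I"
    and f: "\<And>i. i \<in> I \<Longrightarrow> set_integrable \<rho> {0..} (f i)" "\<And>i s. i \<in> I \<Longrightarrow> 0 \<le> s \<Longrightarrow> 0 \<le> f i s"
  shows "q (\<Sum>i\<in>I. (LINT s:{0..}|\<rho>. f i s) *\<^sub>R v i) \<le> (LINT s:{0..}|\<rho>. \<Sum>i\<in>I. f i s * q (v i))"
proof -
  have "q (\<Sum>i\<in>I. (LINT s:{0..}|\<rho>. f i s) *\<^sub>R v i) \<le> (\<Sum>i\<in>I. (LINT s:{0..}|\<rho>. f i s) * q (v i))"
  proof (rule order_trans[OF seminorm_sum[OF q]], rule sum_mono)
    fix i assume i: "i \<in> I"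
    have "0 \<le> (LINT s:{0..}|\<rho>. f i s)"
      unfolding set_lebesgue_integral_def using f(2)[OF i] by (intro integral_nonneg_AE) (auto simp: indicator_def)
    then show "q ((LINT s:{0..}|\<rho>. f i s) *\<^sub>R v i) \<le> (LINT s:{0..}|\<rho>. f i s) * q (v i)"
      by (simp add: seminorm_scaleR[OF q])
  qed
  also have "\<dots> = (LINT s:{0..}|\<rho>. \<Sum>i\<in>I. f i s * q (v i))"
    using set_lint_sum(1)[where I = I and M = \<rho> and A = "{0..}" and F = "\<lambda>i s. f i s * q (v i)"] f(1) by simp
  finally show ?thesis .
qed

text \<open>Two degrees are compared on the product partition of unity
  \<open>weight m k s * weight n j s\<close>, each difference of nodes passing through
  \<open>G s\<close>. \<open>K\<close> and \<open>N\<close> are chosen before \<open>\<rho>\<close>;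
  this uniformity later allows the measure to vary.\<close>

lemma approx_integral_Cauchy:
  assumes G: "bcont G" and q: "admissible q"
  shows "\<exists>K\<ge>0. \<forall>e>0. \<forall>R. \<exists>N. \<forall>m\<ge>N. \<forall>n\<ge>N. \<forall>\<rho>. half_line_measure \<rho> \<longrightarrow>
    q (approx_integral \<rho> G m - approx_integral \<rho> G n) \<le> e * measure \<rho> UNIV + K * measure \<rho> {R<..}"
proof -
  note sn = admissible_seminorm[OF q]
  obtain K where K: "0 \<le> K" "\<And>u v. u \<le> 1 \<Longrightarrow> v \<le> 1 \<Longrightarrow> q (node G u - node G v) \<le> K"
    using node_diff_bound[OF G q] by blast
  show ?thesis
  proof (intro exI[of _ K] conjI K(1) allI impI)
    fix e R :: real assume e: "0 < e"
    obtain N where N: "\<And>n s. N \<le> n \<Longrightarrow> 0 \<le> s \<Longrightarrow> s \<le> R \<Longrightarrow>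
        err q G n s \<le> e/2"
      using err_uniform[OF G q, of "e/2" R] e by auto
    show "\<exists>N. \<forall>m\<ge>N. \<forall>n\<ge>N. \<forall>\<rho>. half_line_measure \<rho> \<longrightarrow>
      q (approx_integral \<rho> G m - approx_integral \<rho> G n) \<le> e * measure \<rho> UNIV + K * measure \<rho> {R<..}"
    proof (intro exI allI impI)
      fix m n \<rho> assume mn: "N \<le> m" "N \<le> n" and \<rho>: "half_line_measure \<rho>"
      define I where "I = {..m} \<times> {..n}"
      define f where "f i s = weight m (fst i) s * weight n (snd i) s" for i s
      define v where "v i = node G (fst i / m) - node G (snd i / n)" for i :: "nat \<times> nat"
      have frac: "real k / real j \<le> 1" if "k \<le> j" for k j using that by (simp add: divide_le_eq)
      have f_int: "set_integrable \<rho> {0..} (f i)" if "i \<in> I" for i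
        using that weight_le_1 weight_nonneg unfolding f_def[abs_def] I_def
        by (intro half_line_integrable[OF \<rho>, of _ 1] continuous_intros weight_continuous)
          (auto simp: abs_mult intro!: mult_le_one)
      have f_nonneg: "0 \<le> f i s" if "0 \<le> s" for i s using that by (simp add: f_def weight_nonneg)
      have one1: "(\<Sum>j\<le>n. f (k, j) s) = weight m k s" for k s
        by (simp add: f_def sum_distrib_left[symmetric] weight_sum)
      have one2: "(\<Sum>k\<le>m. f (k, j) s) = weight n j s" for j s
        by (simp add: f_def sum_distrib_right[symmetric] weight_sum)
      have "approx_integral \<rho> G m = (\<Sum>k\<le>m. \<Sum>j\<le>n. (LINT s:{0..}|\<rho>. f (k, j) s) *\<^sub>R node G (k / m))"
        unfolding approx_integral_def one1[symmetric]
        by (intro sum.cong refl, subst set_lint_sum) (auto simp: f_int I_def scaleR_sum_left)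
      moreover have "approx_integral \<rho> G n = (\<Sum>j\<le>n. \<Sum>k\<le>m. (LINT s:{0..}|\<rho>. f (k, j) s) *\<^sub>R node G (j / n))"
        unfolding approx_integral_def one2[symmetric]
        by (intro sum.cong refl, subst set_lint_sum) (auto simp: f_int I_def scaleR_sum_left)
      then have "approx_integral \<rho> G n = (\<Sum>k\<le>m. \<Sum>j\<le>n. (LINT s:{0..}|\<rho>. f (k, j) s) *\<^sub>R node G (j / n))"
        by (simp add: sum.swap[of _ "{..n}"])
      ultimately have "approx_integral \<rho> G m - approx_integral \<rho> G n
          = (\<Sum>k\<le>m. \<Sum>j\<le>n. (LINT s:{0..}|\<rho>. f (k, j) s) *\<^sub>R v (k, j))"
        by (simp add: v_def scaleR_diff_right sum_subtractf)
      then have "approx_integral \<rho> G m - approx_integral \<rho> G n = (\<Sum>i\<in>I. (LINT s:{0..}|\<rho>. f i s) *\<^sub>R v i)"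
        by (simp add: I_def sum.cartesian_product split_def)
      also have "q \<dots> \<le> (LINT s:{0..}|\<rho>. \<Sum>i\<in>I. f i s * q (v i))"
        by (rule seminorm_weighted_sum[OF sn]) (auto simp: I_def[symmetric] f_int f_nonneg, simp add: I_def)
      also have "\<dots> \<le> e * measure \<rho> UNIV + K * measure \<rho> {R<..}"
      proof (rule half_line_lint_tail[OF \<rho>])
        show "set_integrable \<rho> {0..} (\<lambda>s. \<Sum>i\<in>I. f i s * q (v i))"
          using f_int by (intro set_lint_sum) auto
      next
        fix s :: real assume s: "0 \<le> s"
        have "(\<Sum>i\<in>I. f i s * q (v i)) \<le> (\<Sum>i\<in>I. f i s * K)"
          using frac by (intro sum_mono mult_left_mono f_nonneg s) (auto simp: v_def I_def intro!: K)
        also have "\<dots> = (\<Sum>k\<le>m. \<Sum>j\<le>n. f (k, j) s) * K"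
          by (simp add: I_def sum.cartesian_product sum_distrib_right)
        also have "\<dots> = K" by (simp add: one1 weight_sum)
        finally show "(\<Sum>i\<in>I. f i s * q (v i)) \<le> K" .
      next
        fix s :: real assume s: "0 \<le> s" "s \<le> R"
        have "(\<Sum>i\<in>I. f i s * q (v i)) \<le>
            (\<Sum>i\<in>I. f i s * (q (node G (fst i / m) - G s) + q (node G (snd i / n) - G s)))"
          using seminorm_triangle_diff[OF sn, of _ _ "G s"] seminorm_diff_commute[OF sn, of "G s"]
          by (intro sum_mono mult_left_mono f_nonneg s) (auto simp: v_def)
        also have "\<dots> = (\<Sum>k\<le>m. \<Sum>j\<le>n. f (k, j) s * q (node G (k / m) - G s))
            + (\<Sum>k\<le>m. \<Sum>j\<le>n. f (k, j) s * q (node G (j / n) - G s))"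
          by (simp add: I_def sum.cartesian_product distrib_left sum.distrib split_def)
        also have "(\<Sum>k\<le>m. \<Sum>j\<le>n. f (k, j) s * q (node G (k / m) - G s))
            = (\<Sum>k\<le>m. weight m k s * q (node G (k / m) - G s))"
          by (simp add: sum_distrib_right[symmetric] one1)
        also have "(\<Sum>k\<le>m. \<Sum>j\<le>n. f (k, j) s * q (node G (j / n) - G s))
            = (\<Sum>j\<le>n. weight n j s * q (node G (j / n) - G s))"
          by (subst sum.swap) (simp add: sum_distrib_right[symmetric] one2)
        also have "(\<Sum>k\<le>m. weight m k s * q (node G (k / m) - G s))
            + (\<Sum>j\<le>n. weight n j s * q (node G (j / n) - G s)) \<le> e/2 + e/2"
          unfolding err_def[symmetric] by (intro add_mono N mn s)
        finally show "(\<Sum>i\<in>I. f i s * q (v i)) \<le> e" by simp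
      qed (use e K(1) in auto)
      finally show "q (approx_integral \<rho> G m - approx_integral \<rho> G n) \<le> e * measure \<rho> UNIV + K * measure \<rho> {R<..}" .
    qed
  qed
qed

definition has_vint :: "real measure \<Rightarrow> (real \<Rightarrow> 'a) \<Rightarrow> 'a \<Rightarrow> bool" where
  "has_vint \<rho> G y \<longleftrightarrow> (\<forall>\<phi>\<in>\<Phi>. \<phi> y = (LINT s:{0..}|\<rho>. \<phi> (G s)))"

definition vint :: "real measure \<Rightarrow> (real \<Rightarrow> 'a) \<Rightarrow> 'a" where
  "vint \<rho> G = (THE y. has_vint \<rho> G y)"

lemma has_vint_unique: "has_vint \<rho> G y \<Longrightarrow> has_vint \<rho> G y' \<Longrightarrow> y = y'"
  by (rule eq_by_\<Phi>) (metis has_vint_def)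

lemma vint_eqI: "has_vint \<rho> G y \<Longrightarrow> vint \<rho> G = y"
  unfolding vint_def using has_vint_unique by blast

context
  fixes \<rho> :: "real measure" and G :: "real \<Rightarrow> 'a"
  assumes \<rho>: "half_line_measure \<rho>" and G: "bcont G"
begin

lemma bcont_\<Phi>_integrable:
  assumes "\<phi> \<in> \<Phi>"
  shows "set_integrable \<rho> {0..} (\<lambda>s. \<phi> (G s))"
proof -
  obtain K where "\<And>s. 0 \<le> s \<Longrightarrow> norm (\<phi> (G s)) \<le> K"
    using bcont_seminorm_boundE[OF G admissible_\<Phi>[OF assms]] by metis
  then show ?thesis by (rule half_line_integrable[OF \<rho> bcont_\<Phi>_continuous[OF G assms]])
qed

lemma bcont_seminorm_integrable:
  assumes "admissible q"
  shows "set_integrable \<rho> {0..} (\<lambda>s. q (G s))"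
proof -
  obtain K where "\<And>s. 0 \<le> s \<Longrightarrow> q (G s) \<le> K" using bcont_seminorm_boundE[OF G assms] by metis
  then show ?thesis
    by (intro half_line_integrable[OF \<rho> bcont_seminorm_continuous[OF G assms]])
      (simp add: seminorm_nonneg[OF admissible_seminorm[OF assms]])
qed

lemma err_integrable:
  assumes "admissible q"
  shows "set_integrable \<rho> {0..} (\<lambda>s. err q G n s)"
proof -
  note sn = admissible_seminorm[OF assms]
  obtain K where K: "0 \<le> K" "\<And>u v. u \<le> 1 \<Longrightarrow> v \<le> 1 \<Longrightarrow> q (node G u - node G v) \<le> K"
    using node_diff_bound[OF G assms] by blast
  show ?thesis
  proof (rule half_line_integrable[OF \<rho>])
    have "continuous_on {0..} (\<lambda>s. q (G s - x))" for x
      by (rule bcont_seminorm_continuous[OF bcont_diff_const[OF G] assms])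
    then show "continuous_on {0..} (\<lambda>s. err q G n s)"
      unfolding err_def
      by (intro continuous_on_sum continuous_on_mult weight_continuous)
        (simp add: seminorm_diff_commute[OF sn, of "node G _"])
    show "norm (err q G n s) \<le> K" if "0 \<le> s" for s
      using err_le[of s q G K n, OF that K(2)] err_nonneg[OF assms that] by simp
  qed
qed

lemma err_integral:
  assumes q: "admissible q"
  shows "(\<lambda>n. LINT s:{0..}|\<rho>. err q G n s) \<longlonglongrightarrow> 0"
proof (rule LIMSEQ_I)
  fix e :: real assume e: "0 < e"
  obtain K where K: "0 \<le> K" "\<And>u v. u \<le> 1 \<Longrightarrow> v \<le> 1 \<Longrightarrow> q (node G u - node G v) \<le> K"
    using node_diff_bound[OF G q] by blast
  obtain d R where d: "0 < d" "d * measure \<rho> UNIV + K * measure \<rho> {R<..} < e"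
    using half_line_small[OF \<rho> e K(1)] by blast
  obtain N where N: "\<And>n s. N \<le> n \<Longrightarrow> 0 \<le> s \<Longrightarrow> s \<le> R \<Longrightarrow> err q G n s \<le> d"
    using err_uniform[OF G q d(1), of R] by auto
  show "\<exists>N. \<forall>n\<ge>N. norm ((LINT s:{0..}|\<rho>. err q G n s) - 0) < e"
  proof (intro exI allI impI)
    fix n assume n: "N \<le> n"
    have "(LINT s:{0..}|\<rho>. err q G n s) \<le> d * measure \<rho> UNIV + K * measure \<rho> {R<..}"
      by (rule half_line_lint_tail[OF \<rho> err_integrable[OF q]]) (use N n d K err_le in auto)
    moreover have "0 \<le> (LINT s:{0..}|\<rho>. err q G n s)"
      unfolding set_lebesgue_integral_def
      by (intro integral_nonneg_AE always_eventually allI) (auto simp: indicator_def err_nonneg[OF q])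
    ultimately show "norm ((LINT s:{0..}|\<rho>. err q G n s) - 0) < e" using d(2) by simp
  qed
qed

lemma approx_integral_\<Phi>:
  assumes \<phi>: "\<phi> \<in> \<Phi>"
  shows "(\<lambda>n. \<phi> (approx_integral \<rho> G n)) \<longlonglongrightarrow> (LINT s:{0..}|\<rho>. \<phi> (G s))"
proof -
  note a = admissible_\<Phi>[OF \<phi>]
  have "norm (\<phi> (approx_integral \<rho> G n) - (LINT s:{0..}|\<rho>. \<phi> (G s)))
      \<le> (LINT s:{0..}|\<rho>. err (\<lambda>x. norm (\<phi> x)) G n s)" for n
  proof -
    define F where "F s = (\<Sum>k\<le>n. weight n k s *\<^sub>R \<phi> (node G (k / n)))" for s
    have w: "k \<in> {..n} \<Longrightarrow> set_integrable \<rho> {0..} (weight n k)" for k using weight_integrable[OF \<rho>] by simp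
    have F: "set_integrable \<rho> {0..} F"
      unfolding F_def[abs_def] by (intro set_lint_sum set_lint_scaleR_left w)
    have "\<phi> (approx_integral \<rho> G n) = (LINT s:{0..}|\<rho>. F s)"
      unfolding F_def approx_integral_def using w
      by (subst set_lint_sum) (simp_all add: set_lint_scaleR_left \<Phi>_sum[OF \<phi>] \<Phi>_scaleR[OF \<phi>])
    then have "\<phi> (approx_integral \<rho> G n) - (LINT s:{0..}|\<rho>. \<phi> (G s)) = (LINT s:{0..}|\<rho>. F s - \<phi> (G s))"
      using F bcont_\<Phi>_integrable[OF \<phi>] by simp
    also have "norm \<dots> \<le> (LINT s:{0..}|\<rho>. norm (F s - \<phi> (G s)))"
      by (intro set_integral_norm_bound set_integral_diff F bcont_\<Phi>_integrable \<phi>)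
    also have "\<dots> \<le> (LINT s:{0..}|\<rho>. err (\<lambda>x. norm (\<phi> x)) G n s)"
    proof (rule half_line_lint_mono[OF \<rho> _ err_integrable[OF a]])
      show "set_integrable \<rho> {0..} (\<lambda>s. norm (F s - \<phi> (G s)))"
        by (intro set_integrable_norm set_integral_diff F bcont_\<Phi>_integrable \<phi>)
      fix s :: real assume s: "0 \<le> s"
      have "F s - \<phi> (G s) = (\<Sum>k\<le>n. weight n k s *\<^sub>R \<phi> (node G (k / n) - G s))"
        by (simp add: F_def \<Phi>_diff[OF \<phi>] scaleR_diff_right sum_subtractf scaleR_sum_left[symmetric] weight_sum)
      then show "norm (F s - \<phi> (G s)) \<le> err (\<lambda>x. norm (\<phi> x)) G n s"
        using weight_nonneg[OF s] by (auto simp: err_def intro!: order_trans[OF norm_sum] sum_mono)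
    qed
    finally show ?thesis .
  qed
  then have "(\<lambda>n. \<phi> (approx_integral \<rho> G n) - (LINT s:{0..}|\<rho>. \<phi> (G s))) \<longlonglongrightarrow> 0"
    by (intro Lim_null_comparison[OF _ err_integral[OF a]]) auto
  then show ?thesis by (rule LIM_zero_cancel)
qed

lemma approx_integral_seminorm_le:
  assumes q: "seminorm q" and C: "\<And>s. 0 \<le> s \<Longrightarrow> q (G s) \<le> C" "0 \<le> C"
  shows "q (approx_integral \<rho> G n) \<le> C * measure \<rho> UNIV"
proof -
  have "q (approx_integral \<rho> G n) \<le> (LINT s:{0..}|\<rho>. \<Sum>k\<le>n. weight n k s * q (node G (k / n)))"
    unfolding approx_integral_def
    by (rule seminorm_weighted_sum[OF q]) (auto simp: weight_integrable[OF \<rho>] weight_nonneg)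
  also have "\<dots> \<le> C * measure \<rho> UNIV"
  proof (rule half_line_lint_le_const[OF \<rho>])
    show "set_integrable \<rho> {0..} (\<lambda>s. \<Sum>k\<le>n. weight n k s * q (node G (k / n)))"
      using weight_integrable[OF \<rho>] by (intro set_lint_sum) auto
    fix s :: real assume s: "0 \<le> s"
    have "q (node G (k / n)) \<le> C" if "k \<le> n" for k
      using that C seminorm_zero[OF q] by (auto simp: node_def divide_le_eq)
    then have "(\<Sum>k\<le>n. weight n k s * q (node G (k / n))) \<le> (\<Sum>k\<le>n. weight n k s * C)"
      using s by (intro sum_mono mult_left_mono weight_nonneg) auto
    then show "(\<Sum>k\<le>n. weight n k s * q (node G (k / n))) \<le> C"
      by (simp add: sum_distrib_right[symmetric] weight_sum)
  qed
  finally show ?thesis .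
qed

text \<open>Sequential completeness provides a limit of the Bernstein sums, and the functionals
  identify it. Both claims are proved together because \<open>vint\<close> is a definite description
  and needs a witness.\<close>

lemma has_vint_vint: "has_vint \<rho> G (vint \<rho> G)"
  and approx_integral_sconv: "sconv (approx_integral \<rho> G) (vint \<rho> G)"
proof -
  obtain C where C: "0 \<le> C" "\<And>s. 0 \<le> s \<Longrightarrow> norm (G s) \<le> C" using bcont_boundE[OF G] by metis
  have norm_sn: "seminorm norm" by (simp add: seminorm_def norm_triangle_ineq)
  have b: "bounded (range (approx_integral \<rho> G))"
    unfolding bounded_iff
    by (intro exI[of _ "C * measure \<rho> UNIV"]) (auto intro!: approx_integral_seminorm_le[OF norm_sn] C)
  have "\<exists>N. \<forall>m\<ge>N. \<forall>n\<ge>N. p (approx_integral \<rho> G m - approx_integral \<rho> G n) < e" if p: "p \<in> P" and e: "0 < e" for p e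
  proof -
    obtain K where K: "K \<ge> 0" "\<And>e R. 0 < e \<Longrightarrow> \<exists>N. \<forall>m\<ge>N. \<forall>n\<ge>N. \<forall>\<rho>. half_line_measure \<rho> \<longrightarrow>
      p (approx_integral \<rho> G m - approx_integral \<rho> G n) \<le> e * measure \<rho> UNIV + K * measure \<rho> {R<..}"
      using approx_integral_Cauchy[OF G admissible_P[OF p]] by blast
    obtain d R where d: "0 < d" "d * measure \<rho> UNIV + K * measure \<rho> {R<..} < e"
      using half_line_small[OF \<rho> e K(1)] by blast
    then show ?thesis using K(2)[OF d(1), of R] \<rho> d(2) by (meson le_less_trans)
  qed
  then obtain y where y: "sconv (approx_integral \<rho> G) y" using P_complete[OF b] by blast
  have "has_vint \<rho> G y"
    unfolding has_vint_def using LIMSEQ_unique \<Phi>_conv[OF _ y] approx_integral_\<Phi> by blast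
  then show "has_vint \<rho> G (vint \<rho> G)" "sconv (approx_integral \<rho> G) (vint \<rho> G)"
    using y vint_eqI by auto
qed

lemma \<Phi>_vint: "\<phi> \<in> \<Phi> \<Longrightarrow> \<phi> (vint \<rho> G) = (LINT s:{0..}|\<rho>. \<phi> (G s))"
  using has_vint_vint by (simp add: has_vint_def)

text \<open>The norm need not be admissible, so \<open>norm (G s)\<close> is not known to be
  integrable; the bound goes through functionals dominated by the norm.\<close>

lemma norm_vint_le:
  assumes C: "\<And>s. 0 \<le> s \<Longrightarrow> norm (G s) \<le> C"
  shows "norm (vint \<rho> G) \<le> C * measure \<rho> UNIV"
proof (rule P_norming)
  fix \<phi> assume \<phi>: "\<phi> \<in> \<Phi>" and \<phi>1: "\<And>y. norm (\<phi> y) \<le> norm y"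
  have "norm (\<phi> (vint \<rho> G)) \<le> (LINT s|\<rho>. norm (indicat_real {0..} s *\<^sub>R \<phi> (G s)))"
    unfolding \<Phi>_vint[OF \<phi>] set_lebesgue_integral_def by (rule integral_norm_bound)
  also have "\<dots> = (LINT s:{0..}|\<rho>. norm (\<phi> (G s)))"
    by (simp add: set_lebesgue_integral_def)
  also have "\<dots> \<le> C * measure \<rho> UNIV"
    using C \<phi>1 by (intro half_line_lint_le_const[OF \<rho>] bcont_seminorm_integrable admissible_\<Phi> \<phi>)
      (meson order_trans)
  finally show "norm (\<phi> (vint \<rho> G)) \<le> C * measure \<rho> UNIV" .
qed

text \<open>The triangle inequality is clear for the finite Bernstein sums. Replacing the value at a
  node by \<open>p (G s)\<close> costs \<open>err\<close>, whose integral tends to 0.\<close>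

lemma seminorm_vint_le:
  assumes p: "p \<in> P"
  shows "p (vint \<rho> G) \<le> (LINT s:{0..}|\<rho>. p (G s))"
proof -
  note a = admissible_P[OF p] and sn = P_seminorm[OF p]
  let ?E = "\<lambda>n. LINT s:{0..}|\<rho>. err p G n s"
  have "p (approx_integral \<rho> G n) \<le> (LINT s:{0..}|\<rho>. p (G s)) + ?E n" for n
  proof -
    have "p (approx_integral \<rho> G n) \<le> (LINT s:{0..}|\<rho>. \<Sum>k\<le>n. weight n k s * p (node G (k / n)))"
      unfolding approx_integral_def
      by (rule seminorm_weighted_sum[OF sn]) (auto simp: weight_integrable[OF \<rho>] weight_nonneg)
    also have "\<dots> \<le> (LINT s:{0..}|\<rho>. p (G s) + err p G n s)"
    proof (rule half_line_lint_mono[OF \<rho>])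
      show "set_integrable \<rho> {0..} (\<lambda>s. \<Sum>k\<le>n. weight n k s * p (node G (k / n)))"
        using weight_integrable[OF \<rho>] by (intro set_lint_sum) auto
      show "set_integrable \<rho> {0..} (\<lambda>s. p (G s) + err p G n s)"
        by (rule set_integral_add[OF bcont_seminorm_integrable[OF a] err_integrable[OF a]])
      fix s :: real assume s: "0 \<le> s"
      have "(\<Sum>k\<le>n. weight n k s * p (node G (k / n)))
          \<le> (\<Sum>k\<le>n. weight n k s * (p (G s) + p (node G (k / n) - G s)))"
        using seminorm_triangle[OF sn, of "G s" "_ - G s"]
        by (intro sum_mono mult_left_mono weight_nonneg s) simp
      also have "\<dots> = p (G s) + err p G n s"
        by (simp add: err_def distrib_left sum.distrib sum_distrib_right[symmetric] weight_sum)
      finally show "(\<Sum>k\<le>n. weight n k s * p (node G (k / n)))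
          \<le> p (G s) + err p G n s" .
    qed
    also have "\<dots> = (LINT s:{0..}|\<rho>. p (G s)) + ?E n"
      by (rule set_integral_add[OF bcont_seminorm_integrable[OF a] err_integrable[OF a]])
    finally show ?thesis .
  qed
  moreover have "p (vint \<rho> G) \<le> p (approx_integral \<rho> G n) + p (approx_integral \<rho> G n - vint \<rho> G)" for n
    using seminorm_reverse_triangle[OF sn, of "approx_integral \<rho> G n" "vint \<rho> G"] by linarith
  ultimately have "p (vint \<rho> G) \<le> (LINT s:{0..}|\<rho>. p (G s)) + ?E n + p (approx_integral \<rho> G n - vint \<rho> G)" for n
    by (meson add_right_mono order_trans)
  moreover have "(\<lambda>n. (LINT s:{0..}|\<rho>. p (G s)) + ?E n + p (approx_integral \<rho> G n - vint \<rho> G))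
      \<longlonglongrightarrow> (LINT s:{0..}|\<rho>. p (G s)) + 0 + 0"
    using approx_integral_sconv p by (intro tendsto_intros err_integral a) (simp add: seq_conv_def)
  ultimately show ?thesis by (intro LIMSEQ_le_const) auto
qed

end

lemma vint_add:
  assumes "half_line_measure \<rho>" "bcont G" "bcont G'"
  shows "vint \<rho> (\<lambda>s. G s + G' s) = vint \<rho> G + vint \<rho> G'"
  using assms by (intro vint_eqI) (simp add: has_vint_def \<Phi>_vint \<Phi>_add bcont_\<Phi>_integrable)

lemma vint_const:
  assumes "half_line_measure \<rho>"
  shows "vint \<rho> (\<lambda>_. x) = measure \<rho> UNIV *\<^sub>R x"
proof (rule eq_by_\<Phi>)
  fix \<phi> assume \<phi>: "\<phi> \<in> \<Phi>"
  have "(LINT s:{0..}|\<rho>. 1 *\<^sub>R \<phi> x) = (LINT s:{0..}|\<rho>. 1) *\<^sub>R \<phi> x"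
    using half_line_integrable[OF assms, of "\<lambda>_. 1::real" 1] by (intro set_lint_scaleR_left) auto
  then show "\<phi> (vint \<rho> (\<lambda>_. x)) = \<phi> (measure \<rho> UNIV *\<^sub>R x)"
    by (simp add: \<Phi>_vint[OF assms bcont_const \<phi>] half_line_lint_const[OF assms] \<Phi>_scaleR[OF \<phi>])
qed

lemma vint_diff_const:
  assumes "half_line_measure \<rho>" "bcont G"
  shows "vint \<rho> (\<lambda>s. G s - x) = vint \<rho> G - measure \<rho> UNIV *\<^sub>R x"
  using vint_add[OF assms bcont_const[of "- x"]] vint_const[OF assms(1), of "- x"] by simp

text \<open>Letting \<open>m\<close> tend to infinity in the Cauchy estimate keeps \<open>N\<close>
  independent of \<open>\<rho>\<close>, so a degree can be fixed before the measure runs through a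
  sequence.\<close>

lemma approx_integral_error:
  assumes G: "bcont G" and p: "p \<in> P"
  shows "\<exists>K\<ge>0. \<forall>e>0. \<forall>R. \<exists>N. \<forall>n\<ge>N. \<forall>\<rho>. half_line_measure \<rho> \<longrightarrow>
    p (vint \<rho> G - approx_integral \<rho> G n) \<le> e * measure \<rho> UNIV + K * measure \<rho> {R<..}"
proof -
  note sn = P_seminorm[OF p]
  obtain K where K: "K \<ge> 0" "\<And>e R. 0 < e \<Longrightarrow> \<exists>N. \<forall>m\<ge>N. \<forall>n\<ge>N. \<forall>\<rho>. half_line_measure \<rho> \<longrightarrow>
    p (approx_integral \<rho> G m - approx_integral \<rho> G n) \<le> e * measure \<rho> UNIV + K * measure \<rho> {R<..}"
    using approx_integral_Cauchy[OF G admissible_P[OF p]] by blast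
  show ?thesis
  proof (intro exI[of _ K] conjI K(1) allI impI)
    fix e R :: real assume "0 < e"
    then obtain N where N: "\<And>m n \<rho>. N \<le> m \<Longrightarrow> N \<le> n \<Longrightarrow> half_line_measure \<rho> \<Longrightarrow>
      p (approx_integral \<rho> G m - approx_integral \<rho> G n) \<le> e * measure \<rho> UNIV + K * measure \<rho> {R<..}"
      using K(2) by blast
    have "p (vint \<rho> G - approx_integral \<rho> G n) \<le> e * measure \<rho> UNIV + K * measure \<rho> {R<..}"
      if n: "N \<le> n" and \<rho>: "half_line_measure \<rho>" for n \<rho>
    proof (rule LIMSEQ_le_const)
      have "(\<lambda>m. p (approx_integral \<rho> G m - vint \<rho> G)) \<longlonglongrightarrow> 0"
        using approx_integral_sconv[OF \<rho> G] p by (simp add: seq_conv_def)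
      then show "(\<lambda>m. p (approx_integral \<rho> G m - vint \<rho> G) + (e * measure \<rho> UNIV + K * measure \<rho> {R<..}))
          \<longlonglongrightarrow> e * measure \<rho> UNIV + K * measure \<rho> {R<..}"
        using tendsto_add[OF _ tendsto_const] by fastforce
      show "\<exists>M. \<forall>m\<ge>M. p (vint \<rho> G - approx_integral \<rho> G n)
          \<le> p (approx_integral \<rho> G m - vint \<rho> G) + (e * measure \<rho> UNIV + K * measure \<rho> {R<..})"
        using N[OF _ n \<rho>] seminorm_triangle_diff[OF sn, of "vint \<rho> G" "approx_integral \<rho> G n"]
          seminorm_diff_commute[OF sn, of "vint \<rho> G"]
        by (intro exI[of _ N] allI impI) (smt (verit))
    qed
    then show "\<exists>N. \<forall>n\<ge>N. \<forall>\<rho>. half_line_measure \<rho> \<longrightarrow>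
      p (vint \<rho> G - approx_integral \<rho> G n) \<le> e * measure \<rho> UNIV + K * measure \<rho> {R<..}" by blast
  qed
qed

text \<open>Induction on \<open>i\<close>: a further factor \<open>1 - exp (- s)\<close> is the
  difference of the cases \<open>k\<close> and \<open>k + 1\<close>. The number \<open>b\<close> is
  the mass of a limit atom at the origin, where this factor vanishes, so it is seen only for
  \<open>i = 0\<close>.\<close>

lemma exp_power_integral_tendsto:
  assumes \<rho>: "\<And>n. half_line_measure (\<rho> n)" and \<rho>': "half_line_measure \<rho>'"
    and lim: "\<And>l. 0 \<le> l \<Longrightarrow> (\<lambda>n. laplace (\<rho> n) l) \<longlonglongrightarrow> b + laplace \<rho>' l"
  shows "(\<lambda>n. LINT s:{0..}|\<rho> n. exp (- s) ^ k * (1 - exp (- s)) ^ i)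
      \<longlonglongrightarrow> (if i = 0 then b else 0) + (LINT s:{0..}|\<rho>'. exp (- s) ^ k * (1 - exp (- s)) ^ i)"
proof (induction i arbitrary: k)
  case 0
  have "(LINT s:{0..}|r. exp (- s) ^ k * (1 - exp (- s)) ^ 0) = laplace r (real k)" for r
    by (simp add: laplace_def exp_of_nat_mult[symmetric])
  then show ?case using lim[of "real k"] by simp
next
  case (Suc i)
  have int: "set_integrable r {0..} (\<lambda>s. exp (- s) ^ k * (1 - exp (- s)) ^ i)" if "half_line_measure r" for r k
    by (rule half_line_integrable[OF that, of _ 1])
      (auto intro!: continuous_intros mult_le_one power_le_one simp: abs_mult power_abs)
  have eq: "(LINT s:{0..}|r. exp (- s) ^ k * (1 - exp (- s)) ^ Suc i)
      = (LINT s:{0..}|r. exp (- s) ^ k * (1 - exp (- s)) ^ i) - (LINT s:{0..}|r. exp (- s) ^ Suc k * (1 - exp (- s)) ^ i)"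
    if "half_line_measure r" for r
    by (subst set_integral_diff(2)[OF int[OF that] int[OF that], symmetric]) (simp add: algebra_simps)
  show ?case
    unfolding eq[OF \<rho>] eq[OF \<rho>'] using tendsto_diff[OF Suc.IH[of k] Suc.IH[of "Suc k"]] by (simp add: algebra_simps)
qed

lemma weight_integral_tendsto:
  assumes \<rho>: "\<And>n. half_line_measure (\<rho> n)" and \<rho>': "half_line_measure \<rho>'"
    and lim: "\<And>l. 0 \<le> l \<Longrightarrow> (\<lambda>n. laplace (\<rho> n) l) \<longlonglongrightarrow> b + laplace \<rho>' l"
    and k: "k \<le> m"
  shows "(\<lambda>n. LINT s:{0..}|\<rho> n. weight m k s)
      \<longlonglongrightarrow> (if k = m then b else 0) + (LINT s:{0..}|\<rho>'. weight m k s)"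
proof -
  have eq: "(LINT s:{0..}|r. weight m k s) = real (m choose k) * (LINT s:{0..}|r. exp (- s) ^ k * (1 - exp (- s)) ^ (m - k))" for r
    by (simp add: weight_def Bernstein_def mult.assoc)
  show ?thesis
    unfolding eq using tendsto_mult_left[OF exp_power_integral_tendsto[OF \<rho> \<rho>' lim, of k "m - k"], of "real (m choose k)"] k
    by (auto simp: distrib_left)
qed

text \<open>A continuity theorem for Laplace transforms, tested against vector valued functions: convergence
  of the Laplace transforms on \<open>[0, \<infinity>)\<close> gives convergence against the Bernstein weights and
  uniform smallness of the tails.\<close>
lemma vint_weak_limit:
  assumes G: "bcont G" and \<rho>: "\<And>n. half_line_measure (\<rho> n)" and \<rho>': "half_line_measure \<rho>'"
    and lim: "\<And>l. 0 \<le> l \<Longrightarrow> (\<lambda>n. laplace (\<rho> n) l) \<longlonglongrightarrow> b + laplace \<rho>' l"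
  shows "sconv (\<lambda>n. vint (\<rho> n) G) (b *\<^sub>R G 0 + vint \<rho>' G)"
proof -
  obtain C where C: "0 \<le> C" "\<And>s. 0 \<le> s \<Longrightarrow> norm (G s) \<le> C" using bcont_boundE[OF G] by metis
  have mlim: "(\<lambda>n. measure (\<rho> n) UNIV) \<longlonglongrightarrow> b + measure \<rho>' UNIV"
    using lim[of 0] by (simp add: laplace_0 \<rho> \<rho>')
  then obtain M where "0 < M" "\<And>n. norm (measure (\<rho> n) UNIV) \<le> M"
    using convergent_imp_Bseq[OF convergentI] by (metis BseqE)
  then have M: "0 < M" "\<And>n. measure (\<rho> n) UNIV \<le> M" by auto
  show ?thesis
  proof (rule sconvI)
    show "norm (vint (\<rho> n) G) \<le> C * M" for n
      using norm_vint_le[OF \<rho>[of n] G C(2)] mult_left_mono[OF M(2)[of n] C(1)] by simp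
    fix p assume p: "p \<in> P"
    note sn = P_seminorm[OF p]
    obtain K where K: "K \<ge> 0" "\<And>e R. 0 < e \<Longrightarrow> \<exists>N. \<forall>n\<ge>N. \<forall>\<rho>. half_line_measure \<rho> \<longrightarrow>
      p (vint \<rho> G - approx_integral \<rho> G n) \<le> e * measure \<rho> UNIV + K * measure \<rho> {R<..}"
      using approx_integral_error[OF G p] by blast
    show "(\<lambda>n. p (vint (\<rho> n) G - (b *\<^sub>R G 0 + vint \<rho>' G))) \<longlonglongrightarrow> 0"
    proof (rule LIMSEQ_I)
      fix e :: real assume e: "0 < e"
      \<comment> \<open>\<open>d\<close> makes the terms with the total masses at most
        \<open>e / 8\<close>, and \<open>d'\<close> below does the same for the tails. The two
        Bernstein errors and the middle difference are then each at most
        \<open>e / 4\<close>.\<close>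
      define d where "d = e / (8 * (M + measure \<rho>' UNIV + 1))"
      have MM: "0 < M + measure \<rho>' UNIV + 1" using M(1) by (simp add: add_pos_nonneg)
      have d: "0 < d" using e MM by (simp add: d_def)
      have dM: "d * M \<le> e / 8" "d * measure \<rho>' UNIV \<le> e / 8"
        using e MM M(1) by (auto simp: d_def divide_simps intro!: mult_left_mono)
      define \<kappa> where "\<kappa> = (1 - exp (-1 :: real))"
      have \<kappa>: "0 < \<kappa>" by (simp add: \<kappa>_def)
      define d' where "d' = e * \<kappa> / (8 * (K + 1))"
      have d': "0 < d'" using e \<kappa> K(1) by (simp add: d'_def)
      have Kd': "K * (d' / \<kappa>) \<le> e / 8" 
      proof -
        have "d' / \<kappa> = e / (8 * (K + 1))" using \<kappa> by (simp add: d'_def)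
        moreover have "K * (e / (8 * (K + 1))) \<le> e / 8" using e K(1) by (simp add: divide_simps)
        ultimately show ?thesis by simp
      qed
      have "(\<lambda>j. laplace \<rho>' 0 - laplace \<rho>' (1 / real (Suc j))) \<longlonglongrightarrow> laplace \<rho>' 0 - laplace \<rho>' 0"
        by (intro tendsto_intros laplace_tendsto_0 \<rho>')
      then have "eventually (\<lambda>j. laplace \<rho>' 0 - laplace \<rho>' (1 / real (Suc j)) < d') sequentially"
        using d' by (intro order_tendstoD(2)[where y = 0]) auto
      then obtain j where j: "laplace \<rho>' 0 - laplace \<rho>' (1 / real (Suc j)) < d'"
        by (auto simp: eventually_sequentially)
      define R where "R = real (Suc j)"
      have R: "0 < R" by (simp add: R_def)
      have tail': "measure \<rho>' {R<..} \<le> d' / \<kappa>"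
      proof -
        have "\<kappa> * measure \<rho>' {R<..} \<le> d'"
          using laplace_tail[OF \<rho>' R] j[folded R_def] unfolding \<kappa>_def by linarith
        then show ?thesis using \<kappa> by (simp add: pos_le_divide_eq mult.commute)
      qed
      \<comment> \<open>The mass \<open>b\<close> cancels in this difference, so the
        \<open>R\<close> chosen for \<open>\<rho>'\<close> also controls the tails of almost all
        \<open>\<rho> n\<close>.\<close>
      have "(\<lambda>n. laplace (\<rho> n) 0 - laplace (\<rho> n) (1 / R)) \<longlonglongrightarrow> (b + laplace \<rho>' 0) - (b + laplace \<rho>' (1 / R))"
        using R by (intro tendsto_diff lim) auto
      then have "eventually (\<lambda>n. laplace (\<rho> n) 0 - laplace (\<rho> n) (1 / R) < d') sequentially"
        using j by (intro order_tendstoD(2)) (auto simp: R_def)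
      then have tail: "eventually (\<lambda>n. measure (\<rho> n) {R<..} \<le> d' / \<kappa>) sequentially"
      proof eventually_elim
        case (elim n)
        then have "\<kappa> * measure (\<rho> n) {R<..} \<le> d'"
          using laplace_tail[OF \<rho>[of n] R] unfolding \<kappa>_def by linarith
        then show ?case using \<kappa> by (simp add: pos_le_divide_eq mult.commute)
      qed
      obtain N where N: "\<And>n \<rho>. N \<le> n \<Longrightarrow> half_line_measure \<rho> \<Longrightarrow>
          p (vint \<rho> G - approx_integral \<rho> G n) \<le> d * measure \<rho> UNIV + K * measure \<rho> {R<..}"
        using K(2)[OF d, of R] by blast
      \<comment> \<open>The degree must be positive: then the last node \<open>m / m = 1\<close>
        corresponds to \<open>s = 0\<close>, where the mass \<open>b\<close> sits.\<close>
      define m where "m = Suc N"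
      have err': "p (vint \<rho>' G - approx_integral \<rho>' G m) \<le> e / 4"
        using N[OF _ \<rho>', of m] dM(2) mult_left_mono[OF tail' K(1)] Kd' unfolding m_def by linarith
      have err: "eventually (\<lambda>n. p (vint (\<rho> n) G - approx_integral (\<rho> n) G m) \<le> e / 4) sequentially"
        using tail
      proof eventually_elim
        case (elim n)
        have "d * measure (\<rho> n) UNIV \<le> d * M" using M d by (intro mult_left_mono) auto
        then show ?case
          using N[OF _ \<rho>[of n], of m] dM(1) mult_left_mono[OF elim K(1)] Kd' unfolding m_def by linarith
      qed
      have "sconv (\<lambda>n. approx_integral (\<rho> n) G m) (b *\<^sub>R G 0 + approx_integral \<rho>' G m)"
      proof (rule sconv_tendsto)
        have "(\<lambda>n. approx_integral (\<rho> n) G m) \<longlonglongrightarrow>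
            (\<Sum>k\<le>m. ((if k = m then b else 0) + (LINT s:{0..}|\<rho>'. weight m k s)) *\<^sub>R node G (k / m))"
          unfolding approx_integral_def
          by (intro tendsto_intros weight_integral_tendsto \<rho> \<rho>' lim) auto
        also have "(\<Sum>k\<le>m. ((if k = m then b else 0) + (LINT s:{0..}|\<rho>'. weight m k s)) *\<^sub>R node G (k / m))
            = (\<Sum>k\<le>m. if k = m then b *\<^sub>R node G (k / m) else 0) + approx_integral \<rho>' G m"
          unfolding approx_integral_def sum.distrib[symmetric] by (intro sum.cong) (auto simp: scaleR_add_left)
        also have "(\<Sum>k\<le>m. if k = m then b *\<^sub>R node G (k / m) else 0) = b *\<^sub>R G 0"
          by (simp add: m_def node_def)
        finally show "(\<lambda>n. approx_integral (\<rho> n) G m) \<longlonglongrightarrow> b *\<^sub>R G 0 + approx_integral \<rho>' G m" .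
      qed
      then have "(\<lambda>n. p (approx_integral (\<rho> n) G m - (b *\<^sub>R G 0 + approx_integral \<rho>' G m))) \<longlonglongrightarrow> 0"
        using p by (simp add: seq_conv_def)
      then have mid: "eventually (\<lambda>n. p (approx_integral (\<rho> n) G m - (b *\<^sub>R G 0 + approx_integral \<rho>' G m)) < e / 4) sequentially"
        using e by (intro order_tendstoD(2)) auto
      have "eventually (\<lambda>n. p (vint (\<rho> n) G - (b *\<^sub>R G 0 + vint \<rho>' G)) < e) sequentially"
        using err mid
      proof eventually_elim
        case (elim n)
        have "p (vint (\<rho> n) G - (b *\<^sub>R G 0 + vint \<rho>' G))
            \<le> p (vint (\<rho> n) G - approx_integral (\<rho> n) G m)
              + (p (approx_integral (\<rho> n) G m - (b *\<^sub>R G 0 + approx_integral \<rho>' G m))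
              + p ((b *\<^sub>R G 0 + approx_integral \<rho>' G m) - (b *\<^sub>R G 0 + vint \<rho>' G)))"
          using seminorm_triangle_diff[OF sn] by (meson add_left_mono order_trans)
        also have "p ((b *\<^sub>R G 0 + approx_integral \<rho>' G m) - (b *\<^sub>R G 0 + vint \<rho>' G))
            = p (vint \<rho>' G - approx_integral \<rho>' G m)"
          by (simp add: seminorm_diff_commute[OF sn])
        finally show ?case using elim err' e by linarith
      qed
      then show "\<exists>n0. \<forall>n\<ge>n0. norm (p (vint (\<rho> n) G - (b *\<^sub>R G 0 + vint \<rho>' G)) - 0) < e"
        by (auto simp: eventually_sequentially seminorm_nonneg[OF sn])
    qed
  qed
qed

end

section \<open>Semigroups and their generators\<close>

text \<open>Lebesgue measure on \<open>{0..h}\<close>, kept as a measure on the line so that time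
  averages are orbit integrals of the same kind as \<open>S t x\<close>.\<close>

definition segment_measure :: "real \<Rightarrow> real measure" where
  "segment_measure h = density lborel (\<lambda>s. ennreal (indicator {0..h} s))"

lemma segment_measure_emeasure:
  "A \<in> sets borel \<Longrightarrow> emeasure (segment_measure h) A = emeasure lborel ({0..h} \<inter> A)"
  by (simp add: segment_measure_def emeasure_density ennreal_indicator nn_integral_indicator
      flip: indicator_inter_arith)

lemma half_line_segment: "half_line_measure (segment_measure h)"
  unfolding half_line_measure_def
proof (intro conjI)
  show "finite_measure (segment_measure h)"
  proof (rule finite_measureI)
    have "emeasure (segment_measure h) UNIV = emeasure lborel {0..h}"
      by (simp add: segment_measure_emeasure)
    also have "\<dots> \<noteq> \<infinity>" by (simp add: emeasure_lborel_Icc_eq)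
    finally show "emeasure (segment_measure h) (space (segment_measure h)) \<noteq> \<infinity>"
      by (simp add: segment_measure_def)
  qed
  have "{0..h} \<inter> - {0..} = {}" by auto
  then show "emeasure (segment_measure h) (- {0..}) = 0"
    by (simp add: segment_measure_emeasure)
qed (simp add: segment_measure_def)

lemma measure_segment: "0 \<le> h \<Longrightarrow> measure (segment_measure h) UNIV = h"
  by (simp add: measure_def segment_measure_emeasure)

lemma measure_segment_tail: "measure (segment_measure h) {h<..} = 0"
proof -
  have "{0..h} \<inter> {h<..} = {}" by auto
  then show ?thesis by (simp add: measure_def segment_measure_emeasure)
qed

lemma segment_lint:
  fixes F :: "real \<Rightarrow> 'e::euclidean_space"
  assumes "continuous_on {0..} F"
  shows "(LINT s:{0..}|segment_measure h. F s) = (LINT s:{0..h}|lborel. F s)"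
proof -
  have "(LINT s:{0..}|segment_measure h. F s)
      = (LINT s|lborel. indicator {0..h} s *\<^sub>R (indicator {0..} s *\<^sub>R F s))"
    unfolding set_lebesgue_integral_def segment_measure_def
    by (rule integral_density) (use borel_measurable_continuous_on_indicator[OF _ assms] in auto)
  also have "\<dots> = (LINT s:{0..h}|lborel. F s)"
    unfolding set_lebesgue_integral_def by (intro Bochner_Integration.integral_cong) (auto simp: indicator_def)
  finally show ?thesis .
qed

text \<open>With a primitive \<open>\<Gamma>\<close> of \<open>g\<close>, both sides equal
  \<open>\<Gamma> (t + h) - \<Gamma> t - \<Gamma> h + \<Gamma> 0\<close>, which is symmetric in
  \<open>t\<close> and \<open>h\<close>.\<close>

lemma lint_shift_swap:
  fixes g :: "real \<Rightarrow> 'e::euclidean_space"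
  assumes g: "continuous_on {0..} g" and "0 \<le> t" "0 \<le> h"
  shows "(LINT r:{0..h}|lborel. g (t + r)) - (LINT r:{0..h}|lborel. g r)
    = (LINT r:{0..t}|lborel. g (h + r)) - (LINT r:{0..t}|lborel. g r)"
proof -
  have "continuous_on {0..t + h} g" by (rule continuous_on_subset[OF g]) auto
  then obtain \<Gamma> where \<Gamma>: "\<And>s. s \<in> {0..t + h} \<Longrightarrow> (\<Gamma> has_vector_derivative g s) (at s within {0..t + h})"
    using antiderivative_continuous by blast
  have int: "(LINT r:{0..b}|lborel. g (a + r)) = \<Gamma> (a + b) - \<Gamma> a"
    if ab: "0 \<le> a" "0 \<le> b" "a + b \<le> t + h" for a b
  proof -
    have "(\<integral>r. indicator {0..b} r *\<^sub>R g (a + r) \<partial>lborel) = \<Gamma> (a + b) - \<Gamma> (a + 0)"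
    proof (rule integral_FTC_Icc[OF ab(2)])
      fix r assume r: "0 \<le> r" "r \<le> b"
      have "(\<Gamma> has_vector_derivative g (a + r)) (at (a + r) within (\<lambda>r. a + r) ` {0..b})"
        by (rule has_vector_derivative_within_subset[OF \<Gamma>]) (use ab r in auto)
      moreover have "((\<lambda>r. a + r) has_vector_derivative 1) (at r within {0..b})"
        by (auto intro!: derivative_eq_intros)
      ultimately show "((\<lambda>r. \<Gamma> (a + r)) has_vector_derivative g (a + r)) (at r within {0..b})"
        using vector_diff_chain_within by (fastforce simp: o_def)
    next
      show "continuous_on {0..b} (\<lambda>r. g (a + r))"
        by (rule continuous_on_compose2[OF g]) (use ab in \<open>auto intro!: continuous_intros\<close>)
    qed
    then show ?thesis by (simp add: set_lebesgue_integral_def)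
  qed
  show ?thesis
    using int[of t h] int[of 0 h] int[of h t] int[of 0 t] assms by (simp add: add.commute)
qed

section \<open>Convolution of measures on the half line\<close>

context
  fixes \<rho> \<sigma> :: "real measure"
  assumes \<rho>: "half_line_measure \<rho>" and \<sigma>: "half_line_measure \<sigma>"
begin

lemma half_line_convolution: "half_line_measure (\<rho> \<star> \<sigma>)"
proof -
  have fin: "finite_measure \<rho>" "finite_measure \<sigma>" and s: "sets \<rho> = sets borel" "sets \<sigma> = sets borel"
    using \<rho> \<sigma> by (auto simp: half_line_measure_def)
  have "emeasure (\<rho> \<star> \<sigma>) (- {0..}) = (\<integral>\<^sup>+x. \<integral>\<^sup>+y. indicator (- {0..}) (x + y) \<partial>\<sigma> \<partial>\<rho>)"
    by (rule convolution_emeasure') (use fin s in auto)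
  also have "\<dots> = (\<integral>\<^sup>+x. 0 \<partial>\<rho>)"
  proof (rule nn_integral_cong_AE)
    show "AE x in \<rho>. (\<integral>\<^sup>+y. indicator (- {0..}) (x + y) \<partial>\<sigma>) = 0"
      using half_line_AE[OF \<rho>]
    proof eventually_elim
      case (elim x)
      have "(\<integral>\<^sup>+y. indicator (- {0..}) (x + y) \<partial>\<sigma>) = (\<integral>\<^sup>+y. 0 \<partial>\<sigma>)"
        by (rule nn_integral_cong_AE) (use half_line_AE[OF \<sigma>] elim in \<open>auto elim!: eventually_mono\<close>)
      then show ?case by simp
    qed
  qed
  finally show ?thesis
    using convolution_finite[OF fin s(2,1)] by (simp add: half_line_measure_def)
qed

text \<open>Fubini. As \<open>g\<close> is controlled only on the half line, its extension by zero
  \<open>g'\<close> is integrated over the plane. The inner integrals are compared for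
  \<open>u \<ge> 0\<close> only, and the indicator settles measurability for the other
  \<open>u\<close>.\<close>

lemma lint_convolution:
  fixes g :: "real \<Rightarrow> 'e::euclidean_space"
  assumes g: "continuous_on {0..} g" "\<And>s. 0 \<le> s \<Longrightarrow> norm (g s) \<le> C"
  shows "(LINT w:{0..}|\<rho> \<star> \<sigma>. g w) = (LINT u:{0..}|\<rho>. LINT v:{0..}|\<sigma>. g (u + v))"
proof -
  interpret R: finite_measure \<rho> using \<rho> by (simp add: half_line_measure_def)
  interpret S: finite_measure \<sigma> using \<sigma> by (simp add: half_line_measure_def)
  interpret pair_sigma_finite \<rho> \<sigma> ..
  interpret RS: finite_measure "\<rho> \<Otimes>\<^sub>M \<sigma>" by (intro finite_measure_pair_measure) unfold_locales
  have sets [measurable_cong]: "sets \<rho> = sets borel" "sets \<sigma> = sets borel"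
    using \<rho> \<sigma> by (auto simp: half_line_measure_def)
  have [measurable]: "fst \<in> borel_measurable (\<rho> \<Otimes>\<^sub>M \<sigma>)" "snd \<in> borel_measurable (\<rho> \<Otimes>\<^sub>M \<sigma>)"
    using measurable_fst[of \<rho> \<sigma>] measurable_snd[of \<rho> \<sigma>] measurable_cong_sets[OF refl sets(1)]
      measurable_cong_sets[OF refl sets(2)] by auto
  define g' where "g' w = indicat_real {0..} w *\<^sub>R g w" for w
  have [measurable]: "g' \<in> borel_measurable borel"
    unfolding g'_def by (rule borel_measurable_continuous_on_indicator[OF _ g(1)]) simp
  have C: "0 \<le> C" using g(2)[of 0] norm_ge_zero order_trans by blast
  have bound: "norm (g' w) \<le> C" for w using g(2)[of w] C by (simp add: g'_def indicator_def)
  have int: "integrable (\<rho> \<Otimes>\<^sub>M \<sigma>) (\<lambda>z. g' (fst z + snd z))"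
  proof (rule RS.integrable_const_bound[of _ C])
    have "(\<lambda>z. fst z + snd z) \<in> borel_measurable (\<rho> \<Otimes>\<^sub>M \<sigma>)"
      by (intro borel_measurable_add) measurable
    then show "(\<lambda>z. g' (fst z + snd z)) \<in> borel_measurable (\<rho> \<Otimes>\<^sub>M \<sigma>)"
      by (rule measurable_compose) measurable
  qed (simp add: bound)
  have "(LINT w:{0..}|\<rho> \<star> \<sigma>. g w) = (\<integral>w. g' w \<partial>(\<rho> \<star> \<sigma>))"
    by (simp add: set_lebesgue_integral_def g'_def)
  also have "\<dots> = (\<integral>z. g' (fst z + snd z) \<partial>(\<rho> \<Otimes>\<^sub>M \<sigma>))"
    unfolding convolution_def by (subst integral_distr) (auto simp: split_def)
  also have "\<dots> = (\<integral>u. \<integral>v. g' (u + v) \<partial>\<sigma> \<partial>\<rho>)"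
    using integral_fst[of "\<lambda>u v. g' (u + v)"] int by (simp add: split_def)
  also have "\<dots> = (\<integral>u. indicat_real {0..} u *\<^sub>R (LINT v:{0..}|\<sigma>. g (u + v)) \<partial>\<rho>)"
  proof (rule integral_cong_AE)
    have eq: "(\<integral>v. g' (u + v) \<partial>\<sigma>) = indicat_real {0..} u *\<^sub>R (LINT v:{0..}|\<sigma>. g (u + v))" if "0 \<le> u" for u
    proof -
      have "AE v in \<sigma>. g' (u + v) = indicat_real {0..} v *\<^sub>R g (u + v)"
        using half_line_AE[OF \<sigma>] by eventually_elim (use that in \<open>simp add: g'_def\<close>)
      moreover have "(\<lambda>v. indicat_real {0..} v *\<^sub>R g (u + v)) \<in> borel_measurable borel"
        using that by (intro borel_measurable_continuous_on_indicator continuous_on_compose2[OF g(1)])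
          (auto intro!: continuous_intros)
      ultimately have "(\<integral>v. g' (u + v) \<partial>\<sigma>) = (\<integral>v. indicat_real {0..} v *\<^sub>R g (u + v) \<partial>\<sigma>)"
        by (intro integral_cong_AE) (auto simp: measurable_cong_sets[OF sets(2) refl])
      then show ?thesis using that by (simp add: set_lebesgue_integral_def)
    qed
    show "AE u in \<rho>. (\<integral>v. g' (u + v) \<partial>\<sigma>) = indicat_real {0..} u *\<^sub>R (LINT v:{0..}|\<sigma>. g (u + v))"
      using half_line_AE[OF \<rho>] by eventually_elim (rule eq)
    have m: "(\<lambda>u. \<integral>v. g' (u + v) \<partial>\<sigma>) \<in> borel_measurable \<rho>"
      using borel_measurable_integrable[OF int]
      by (intro S.borel_measurable_lebesgue_integral) (simp add: split_def)
    then show "(\<lambda>u. \<integral>v. g' (u + v) \<partial>\<sigma>) \<in> borel_measurable \<rho>" .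
    have "(\<lambda>u. indicat_real {0..} u *\<^sub>R (\<integral>v. g' (u + v) \<partial>\<sigma>)) \<in> borel_measurable \<rho>"
      by (intro borel_measurable_scaleR m) (simp add: measurable_cong_sets[OF sets(1) refl])
    moreover have "indicat_real {0..} u *\<^sub>R (\<integral>v. g' (u + v) \<partial>\<sigma>) = indicat_real {0..} u *\<^sub>R (LINT v:{0..}|\<sigma>. g (u + v))" for u
      using eq[of u] by (auto simp: indicator_def)
    ultimately show "(\<lambda>u. indicat_real {0..} u *\<^sub>R (LINT v:{0..}|\<sigma>. g (u + v))) \<in> borel_measurable \<rho>"
      by simp
  qed
  finally show ?thesis by (simp add: set_lebesgue_integral_def)
qed

end

text \<open>\<open>T_equi\<close> expresses uniformity over bounded times by arbitrary selections
  \<open>r n\<close> of times, so that every axiom speaks of sequences. The locale is instantiated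
  twice, by \<open>T\<close> and by its subordinated semigroup.\<close>

locale saks_semigroup = saks_space smul P
  for smul :: "'k::{real_normed_field,euclidean_space} \<Rightarrow> 'a::banach \<Rightarrow> 'a" and P +
  fixes T :: "real \<Rightarrow> 'a \<Rightarrow> 'a" and M :: real
  assumes T_linear: "0 \<le> t \<Longrightarrow> Vector_Spaces.linear smul smul (T t)"
    and T_0: "T 0 x = x"
    and T_plus: "0 \<le> u \<Longrightarrow> 0 \<le> t \<Longrightarrow> T (u + t) x = T u (T t x)"
    and M_nonneg: "0 \<le> M"
    and T_bound: "0 \<le> t \<Longrightarrow> norm (T t x) \<le> M * norm x"
    and T_cont: "(\<And>n. 0 < r n) \<Longrightarrow> r \<longlonglongrightarrow> 0 \<Longrightarrow> sconv (\<lambda>n. T (r n) x) x"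
    and T_equi: "sconv s x \<Longrightarrow> (\<And>n. 0 \<le> r n) \<Longrightarrow> (\<And>n. r n \<le> R) \<Longrightarrow> sconv (\<lambda>n. T (r n) (s n - x)) 0"
begin

lemma T_smul: "0 \<le> t \<Longrightarrow> T t (smul c x) = smul c (T t x)"
  using T_linear by (auto simp: Vector_Spaces.linear_iff)

lemma T_add: "0 \<le> t \<Longrightarrow> T t (x + y) = T t x + T t y"
  using T_linear by (auto simp: Vector_Spaces.linear_iff)

lemma T_scaleR: "0 \<le> t \<Longrightarrow> T t (c *\<^sub>R x) = c *\<^sub>R T t x"
  using T_smul[of t "of_real c" x] by (simp add: smul_of_real)

lemma T_diff: "0 \<le> t \<Longrightarrow> T t (x - y) = T t x - T t y"
  using T_add[of t x "(-1) *\<^sub>R y"] T_scaleR[of t "-1" y] by simp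

lemma T_equi_0: "sconv w 0 \<Longrightarrow> (\<And>n. 0 \<le> r n) \<Longrightarrow> (\<And>n. r n \<le> R) \<Longrightarrow> sconv (\<lambda>n. T (r n) (w n)) 0"
  using T_equi[of w 0 r R] by simp

lemma T_sconv:
  assumes "sconv s l" "0 \<le> t"
  shows "sconv (\<lambda>n. T t (s n)) (T t l)"
  using sconv_add[OF T_equi[OF assms(1), of "\<lambda>_. t" t] sconv_const[of "T t l"]] assms(2)
  by (simp add: T_diff)

lemma \<Phi>_T: "\<phi> \<in> \<Phi> \<Longrightarrow> 0 \<le> t \<Longrightarrow> (\<lambda>x. \<phi> (T t x)) \<in> \<Phi>"
  unfolding seq_dual_def
proof (intro CollectI conjI allI impI; elim CollectE conjE)
  fix s l
  assume "0 \<le> t" "\<forall>s l. sconv s l \<longrightarrow> (\<lambda>n. \<phi> (s n)) \<longlonglongrightarrow> \<phi> l" "sconv s l"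
  then show "(\<lambda>n. \<phi> (T t (s n))) \<longlonglongrightarrow> \<phi> (T t l)" using T_sconv by blast
qed (simp add: Vector_Spaces.linear_iff T_add T_smul)

lemma T_commute: "0 \<le> s \<Longrightarrow> 0 \<le> t \<Longrightarrow> T s (T t x) = T t (T s x)"
  by (metis T_plus add.commute)

text \<open>Comparison sequences are filled with dummy terms at indices where the quantity of
  interest is 0; the first alternative absorbs these.\<close>

lemma sconv_0_dominated:
  assumes z: "sconv z 0" and w: "\<And>n. w n = 0 \<or> w n = z n \<or> w n = - z n"
  shows "sconv w 0"
proof -
  obtain C where C: "0 \<le> C" "\<And>n. norm (z n) \<le> C" using sconv_boundedE[OF z] by metis
  show ?thesis
  proof (rule sconvI)
    show "norm (w n) \<le> C" for n using w[of n] C by (metis norm_minus_cancel norm_zero)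
    fix p assume p: "p \<in> P"
    note sn = P_seminorm[OF p]
    have "(\<lambda>n. p (z n)) \<longlonglongrightarrow> 0" using z p by (simp add: seq_conv_def)
    then show "(\<lambda>n. p (w n - 0)) \<longlonglongrightarrow> 0"
    proof (rule tendsto_0_sandwich)
      show "p (w n - 0) \<le> p (z n)" for n
        using w[of n] seminorm_nonneg[OF sn, of "z n"] seminorm_uminus[OF sn, of "z n"] seminorm_zero[OF sn]
        by auto
    qed (rule seminorm_nonneg[OF sn])
  qed
qed

text \<open>Up to sign, \<open>T u x - T s x\<close> is
  \<open>T (min u s) (T \<bar>u - s\<bar> x - x)\<close>. Local equicontinuity handles the varying
  outer time, which occurs when \<open>s\<close> is approached from the left.\<close>

lemma orbit_bcont: "bcont (\<lambda>s. T s x)"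
  unfolding bcont_def
proof (intro conjI allI impI)
  show "\<exists>C. \<forall>s\<ge>0. norm (T s x) \<le> C" using T_bound by blast
  fix r :: "nat \<Rightarrow> real" and s assume "(\<forall>n. 0 \<le> r n) \<and> r \<longlonglongrightarrow> s"
  then have r: "\<And>n. 0 \<le> r n" "r \<longlonglongrightarrow> s" by auto
  have s: "0 \<le> s" using LIMSEQ_le_const[OF r(2), of 0] r(1) by auto
  \<comment> \<open>Continuity at 0 is available along positive times; where \<open>r n = s\<close>
    a dummy time is inserted, and the difference of orbit values is 0 there.\<close>
  define h where "h n = (if r n = s then inverse (real (Suc n)) else \<bar>r n - s\<bar>)" for n
  have h: "0 < h n" for n by (simp add: h_def)
  have "(\<lambda>n. \<bar>r n - s\<bar> + inverse (real (Suc n))) \<longlonglongrightarrow> 0"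
    using tendsto_add[OF tendsto_rabs_zero[OF LIM_zero[OF r(2)]] LIMSEQ_inverse_real_of_nat] by simp
  then have "h \<longlonglongrightarrow> 0"
    by (rule tendsto_0_sandwich) (auto simp: h_def)
  then have "sconv (\<lambda>n. T (h n) x - x) 0"
    using sconv_diff[OF T_cont[of h x, OF h] sconv_const[of x]] by simp
  then have "sconv (\<lambda>n. T (min (r n) s) (T (h n) x - x)) 0"
    using r(1) s by (intro T_equi_0[where R = s]) auto
  then have "sconv (\<lambda>n. T (r n) x - T s x) 0"
  proof (rule sconv_0_dominated)
    fix n
    show "T (r n) x - T s x = 0 \<or> T (r n) x - T s x = T (min (r n) s) (T (h n) x - x)
      \<or> T (r n) x - T s x = - T (min (r n) s) (T (h n) x - x)"
    proof (cases "r n" s rule: linorder_cases)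
      case less
      then show ?thesis using r(1)[of n] T_plus[of "r n" "s - r n" x] by (simp add: h_def T_diff)
    next
      case greater
      then show ?thesis using s T_plus[of s "r n - s" x] by (simp add: h_def T_diff)
    qed simp
  qed
  from sconv_add[OF this sconv_const[of "T s x"]] show "sconv (\<lambda>n. T (r n) x) (T s x)" by simp
qed

text \<open>Selecting a violating time for each \<open>n\<close>, whenever there is one, turns
  convergence along all selections into uniform smallness.\<close>

lemma equi_uniform:
  assumes "\<And>r. (\<And>n. r n \<in> I) \<Longrightarrow> sconv (\<lambda>n. T (r n) (w n)) 0" and p: "p \<in> P" and e: "0 < e"
  shows "eventually (\<lambda>n. \<forall>u\<in>I. p (T u (w n)) \<le> e) sequentially"
proof (cases "I = {}")
  case False
  then obtain i where i: "i \<in> I" by blast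
  define r where "r n = (if \<exists>u\<in>I. \<not> p (T u (w n)) \<le> e then SOME u. u \<in> I \<and> \<not> p (T u (w n)) \<le> e else i)" for n
  have r: "r n \<in> I \<and> ((\<exists>u\<in>I. \<not> p (T u (w n)) \<le> e) \<longrightarrow> \<not> p (T (r n) (w n)) \<le> e)" for n
    unfolding r_def using i someI_ex[of "\<lambda>u. u \<in> I \<and> \<not> p (T u (w n)) \<le> e"] by (auto simp del: not_le)
  have "(\<lambda>n. p (T (r n) (w n) - 0)) \<longlonglongrightarrow> 0" using assms(1)[of r] r p by (simp add: seq_conv_def)
  then have "eventually (\<lambda>n. p (T (r n) (w n)) < e) sequentially"
    using e order_tendstoD(2) by fastforce
  then show ?thesis by eventually_elim (use r in force)
qed simp

section \<open>Orbit integrals as commuting, sequentially continuous operators\<close>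

definition Iop :: "real measure \<Rightarrow> 'a \<Rightarrow> 'a" where
  "Iop \<rho> x = vint \<rho> (\<lambda>s. T s x)"

lemma \<Phi>_Iop: "half_line_measure \<rho> \<Longrightarrow> \<phi> \<in> \<Phi> \<Longrightarrow> \<phi> (Iop \<rho> x) = (LINT s:{0..}|\<rho>. \<phi> (T s x))"
  unfolding Iop_def by (rule \<Phi>_vint[OF _ orbit_bcont])

lemma orbit_\<Phi>_integrable:
  "half_line_measure \<rho> \<Longrightarrow> \<phi> \<in> \<Phi> \<Longrightarrow> set_integrable \<rho> {0..} (\<lambda>s. \<phi> (T s x))"
  by (rule bcont_\<Phi>_integrable[OF _ orbit_bcont])

lemma set_lint_cong_half_line:
  "(\<And>s. 0 \<le> s \<Longrightarrow> F s = F' s) \<Longrightarrow> (LINT s:{0..}|\<rho>. F s) = (LINT s:{0..}|\<rho>. F' s)"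
  for F F' :: "real \<Rightarrow> 'k"
  unfolding set_lebesgue_integral_def by (intro Bochner_Integration.integral_cong) (auto simp: indicator_def)

lemma Iop_add: "half_line_measure \<rho> \<Longrightarrow> Iop \<rho> (x + y) = Iop \<rho> x + Iop \<rho> y"
proof (rule eq_by_\<Phi>)
  fix \<phi> assume *: "half_line_measure \<rho>" "\<phi> \<in> \<Phi>"
  have "(LINT s:{0..}|\<rho>. \<phi> (T s (x + y))) = (LINT s:{0..}|\<rho>. \<phi> (T s x) + \<phi> (T s y))"
    by (rule set_lint_cong_half_line) (simp add: T_add \<Phi>_add *)
  then show "\<phi> (Iop \<rho> (x + y)) = \<phi> (Iop \<rho> x + Iop \<rho> y)"
    using * by (simp add: \<Phi>_Iop \<Phi>_add orbit_\<Phi>_integrable)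
qed

lemma Iop_smul: "half_line_measure \<rho> \<Longrightarrow> Iop \<rho> (smul c x) = smul c (Iop \<rho> x)"
proof (rule eq_by_\<Phi>)
  fix \<phi> assume *: "half_line_measure \<rho>" "\<phi> \<in> \<Phi>"
  have "(LINT s:{0..}|\<rho>. \<phi> (T s (smul c x))) = (LINT s:{0..}|\<rho>. c * \<phi> (T s x))"
    by (rule set_lint_cong_half_line) (simp add: T_smul \<Phi>_smul *)
  then show "\<phi> (Iop \<rho> (smul c x)) = \<phi> (smul c (Iop \<rho> x))"
    using * by (simp add: \<Phi>_Iop \<Phi>_smul)
qed

lemma Iop_scaleR: "half_line_measure \<rho> \<Longrightarrow> Iop \<rho> (r *\<^sub>R x) = r *\<^sub>R Iop \<rho> x"
  using Iop_smul[of \<rho> "of_real r" x] by (simp add: smul_of_real)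

lemma Iop_diff: "half_line_measure \<rho> \<Longrightarrow> Iop \<rho> (x - y) = Iop \<rho> x - Iop \<rho> y"
  using Iop_add[of \<rho> x "(-1) *\<^sub>R y"] Iop_scaleR[of \<rho> "-1" y] by simp

lemma Iop_bound: "half_line_measure \<rho> \<Longrightarrow> norm (Iop \<rho> x) \<le> M * norm x * measure \<rho> UNIV"
  unfolding Iop_def by (rule norm_vint_le[OF _ orbit_bcont T_bound])

lemma Iop_T: "half_line_measure \<rho> \<Longrightarrow> 0 \<le> t \<Longrightarrow> T t (Iop \<rho> x) = Iop \<rho> (T t x)"
proof (rule eq_by_\<Phi>)
  fix \<phi> assume *: "half_line_measure \<rho>" "0 \<le> t" "\<phi> \<in> \<Phi>"
  show "\<phi> (T t (Iop \<rho> x)) = \<phi> (Iop \<rho> (T t x))"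
    using * \<Phi>_Iop[OF *(1) \<Phi>_T[OF *(3,2)]]
    by (auto simp: \<Phi>_Iop T_commute intro: set_lint_cong_half_line)
qed

text \<open>Tested on \<open>\<phi>\<close>, this is Fubini and the semigroup law. The inner
  integral is reached by applying \<open>\<Phi>_Iop\<close> to the functional \<open>\<phi>\<close>
  composed with \<open>T u\<close>, which is where the stability of \<open>\<Phi>\<close> under
  \<open>T\<close> enters.\<close>

lemma Iop_convolution:
  assumes \<rho>: "half_line_measure \<rho>" and \<sigma>: "half_line_measure \<sigma>"
  shows "Iop \<rho> (Iop \<sigma> x) = Iop (\<rho> \<star> \<sigma>) x"
proof (rule eq_by_\<Phi>)
  fix \<phi> assume \<phi>: "\<phi> \<in> \<Phi>"
  obtain c where c: "0 < c" "\<And>x. norm (\<phi> x) \<le> c * norm x" using \<Phi>_bounded[OF \<phi>] by blast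
  have "\<phi> (Iop \<rho> (Iop \<sigma> x)) = (LINT u:{0..}|\<rho>. \<phi> (T u (Iop \<sigma> x)))" by (rule \<Phi>_Iop[OF \<rho> \<phi>])
  also have "\<dots> = (LINT u:{0..}|\<rho>. LINT v:{0..}|\<sigma>. \<phi> (T (u + v) x))"
  proof (rule set_lint_cong_half_line)
    fix u :: real assume u: "0 \<le> u"
    show "\<phi> (T u (Iop \<sigma> x)) = (LINT v:{0..}|\<sigma>. \<phi> (T (u + v) x))"
      using \<Phi>_Iop[OF \<sigma> \<Phi>_T[OF \<phi> u]] u by (auto simp: T_plus intro: set_lint_cong_half_line)
  qed
  also have "\<dots> = (LINT w:{0..}|\<rho> \<star> \<sigma>. \<phi> (T w x))"
  proof (rule lint_convolution[OF \<rho> \<sigma> bcont_\<Phi>_continuous[OF orbit_bcont \<phi>], symmetric])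
    fix s :: real assume "0 \<le> s"
    then have "c * norm (T s x) \<le> c * (M * norm x)" using T_bound c(1) by simp
    then show "norm (\<phi> (T s x)) \<le> c * (M * norm x)" using c(2)[of "T s x"] by linarith
  qed
  also have "\<dots> = \<phi> (Iop (\<rho> \<star> \<sigma>) x)"
    using \<Phi>_Iop[OF half_line_convolution[OF \<rho> \<sigma>] \<phi>] by simp
  finally show "\<phi> (Iop \<rho> (Iop \<sigma> x)) = \<phi> (Iop (\<rho> \<star> \<sigma>) x)" .
qed

lemma Iop_commute:
  assumes "half_line_measure \<rho>" "half_line_measure \<sigma>"
  shows "Iop \<rho> (Iop \<sigma> x) = Iop \<sigma> (Iop \<rho> x)"
  using assms convolution_commutative[of \<rho> \<sigma>] by (simp add: Iop_convolution half_line_measure_def)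

text \<open>The last hypothesis covers both cases of the theorem: with \<open>I = {..R}\<close> it is local
  equicontinuity and uniform tightness, with \<open>I = UNIV\<close> it is global equicontinuity alone.\<close>
lemma Iop_null:
  assumes \<rho>: "\<And>n. half_line_measure (\<rho> n)" and B: "\<And>n. measure (\<rho> n) UNIV \<le> B"
    and w: "sconv w 0"
    and tight: "\<And>e. 0 < e \<Longrightarrow> \<exists>I\<in>sets borel. (\<forall>n. measure (\<rho> n) (- I) \<le> e) \<and>
      (\<forall>r. (\<forall>n. 0 \<le> r n \<and> r n \<in> I) \<longrightarrow> sconv (\<lambda>n. T (r n) (w n)) 0)"
  shows "sconv (\<lambda>n. Iop (\<rho> n) (w n)) 0"
proof -
  obtain C where C: "0 \<le> C" "\<And>n. norm (w n) \<le> C" using sconv_boundedE[OF w] by metis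
  have B0: "0 \<le> B" using B[of 0] measure_nonneg order_trans by blast
  have Tw: "norm (T s (w n)) \<le> M * C" if "0 \<le> s" for s n
    using T_bound[OF that, of "w n"] mult_left_mono[OF C(2)[of n] M_nonneg] by linarith
  show ?thesis
  proof (rule sconvI)
    show "norm (Iop (\<rho> n) (w n)) \<le> M * C * B" for n
    proof -
      have "norm (Iop (\<rho> n) (w n)) \<le> M * C * measure (\<rho> n) UNIV"
        unfolding Iop_def by (rule norm_vint_le[OF \<rho> orbit_bcont Tw])
      also have "\<dots> \<le> M * C * B" using B M_nonneg C(1) by (intro mult_left_mono) auto
      finally show ?thesis .
    qed
    fix p assume p: "p \<in> P"
    note sn = P_seminorm[OF p]
    have "0 \<le> M * C" using M_nonneg C by simp
    then obtain K where K: "0 \<le> K" "\<And>x. norm x \<le> M * C \<Longrightarrow> p x \<le> K"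
      using admissible_bound[OF admissible_P[OF p]] by blast
    have pK: "p (T s (w n)) \<le> K" if "0 \<le> s" for s n by (rule K(2)[OF Tw[OF that]])
    show "(\<lambda>n. p (Iop (\<rho> n) (w n) - 0)) \<longlonglongrightarrow> 0"
    proof (rule LIMSEQ_I)
      fix e :: real assume e: "0 < e"
      define d where "d = e / (4 * (B + 1))"
      define d' where "d' = e / (4 * (K + 1))"
      have d: "0 < d" "0 < d'" using e B0 K(1) by (auto simp: d_def d'_def)
      have dB: "d * B \<le> e / 4" "K * d' \<le> e / 4" using e B0 K(1) by (auto simp: d_def d'_def divide_simps)
      obtain I where I: "I \<in> sets borel" "\<And>n. measure (\<rho> n) (- I) \<le> d'"
        "\<And>r. (\<And>n. 0 \<le> r n \<and> r n \<in> I) \<Longrightarrow> sconv (\<lambda>n. T (r n) (w n)) 0"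
        using tight[OF d(2)] by blast
      have "eventually (\<lambda>n. \<forall>u\<in>{0..} \<inter> I. p (T u (w n)) \<le> d) sequentially"
        using p d(1) I(3) by (intro equi_uniform) auto
      then have "eventually (\<lambda>n. p (Iop (\<rho> n) (w n)) < e) sequentially"
      proof eventually_elim
        case (elim n)
        have "p (Iop (\<rho> n) (w n)) \<le> (LINT s:{0..}|\<rho> n. p (T s (w n)))"
          unfolding Iop_def by (rule seminorm_vint_le[OF \<rho> orbit_bcont p])
        also have "\<dots> \<le> d * measure (\<rho> n) UNIV + K * measure (\<rho> n) (- I)"
          using elim pK d(1) K(1)
          by (intro half_line_lint_split[OF \<rho> I(1)] bcont_seminorm_integrable[OF \<rho> orbit_bcont admissible_P[OF p]]) auto
        also have "\<dots> \<le> d * B + K * d'"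
          using d K(1) by (intro add_mono mult_left_mono B I(2)) auto
        finally show ?case using dB e by linarith
      qed
      then show "\<exists>N. \<forall>n\<ge>N. norm (p (Iop (\<rho> n) (w n) - 0) - 0) < e"
        by (auto simp: eventually_sequentially seminorm_nonneg[OF sn])
    qed
  qed
qed

lemma Iop_sconv:
  assumes \<rho>: "half_line_measure \<rho>" and s: "sconv s l"
  shows "sconv (\<lambda>n. Iop \<rho> (s n)) (Iop \<rho> l)"
proof -
  have w: "sconv (\<lambda>n. s n - l) 0" using sconv_diff[OF s sconv_const[of l]] by simp
  have "sconv (\<lambda>n. Iop \<rho> (s n - l)) 0"
  proof (rule Iop_null[OF \<rho> order_refl w])
    fix e :: real assume "0 < e"
    then obtain R where "measure \<rho> {R<..} < e" using half_line_tail_small[OF \<rho>] by blast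
    then show "\<exists>I\<in>sets borel. (\<forall>n. measure \<rho> (- I) \<le> e) \<and>
      (\<forall>r. (\<forall>n. 0 \<le> r n \<and> r n \<in> I) \<longrightarrow> sconv (\<lambda>n. T (r n) (s n - l)) 0)"
      using T_equi_0[OF w] by (intro bexI[of _ "{..R}"]) auto
  qed
  from sconv_add[OF this sconv_const[of "Iop \<rho> l"]] show ?thesis by (simp add: Iop_diff[OF \<rho>])
qed

definition J :: "real \<Rightarrow> 'a \<Rightarrow> 'a" where
  "J h = Iop (segment_measure h)"

lemma \<Phi>_J: "\<phi> \<in> \<Phi> \<Longrightarrow> \<phi> (J h x) = (LINT s:{0..h}|lborel. \<phi> (T s x))"
  unfolding J_def
  by (simp add: \<Phi>_Iop half_line_segment segment_lint bcont_\<Phi>_continuous[OF orbit_bcont])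

lemma J_bound: "0 \<le> h \<Longrightarrow> norm (J h x) \<le> M * norm x * h"
  using Iop_bound[OF half_line_segment, of h x] by (simp add: J_def measure_segment)

lemma J_average_sconv:
  assumes r: "\<And>n. 0 < r n" "r \<longlonglongrightarrow> 0"
  shows "sconv (\<lambda>n. (1 / r n) *\<^sub>R J (r n) x) x"
proof (rule sconvI)
  show "norm ((1 / r n) *\<^sub>R J (r n) x) \<le> M * norm x" for n
    using J_bound[of "r n" x] r(1)[of n] by (simp add: divide_le_eq)
  fix p assume p: "p \<in> P"
  note sn = P_seminorm[OF p]
  have Tx: "bcont (\<lambda>s. T s x - x)" by (rule bcont_diff_const[OF orbit_bcont])
  obtain C where C: "0 \<le> C" "\<And>s. 0 \<le> s \<Longrightarrow> p (T s x - x) \<le> C"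
    using bcont_seminorm_boundE[OF Tx admissible_P[OF p]] by blast
  show "(\<lambda>n. p ((1 / r n) *\<^sub>R J (r n) x - x)) \<longlonglongrightarrow> 0"
  proof (rule LIMSEQ_I)
    fix e :: real assume e: "0 < e"
    have "continuous_on {0..} (\<lambda>s. p (T s x - x))"
      by (rule bcont_seminorm_continuous[OF Tx admissible_P[OF p]])
    then obtain d where d: "0 < d" "\<And>s. 0 \<le> s \<Longrightarrow> \<bar>s\<bar> < d \<Longrightarrow> p (T s x - x) < e / 2"
    proof -
      assume "continuous_on {0..} (\<lambda>s. p (T s x - x))"
      then have "\<exists>d>0. \<forall>s\<in>{0..}. dist s 0 < d \<longrightarrow> dist (p (T s x - x)) (p (T 0 x - x)) < e / 2"
        using e unfolding continuous_on_iff by (meson atLeast_iff half_gt_zero order_refl)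
      then show ?thesis using that by (auto simp: T_0 seminorm_zero[OF sn] seminorm_nonneg[OF sn])
    qed
    have "eventually (\<lambda>n. r n < d) sequentially" using order_tendstoD(2)[OF r(2) d(1)] .
    then have "eventually (\<lambda>n. p ((1 / r n) *\<^sub>R J (r n) x - x) < e) sequentially"
    proof eventually_elim
      case (elim n)
      let ?m = "segment_measure (r n)"
      have r0: "0 < r n" by (rule r)
      have "J (r n) x - r n *\<^sub>R x = vint ?m (\<lambda>s. T s x - x)"
        using vint_diff_const[OF half_line_segment orbit_bcont, of "r n" x x] r0
        by (simp add: J_def Iop_def measure_segment)
      moreover have "p (vint ?m (\<lambda>s. T s x - x)) \<le> (LINT s:{0..}|?m. p (T s x - x))"
        by (rule seminorm_vint_le[OF half_line_segment Tx p])
      moreover have "\<dots> \<le> e / 2 * measure ?m UNIV + C * measure ?m {r n<..}"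
      proof (rule half_line_lint_tail[OF half_line_segment bcont_seminorm_integrable[OF half_line_segment Tx admissible_P[OF p]]])
        fix s :: real assume "0 \<le> s" "s \<le> r n"
        then show "p (T s x - x) \<le> e / 2" using d(2)[of s] elim by simp
      qed (use e C in auto)
      ultimately have *: "p (J (r n) x - r n *\<^sub>R x) \<le> e / 2 * r n"
        using r0 by (simp add: measure_segment measure_segment_tail)
      have "(1 / r n) *\<^sub>R J (r n) x - x = (1 / r n) *\<^sub>R (J (r n) x - r n *\<^sub>R x)"
        using r0 by (simp add: scaleR_diff_right)
      then have "p ((1 / r n) *\<^sub>R J (r n) x - x) = p (J (r n) x - r n *\<^sub>R x) / r n"
        using r0 by (simp add: seminorm_scaleR[OF sn])
      also have "\<dots> \<le> e / 2" using * r0 by (simp add: divide_le_eq)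
      finally show ?case using e by linarith
    qed
    then show "\<exists>N. \<forall>n\<ge>N. norm (p ((1 / r n) *\<^sub>R J (r n) x - x) - 0) < e"
      by (auto simp: eventually_sequentially seminorm_nonneg[OF sn])
  qed
qed

section \<open>The generator and its integrated form\<close>

definition gen :: "'a \<Rightarrow> 'a \<Rightarrow> bool" where
  "gen x y \<longleftrightarrow> (\<forall>r. (\<forall>n. 0 < r n) \<and> r \<longlonglongrightarrow> 0 \<longrightarrow> sconv (\<lambda>n. (1 / r n) *\<^sub>R (T (r n) x - x)) y)"

text \<open>The right derivative at 0 is transported to both sides of \<open>s\<close>. From the
  left the outer time \<open>X n\<close> varies with \<open>n\<close>; writing \<open>w n\<close> as
  \<open>(w n - y) + y\<close>, equicontinuity treats the first part and orbit continuity the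
  second.\<close>

lemma gen_difference_quotient:
  assumes xy: "gen x y" and s: "0 \<le> s" and X: "\<And>n. 0 \<le> X n" "\<And>n. X n \<noteq> s" "X \<longlonglongrightarrow> s"
  shows "sconv (\<lambda>n. (1 / (X n - s)) *\<^sub>R (T (X n) x - T s x)) (T s y)"
proof -
  define h where "h n = \<bar>X n - s\<bar>" for n
  define w where "w n = (1 / h n) *\<^sub>R (T (h n) x - x)" for n
  define m where "m n = min (X n) s" for n
  have m: "0 \<le> m n" "m n \<le> s" for n using X(1) s by (auto simp: m_def)
  have hpos: "0 < h n" for n using X(2) by (simp add: h_def)
  have h0: "h \<longlonglongrightarrow> 0" unfolding h_def[abs_def] by (intro tendsto_rabs_zero LIM_zero X)
  have "sconv w y" using xy hpos h0 unfolding gen_def w_def by blast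
  then have 1: "sconv (\<lambda>n. T (m n) (w n - y)) 0" by (rule T_equi) (rule m)+
  have "m \<longlonglongrightarrow> min s s" unfolding m_def[abs_def] by (intro tendsto_min X tendsto_const)
  then have 2: "sconv (\<lambda>n. T (m n) y) (T s y)" by (intro bcont_sconv[OF orbit_bcont]) (use m in auto)
  have eq: "(1 / (X n - s)) *\<^sub>R (T (X n) x - T s x) = T (m n) (w n - y) + T (m n) y" for n
  proof (cases "X n < s")
    case True
    then have "T s x = T (m n) (T (h n) x)"
      using T_plus[of "X n" "s - X n" x] X(1)[of n] by (simp add: m_def h_def)
    moreover have "(1 / (X n - s)) *\<^sub>R (T (X n) x - T s x) = (1 / h n) *\<^sub>R (T s x - T (X n) x)"
    proof -
      have "X n - s = - h n" using True by (simp add: h_def)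
      then have "1 / (X n - s) = - (1 / h n)" by (simp only: divide_minus_right)
      then show ?thesis by (simp add: scaleR_diff_right)
    qed
    ultimately show ?thesis using True m(1)[of n] by (simp add: m_def w_def T_diff T_scaleR)
  next
    case False
    then have "T (X n) x = T (m n) (T (h n) x)" using T_plus[of s "X n - s" x] s by (simp add: m_def h_def)
    moreover have "m n = s" "h n = X n - s" using False by (auto simp: m_def h_def)
    ultimately show ?thesis using s by (simp add: w_def T_diff T_scaleR)
  qed
  show ?thesis unfolding eq using sconv_add[OF 1 2] by simp
qed

text \<open>The fundamental theorem of calculus, applied weakly: \<open>\<phi> (T s x)\<close> has
  derivative \<open>\<phi> (T s y)\<close> in \<open>s\<close>, and functionals in
  \<open>\<Phi>\<close> separate points.\<close>

lemma gen_integral: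
  assumes xy: "gen x y" and t: "0 \<le> t"
  shows "T t x - x = J t y"
proof (rule eq_by_\<Phi>)
  fix \<phi> assume \<phi>: "\<phi> \<in> \<Phi>"
  have "(\<integral>s. indicator {0..t} s *\<^sub>R \<phi> (T s y) \<partial>lborel) = \<phi> (T t x) - \<phi> (T 0 x)"
  proof (rule integral_FTC_Icc[OF t])
    fix s assume s: "0 \<le> s" "s \<le> t"
    show "((\<lambda>s. \<phi> (T s x)) has_vector_derivative \<phi> (T s y)) (at s within {0..t})"
      unfolding has_vector_derivative_def has_derivative_iff_norm tendsto_at_iff_sequentially
    proof (intro conjI allI impI)
      fix X :: "nat \<Rightarrow> real" assume X: "\<forall>i. X i \<in> {0..t} - {s}" "X \<longlonglongrightarrow> s"
      have "sconv (\<lambda>n. (1 / (X n - s)) *\<^sub>R (T (X n) x - T s x)) (T s y)"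
        using X by (intro gen_difference_quotient[OF xy s(1)]) auto
      then have "(\<lambda>n. \<phi> ((1 / (X n - s)) *\<^sub>R (T (X n) x - T s x)) - \<phi> (T s y)) \<longlonglongrightarrow> 0"
        by (intro LIM_zero \<Phi>_conv[OF \<phi>])
      then have *: "(\<lambda>n. norm (\<phi> ((1 / (X n - s)) *\<^sub>R (T (X n) x - T s x)) - \<phi> (T s y))) \<longlonglongrightarrow> 0"
        by (rule tendsto_norm_zero)
      have "norm (\<phi> (T (X n) x) - \<phi> (T s x) - (X n - s) *\<^sub>R \<phi> (T s y)) / norm (X n - s)
          = norm (\<phi> ((1 / (X n - s)) *\<^sub>R (T (X n) x - T s x)) - \<phi> (T s y))" for n
      proof -
        have ne: "X n - s \<noteq> 0" using X(1) by (metis DiffD2 insertI1 right_minus_eq)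
        have "\<phi> (T (X n) x) - \<phi> (T s x) - (X n - s) *\<^sub>R \<phi> (T s y)
            = (X n - s) *\<^sub>R (\<phi> ((1 / (X n - s)) *\<^sub>R (T (X n) x - T s x)) - \<phi> (T s y))"
          using ne by (simp add: \<Phi>_scaleR[OF \<phi>] \<Phi>_diff[OF \<phi>] scaleR_diff_right)
        then show ?thesis using ne by simp
      qed
      with * show "((\<lambda>r. norm (\<phi> (T r x) - \<phi> (T s x) - (r - s) *\<^sub>R \<phi> (T s y)) / norm (r - s)) \<circ> X) \<longlonglongrightarrow> 0"
        by (simp add: o_def)
    qed (rule bounded_linear_scaleR_left)
  next
    show "continuous_on {0..t} (\<lambda>s. \<phi> (T s y))"
      by (rule continuous_on_subset[OF bcont_\<Phi>_continuous[OF orbit_bcont \<phi>]]) auto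
  qed
  then show "\<phi> (T t x - x) = \<phi> (J t y)"
    by (simp add: \<Phi>_J[OF \<phi>] \<Phi>_diff[OF \<phi>] T_0 set_lebesgue_integral_def)
qed

lemma genI_integral:
  assumes "\<And>t. 0 < t \<Longrightarrow> T t x - x = J t y"
  shows "gen x y"
  unfolding gen_def using assms J_average_sconv by simp

lemma gen_unique: "gen x y \<Longrightarrow> gen x y' \<Longrightarrow> y = y'"
  unfolding gen_def using sconv_unique LIMSEQ_inverse_real_of_nat
  by (auto dest!: spec[of _ "\<lambda>n. inverse (real (Suc n))"])

text \<open>Difference quotients involve a second limit, but the integrated equation
  \<open>T t x - x = J t y\<close> passes to limits in \<open>x\<close> and \<open>y\<close> for
  each fixed \<open>t\<close>.\<close>

lemma gen_closed:
  assumes xy: "\<And>n. gen (x n) (y n)" and x: "sconv x x'" and y: "sconv y y'"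
  shows "gen x' y'"
proof (rule genI_integral)
  fix t :: real assume t: "0 < t"
  have "sconv (\<lambda>n. T t (x n) - x n) (T t x' - x')"
    using t by (intro sconv_diff T_sconv x) auto
  moreover have "sconv (\<lambda>n. J t (y n)) (J t y')"
    unfolding J_def by (rule Iop_sconv[OF half_line_segment y])
  ultimately show "T t x' - x' = J t y'"
    using gen_integral[OF xy] t sconv_unique by simp
qed

text \<open>Tested on \<open>\<phi>\<close>, this is the symmetry of \<open>lint_shift_swap\<close>
  along the orbit. It is the integrated generator equation for \<open>J h x\<close>, hence puts
  averages into the domain.\<close>

lemma T_J_swap:
  assumes t: "0 \<le> t" and h: "0 \<le> h"
  shows "T t (J h x) - J h x = J t (T h x - x)"
proof (rule eq_by_\<Phi>)
  fix \<phi> assume \<phi>: "\<phi> \<in> \<Phi>"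
  have shift: "(LINT r:{0..b}|lborel. \<phi> (T r (T a x))) = (LINT r:{0..b}|lborel. \<phi> (T (a + r) x))"
    if "0 \<le> a" for a b
    unfolding set_lebesgue_integral_def using that
    by (intro Bochner_Integration.integral_cong) (auto simp: indicator_def T_plus T_commute)
  have "\<phi> (T t (J h x) - J h x) = (LINT r:{0..h}|lborel. \<phi> (T (t + r) x)) - (LINT r:{0..h}|lborel. \<phi> (T r x))"
    using t by (simp add: \<Phi>_diff[OF \<phi>] \<Phi>_J[OF \<phi>] J_def Iop_T[OF half_line_segment] flip: shift)
       (simp add: J_def[symmetric] \<Phi>_J[OF \<phi>])
  also have "\<dots> = (LINT r:{0..t}|lborel. \<phi> (T (h + r) x)) - (LINT r:{0..t}|lborel. \<phi> (T r x))"
    by (rule lint_shift_swap[OF bcont_\<Phi>_continuous[OF orbit_bcont \<phi>] t h])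
  also have "\<dots> = \<phi> (J t (T h x) - J t x)"
    using h by (simp add: \<Phi>_diff[OF \<phi>] \<Phi>_J[OF \<phi>] flip: shift)
  finally show "\<phi> (T t (J h x) - J h x) = \<phi> (J t (T h x - x))"
    by (simp add: J_def Iop_diff[OF half_line_segment])
qed

lemma gen_average:
  assumes "0 < h"
  shows "gen ((1 / h) *\<^sub>R J h x) ((1 / h) *\<^sub>R (T h x - x))"
proof (rule genI_integral)
  fix t :: real assume "0 < t"
  then show "T t ((1 / h) *\<^sub>R J h x) - (1 / h) *\<^sub>R J h x = J t ((1 / h) *\<^sub>R (T h x - x))"
    using T_J_swap[of t h x] assms
    by (simp add: T_scaleR J_def Iop_scaleR[OF half_line_segment] flip: scaleR_diff_right)
qed

end

section \<open>Subordination\<close>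

text \<open>The measure \<open>N\<close> may be infinite: the construction is applied to the Levy
  measure with \<open>c = 1\<close> and to \<open>\<nu> t\<close> with \<open>c = 1 / t\<close>. The
  indicator removes negative times and keeps the density nonnegative.\<close>

definition damped :: "real \<Rightarrow> real measure \<Rightarrow> real measure" where
  "damped c N = density N (\<lambda>s. ennreal (indicator {0..} s * (c * (1 - exp (- s)))))"

context
  fixes c :: real and N :: "real measure"
  assumes c: "0 \<le> c" and sets_N: "sets N = sets borel"
begin

private lemma damped_weight:
  "(\<lambda>s. indicator {0..} s * (c * (1 - exp (- s)))) \<in> borel_measurable N"
  "0 \<le> indicator {0..} s * (c * (1 - exp (- s)))"
  using c by (auto simp: measurable_cong_sets[OF sets_N refl] indicator_def)

private lemma damped_measurable:
  fixes F :: "real \<Rightarrow> 'e::euclidean_space"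
  assumes "continuous_on {0..} F"
  shows "(\<lambda>s. indicat_real {0..} s *\<^sub>R F s) \<in> borel_measurable N"
  using borel_measurable_continuous_on_indicator[OF _ assms]
  by (simp add: measurable_cong_sets[OF sets_N refl])

lemma damped_lint:
  fixes F :: "real \<Rightarrow> 'e::euclidean_space"
  assumes "continuous_on {0..} F"
  shows "(LINT s:{0..}|damped c N. F s) = (LINT s:{0..}|N. (c * (1 - exp (- s))) *\<^sub>R F s)"
proof -
  have "(LINT s:{0..}|damped c N. F s)
      = (LINT s|N. (indicator {0..} s * (c * (1 - exp (- s)))) *\<^sub>R (indicator {0..} s *\<^sub>R F s))"
    unfolding set_lebesgue_integral_def damped_def
    by (rule integral_density[OF damped_measurable[OF assms] damped_weight(1)]) (simp add: damped_weight(2))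
  also have "\<dots> = (LINT s:{0..}|N. (c * (1 - exp (- s))) *\<^sub>R F s)"
    unfolding set_lebesgue_integral_def by (intro Bochner_Integration.integral_cong) (auto simp: indicator_def)
  finally show ?thesis .
qed

lemma damped_set_integrable:
  fixes F :: "real \<Rightarrow> 'e::euclidean_space"
  assumes "continuous_on {0..} F"
  shows "set_integrable (damped c N) {0..} F \<longleftrightarrow> set_integrable N {0..} (\<lambda>s. (c * (1 - exp (- s))) *\<^sub>R F s)"
proof -
  have "set_integrable (damped c N) {0..} F
      \<longleftrightarrow> integrable N (\<lambda>s. (indicator {0..} s * (c * (1 - exp (- s)))) *\<^sub>R (indicator {0..} s *\<^sub>R F s))"
    unfolding set_integrable_def damped_def
    by (rule integrable_density[OF damped_measurable[OF assms] damped_weight(1)]) (simp add: damped_weight(2))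
  also have "\<dots> \<longleftrightarrow> set_integrable N {0..} (\<lambda>s. (c * (1 - exp (- s))) *\<^sub>R F s)"
    unfolding set_integrable_def by (intro Bochner_Integration.integrable_cong) (auto simp: indicator_def)
  finally show ?thesis .
qed

lemma half_line_damped:
  assumes int: "set_integrable N {0..} (\<lambda>s. 1 - exp (- s))"
  shows "half_line_measure (damped c N)"
  unfolding half_line_measure_def
proof (intro conjI)
  have int': "integrable N (\<lambda>s. indicator {0..} s * (c * (1 - exp (- s))))"
    using integrable_mult_right[of c N "\<lambda>s. indicator {0..} s * (1 - exp (- s))"] int
    by (simp add: set_integrable_def mult.left_commute)
  show "finite_measure (damped c N)"
  proof (rule finite_measureI)
    have "emeasure (damped c N) (space N) = (\<integral>\<^sup>+s. ennreal (indicator {0..} s * (c * (1 - exp (- s)))) \<partial>N)"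
      unfolding damped_def using damped_weight(1)
      by (subst emeasure_density) (auto intro!: nn_integral_cong)
    also have "\<dots> = ennreal (\<integral>s. indicator {0..} s * (c * (1 - exp (- s))) \<partial>N)"
      by (rule nn_integral_eq_integral[OF int']) (simp add: damped_weight(2))
    finally show "emeasure (damped c N) (space (damped c N)) \<noteq> \<infinity>" by (simp add: damped_def)
  qed
  have "emeasure (damped c N) (- {0..})
      = (\<integral>\<^sup>+s. ennreal (indicator {0..} s * (c * (1 - exp (- s)))) * indicator (- {0..}) s \<partial>N)"
    unfolding damped_def using damped_weight(1) by (subst emeasure_density) (auto simp: sets_N)
  also have "\<dots> = (\<integral>\<^sup>+s. 0 \<partial>N)" by (intro nn_integral_cong) (auto simp: indicator_def)
  finally show "emeasure (damped c N) (- {0..}) = 0" by simp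
qed (simp add: damped_def sets_N)

end

lemma one_minus_exp_bounds:
  fixes s :: real
  assumes "0 \<le> s"
  shows "1 - exp (- s) \<le> min 1 s" "s \<le> (1 + s) * (1 - exp (- s))"
proof -
  show "1 - exp (- s) \<le> min 1 s" using exp_ge_add_one_self[of "- s"] by simp
  have "(1 + s) * exp (- s) \<le> exp s * exp (- s)"
    using exp_ge_add_one_self[of s] by (intro mult_right_mono) auto
  then show "s \<le> (1 + s) * (1 - exp (- s))" by (simp add: exp_minus algebra_simps)
qed

locale subordination = saks_semigroup smul P T M
  for smul :: "'k::{real_normed_field,euclidean_space} \<Rightarrow> 'a::banach \<Rightarrow> 'a" and P T M +
  fixes f :: "real \<Rightarrow> real" and a b :: real and \<mu> :: "real measure" and \<nu> :: "real \<Rightarrow> real measure"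
  assumes Levy: "Levy_triplet f a b \<mu>" and assoc: "associated_convolution_semigroup f \<nu>"
begin

lemma a_nonneg: "0 \<le> a" and b_nonneg: "0 \<le> b" and sets_\<mu>: "sets \<mu> = sets borel"
  using Levy by (auto simp: Levy_triplet_def Radon_measure_on_def)

lemma min_integrable: "set_integrable \<mu> {0<..} (\<lambda>s. min 1 s)"
  unfolding set_integrable_def
proof (rule integrableI_nonneg)
  show "(\<lambda>s. indicat_real {0<..} s *\<^sub>R min 1 s) \<in> borel_measurable \<mu>"
    by (simp add: measurable_cong_sets[OF sets_\<mu> refl])
  have "(\<integral>\<^sup>+s. ennreal (indicat_real {0<..} s *\<^sub>R min 1 s) \<partial>\<mu>) = (\<integral>\<^sup>+s\<in>{0<..}. ennreal (min 1 s) \<partial>\<mu>)"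
    by (intro nn_integral_cong) (auto simp: indicator_def)
  also have "\<dots> < \<infinity>" using Levy by (simp add: Levy_triplet_def)
  finally show "(\<integral>\<^sup>+s. ennreal (indicat_real {0<..} s *\<^sub>R min 1 s) \<partial>\<mu>) < \<infinity>" .
qed (auto simp: indicator_def)

lemma min_bounded_integrable:
  fixes F :: "real \<Rightarrow> 'e::euclidean_space"
  assumes "continuous_on {0..} F" "\<And>s. 0 < s \<Longrightarrow> norm (F s) \<le> C * min 1 s"
  shows "set_integrable \<mu> {0<..} F"
proof (rule set_integrable_bound)
  show "set_integrable \<mu> {0<..} (\<lambda>s. C * min 1 s)" using min_integrable by simp
  have "continuous_on {0<..} F" by (rule continuous_on_subset[OF assms(1)]) auto
  from borel_measurable_continuous_on_indicator[OF _ this]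
  show "set_borel_measurable \<mu> {0<..} F"
    by (simp add: set_borel_measurable_def measurable_cong_sets[OF sets_\<mu> refl])
  show "AE s in \<mu>. s \<in> {0<..} \<longrightarrow> norm (F s) \<le> norm (C * min 1 s)"
    using assms(2) by (intro always_eventually allI impI) (force intro: order_trans)
qed

lemma one_minus_exp_integrable:
  assumes "0 \<le> l"
  shows "set_integrable \<mu> {0<..} (\<lambda>s. 1 - exp (- l * s))"
proof (rule min_bounded_integrable[of _ "1 + l"])
  fix s :: real assume s: "0 < s"
  have "1 - exp (- (l * s)) \<le> min 1 (l * s)" by (rule one_minus_exp_bounds) (use assms s in simp)
  also have "\<dots> \<le> (1 + l) * min 1 s" using assms s by (auto simp: min_def algebra_simps)
  finally show "norm (1 - exp (- l * s)) \<le> (1 + l) * min 1 s" using assms s by simp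
qed (auto intro!: continuous_intros)

text \<open>The continuous extension of \<open>f\<close> to 0, whose value there is
  \<open>a\<close>; the Levy representation says nothing about \<open>f 0\<close> itself. Laplace
  transforms at 0, that is total masses, require it.\<close>

definition f0 :: "real \<Rightarrow> real" where
  "f0 l = (if l = 0 then a else f l)"

lemma f0_eq: "0 \<le> l \<Longrightarrow> f0 l = a + b * l + (LINT s:{0<..}|\<mu>. 1 - exp (- l * s))"
  using Levy by (auto simp: f0_def Levy_triplet_def)

lemma f0_ge: "0 \<le> l \<Longrightarrow> a \<le> f0 l"
proof -
  assume l: "0 \<le> l"
  have "0 \<le> (LINT s:{0<..}|\<mu>. 1 - exp (- l * s))"
    unfolding set_lebesgue_integral_def using l
    by (intro integral_nonneg_AE always_eventually allI) (auto simp: indicator_def)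
  then show ?thesis using l b_nonneg by (simp add: f0_eq)
qed

lemma f0_tendsto: "(\<lambda>n. f0 (1 / real (Suc n))) \<longlonglongrightarrow> a"
proof -
  have inv: "(\<lambda>n. 1 / real (Suc n)) \<longlonglongrightarrow> 0"
    using LIMSEQ_inverse_real_of_nat by (simp add: inverse_eq_divide)
  have "(\<lambda>n. LINT s:{0<..}|\<mu>. 1 - exp (- (1 / real (Suc n)) * s)) \<longlonglongrightarrow> (LINT s:{0<..}|\<mu>. 0)"
    unfolding set_lebesgue_integral_def
  proof (rule integral_dominated_convergence[where w = "\<lambda>s. indicator {0<..} s *\<^sub>R min 1 s"])
    show "integrable \<mu> (\<lambda>s. indicat_real {0<..} s *\<^sub>R min 1 s)"
      using min_integrable by (simp add: set_integrable_def)
    show "AE s in \<mu>. (\<lambda>n. indicat_real {0<..} s *\<^sub>R (1 - exp (- (1 / real (Suc n)) * s))) \<longlonglongrightarrow> indicat_real {0<..} s *\<^sub>R 0"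
    proof (intro always_eventually allI tendsto_scaleR tendsto_const)
      fix s
      have "(\<lambda>n. 1 - exp (- (1 / real (Suc n)) * s)) \<longlonglongrightarrow> 1 - exp (- 0 * s)"
        by (intro tendsto_intros inv)
      then show "(\<lambda>n. 1 - exp (- (1 / real (Suc n)) * s)) \<longlonglongrightarrow> 0" by simp
    qed
    show "AE s in \<mu>. norm (indicat_real {0<..} s *\<^sub>R (1 - exp (- (1 / real (Suc n)) * s))) \<le> indicat_real {0<..} s *\<^sub>R min 1 s" for n
    proof (intro always_eventually allI)
      fix s :: real
      show "norm (indicat_real {0<..} s *\<^sub>R (1 - exp (- (1 / real (Suc n)) * s))) \<le> indicat_real {0<..} s *\<^sub>R min 1 s"
      proof (cases "0 < s")
        case True
        then have le: "s / real (Suc n) \<le> s" by (simp add: divide_le_eq)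
        have "1 - exp (- (s / real (Suc n))) \<le> min 1 (s / real (Suc n))"
          by (rule one_minus_exp_bounds) (use True in simp)
        also have "\<dots> \<le> min 1 s" using le by simp
        finally show ?thesis using True by (simp add: indicator_def)
      qed simp
    qed
  qed (auto simp: measurable_cong_sets[OF sets_\<mu> refl])
  then have "(\<lambda>n. a + b * (1 / real (Suc n)) + (LINT s:{0<..}|\<mu>. 1 - exp (- (1 / real (Suc n)) * s))) \<longlonglongrightarrow> a + b * 0 + 0"
    by (intro tendsto_intros inv) simp
  then show ?thesis by (simp add: f0_eq)
qed

lemma half_line_\<nu>: "0 \<le> t \<Longrightarrow> half_line_measure (\<nu> t)"
proof -
  assume t: "0 \<le> t"
  have R: "Radon_measure_on {0..} (\<nu> t)" "emeasure (\<nu> t) {0..} \<le> 1"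
    using assoc t by (auto simp: associated_convolution_semigroup_def convolution_semigroup_def)
  then have s: "sets (\<nu> t) = sets borel" and z: "emeasure (\<nu> t) (- {0..}) = 0"
    by (auto simp: Radon_measure_on_def)
  have "emeasure (\<nu> t) ({0..} \<union> - {0..}) \<le> emeasure (\<nu> t) {0..} + emeasure (\<nu> t) (- {0..})"
    by (rule emeasure_subadditive) (auto simp: s)
  moreover have "{0..} \<union> - {0..} = (UNIV :: real set)" by auto
  ultimately have "emeasure (\<nu> t) UNIV \<le> 1" using R(2) z by simp
  then have "finite_measure (\<nu> t)"
    using sets_eq_imp_space_eq[OF s] by (intro finite_measureI) (auto simp: top_unique)
  then show ?thesis using s z by (simp add: half_line_measure_def)
qed

text \<open>The defining identity concerns \<open>l > 0\<close>; the case \<open>l = 0\<close>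
  follows along \<open>1 / (n + 1)\<close> from continuity of both sides. It determines the mass of
  \<open>\<nu> t\<close>.\<close>

lemma laplace_\<nu>: "0 \<le> t \<Longrightarrow> 0 \<le> l \<Longrightarrow> laplace (\<nu> t) l = exp (- t * f0 l)"
proof -
  assume t: "0 \<le> t" and l: "0 \<le> l"
  have pos: "laplace (\<nu> t) l = exp (- t * f0 l)" if "0 < l" for l
    using assoc t that by (auto simp: associated_convolution_semigroup_def laplace_def f0_def)
  show ?thesis
  proof (cases "l = 0")
    case True
    have "(\<lambda>n. exp (- t * f0 (1 / real (Suc n)))) \<longlonglongrightarrow> exp (- t * a)"
      by (intro tendsto_intros f0_tendsto)
    moreover have "(\<lambda>n. exp (- t * f0 (1 / real (Suc n)))) \<longlonglongrightarrow> laplace (\<nu> t) 0"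
      using laplace_tendsto_0[OF half_line_\<nu>[OF t]] by (simp add: pos)
    ultimately show ?thesis using LIMSEQ_unique True by (auto simp: f0_def)
  qed (use l pos in simp)
qed

lemma measure_\<nu>: "0 \<le> t \<Longrightarrow> measure (\<nu> t) UNIV = exp (- t * a)"
  using laplace_\<nu>[of t 0] laplace_0[OF half_line_\<nu>] by (simp add: f0_def)

lemma measure_\<nu>_le_1: "0 \<le> t \<Longrightarrow> measure (\<nu> t) UNIV \<le> 1"
  using a_nonneg by (simp add: measure_\<nu>)

text \<open>\<open>laplace_tail\<close> gives the bound
  \<open>exp (- t * a) - exp (- t * f0 (1 / R))\<close>, which is at most
  \<open>t * (f0 (1 / R) - a)\<close>. Linearity in \<open>t\<close> makes it uniform on bounded
  times, and \<open>f0\<close> tends to \<open>a\<close> at 0.\<close>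

lemma \<nu>_tail:
  assumes t: "0 \<le> t" "t \<le> t0" and R: "0 < R"
  shows "(1 - exp (-1)) * measure (\<nu> t) {R<..} \<le> t0 * (f0 (1 / R) - a)"
proof -
  let ?d = "f0 (1 / R) - a"
  have d: "0 \<le> ?d" using f0_ge[of "1 / R"] R by simp
  have "(1 - exp (-1)) * measure (\<nu> t) {R<..} \<le> exp (- t * a) - exp (- t * f0 (1 / R))"
    using laplace_tail[OF half_line_\<nu>[OF t(1)] R] laplace_\<nu>[OF t(1), of 0] laplace_\<nu>[OF t(1), of "1 / R"] R
    by (simp add: f0_def)
  also have "\<dots> = exp (- t * a) * (1 - exp (- (t * ?d)))"
    by (simp add: right_diff_distrib exp_add[symmetric] algebra_simps)
  also have "\<dots> \<le> 1 * (t * ?d)"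
    using one_minus_exp_bounds(1)[of "t * ?d"] t d a_nonneg by (intro mult_mono) auto
  also have "\<dots> \<le> t0 * ?d" using t d by (simp add: mult_right_mono)
  finally show ?thesis .
qed

lemma \<nu>_tight:
  assumes e: "0 < e" and t0: "0 \<le> t0"
  shows "\<exists>R>0. \<forall>t. 0 \<le> t \<and> t \<le> t0 \<longrightarrow> measure (\<nu> t) {R<..} \<le> e"
proof -
  define \<kappa> where "\<kappa> = (1 - exp (-1 :: real))"
  have \<kappa>: "0 < \<kappa>" by (simp add: \<kappa>_def)
  have "(\<lambda>n. t0 * (f0 (1 / real (Suc n)) - a)) \<longlonglongrightarrow> t0 * (a - a)"
    by (intro tendsto_intros f0_tendsto)
  then have "eventually (\<lambda>n. t0 * (f0 (1 / real (Suc n)) - a) < \<kappa> * e) sequentially"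
    using e \<kappa> by (intro order_tendstoD(2)[where y = "t0 * (a - a)"]) auto
  then obtain n where n: "t0 * (f0 (1 / real (Suc n)) - a) < \<kappa> * e" by (auto simp: eventually_sequentially)
  have "measure (\<nu> t) {real (Suc n)<..} \<le> e" if "0 \<le> t" "t \<le> t0" for t
  proof -
    have "\<kappa> * measure (\<nu> t) {real (Suc n)<..} \<le> \<kappa> * e"
      using \<nu>_tail[OF that, of "real (Suc n)"] n unfolding \<kappa>_def by linarith
    then show ?thesis using \<kappa> by simp
  qed
  then show ?thesis by (intro exI[of _ "real (Suc n)"]) simp
qed

section \<open>The subordinated semigroup\<close>

definition S :: "real \<Rightarrow> 'a \<Rightarrow> 'a" where
  "S t x = Iop (\<nu> t) x"

lemma half_line_return: "half_line_measure (return borel 0)"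
  by (simp add: half_line_measure_def prob_space.finite_measure prob_space_return)

lemma lint_return:
  fixes F :: "real \<Rightarrow> 'e::euclidean_space"
  assumes "continuous_on {0..} F"
  shows "(LINT s:{0..}|return borel 0. F s) = F 0"
  unfolding set_lebesgue_integral_def
  by (subst integral_return) (use borel_measurable_continuous_on_indicator[OF _ assms] in auto)

lemma Iop_return: "Iop (return borel 0) x = x"
  by (rule eq_by_\<Phi>)
    (simp add: \<Phi>_Iop half_line_return lint_return bcont_\<Phi>_continuous[OF orbit_bcont] T_0)

lemma S_null:
  assumes w: "sconv w 0" and r: "\<And>n. 0 \<le> r n" "\<And>n. r n \<le> R"
  shows "sconv (\<lambda>n. S (r n) (w n)) 0"
  unfolding S_def
proof (rule Iop_null[of _ 1, OF _ _ w])
  fix e :: real assume "0 < e"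
  moreover have "0 \<le> R" using r[of 0] by simp
  ultimately obtain K where "\<forall>t. 0 \<le> t \<and> t \<le> R \<longrightarrow> measure (\<nu> t) {K<..} \<le> e" using \<nu>_tight by blast
  then show "\<exists>I\<in>sets borel. (\<forall>n. measure (\<nu> (r n)) (- I) \<le> e) \<and>
      (\<forall>r. (\<forall>n. 0 \<le> r n \<and> r n \<in> I) \<longrightarrow> sconv (\<lambda>n. T (r n) (w n)) 0)"
    using r T_equi_0[OF w, of _ K] by (intro bexI[of _ "{..K}"]) auto
qed (auto intro: half_line_\<nu> measure_\<nu>_le_1 r)

lemma S_null_global:
  assumes w: "sconv w 0" and r: "\<And>n. 0 \<le> r n"
    and global: "\<And>r. (\<And>n. 0 \<le> r n) \<Longrightarrow> sconv (\<lambda>n. T (r n) (w n)) 0"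
  shows "sconv (\<lambda>n. S (r n) (w n)) 0"
  unfolding S_def
proof (rule Iop_null[of _ 1, OF _ _ w])
  fix e :: real assume "0 < e"
  then show "\<exists>I\<in>sets borel. (\<forall>n. measure (\<nu> (r n)) (- I) \<le> e) \<and>
      (\<forall>r. (\<forall>n. 0 \<le> r n \<and> r n \<in> I) \<longrightarrow> sconv (\<lambda>n. T (r n) (w n)) 0)"
    using global by (intro bexI[of _ UNIV]) auto
qed (auto intro: half_line_\<nu> measure_\<nu>_le_1 r)

text \<open>The constant \<open>M\<close> is inherited because \<open>\<nu> t\<close> has mass at
  most 1. The instantiation makes uniqueness and closedness of the generator available for
  \<open>S\<close>.\<close>

sublocale S: saks_semigroup smul P S M
proof (intro saks_semigroup.intro saks_semigroup_axioms.intro saks_space_axioms)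
  fix t :: real assume t: "0 \<le> t"
  show "Vector_Spaces.linear smul smul (S t)"
    using scaling Iop_add[OF half_line_\<nu>[OF t]] Iop_smul[OF half_line_\<nu>[OF t]]
    by (simp add: Vector_Spaces.linear_iff normed_scaling_def S_def)
next
  fix t :: real and x assume t: "0 \<le> t"
  show "norm (S t x) \<le> M * norm x"
    using Iop_bound[OF half_line_\<nu>[OF t], of x] measure_\<nu>_le_1[OF t] M_nonneg
      mult_left_mono[of "measure (\<nu> t) UNIV" 1 "M * norm x"] by (simp add: S_def)
next
  have "\<nu> 0 = return borel 0"
    using assoc by (simp add: associated_convolution_semigroup_def convolution_semigroup_def)
  then show "S 0 x = x" for x by (simp add: S_def Iop_return)
next
  fix u t :: real and x assume ut: "0 \<le> u" "0 \<le> t"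
  have "\<nu> u \<star> \<nu> t = \<nu> (u + t)"
    using assoc ut by (simp add: associated_convolution_semigroup_def convolution_semigroup_def)
  then show "S (u + t) x = S u (S t x)"
    using ut by (simp add: S_def Iop_convolution half_line_\<nu>)
next
  fix r :: "nat \<Rightarrow> real" and x assume r: "\<And>n. 0 < r n" "r \<longlonglongrightarrow> 0"
  \<comment> \<open>Strong continuity is an instance of the weak limit theorem: the transforms of
    \<open>\<nu> (r n)\<close> tend to 1, the transform of the unit mass at 0. That mass is taken as
    \<open>\<rho>'\<close>, so the separate atom is 0.\<close>
  have "sconv (\<lambda>n. vint (\<nu> (r n)) (\<lambda>s. T s x)) (0 *\<^sub>R T 0 x + vint (return borel 0) (\<lambda>s. T s x))"
  proof (rule vint_weak_limit[OF orbit_bcont half_line_\<nu> half_line_return])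
    fix l :: real assume l: "0 \<le> l"
    have "laplace (return borel 0) l = 1" by (simp add: laplace_def lint_return continuous_intros)
    moreover have "(\<lambda>n. exp (- r n * f0 l)) \<longlonglongrightarrow> exp (- 0 * f0 l)" by (intro tendsto_intros r)
    ultimately show "(\<lambda>n. laplace (\<nu> (r n)) l) \<longlonglongrightarrow> 0 + laplace (return borel 0) l"
      using l r(1) by (simp add: laplace_\<nu> less_imp_le)
  qed (use r(1) less_imp_le in blast)
  then show "sconv (\<lambda>n. S (r n) x) x" by (simp add: S_def Iop_def[symmetric] Iop_return)
next
  fix s x R and r :: "nat \<Rightarrow> real"
  assume "sconv s x" "\<And>n. 0 \<le> r n" "\<And>n. r n \<le> R"
  then show "sconv (\<lambda>n. S (r n) (s n - x)) 0"
    using S_null[of "\<lambda>n. s n - x" r R] sconv_diff[of s x "\<lambda>_. x" x] sconv_const[of x] by simp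
qed (rule M_nonneg)

text \<open>If \<open>gen x z\<close> holds, the value \<open>z\<close> at 0 is the continuous
  extension, as \<open>s / (1 - exp (- s))\<close> tends to 1.\<close>

definition slope :: "'a \<Rightarrow> 'a \<Rightarrow> real \<Rightarrow> 'a" where
  "slope x z s = (if s = 0 then z else (1 / (1 - exp (- s))) *\<^sub>R (T s x - x))"

lemma slope_eq: "(1 - exp (- s)) *\<^sub>R slope x z s = T s x - x"
  by (simp add: slope_def T_0)

lemma gen_norm_bound:
  assumes "gen x z" "0 \<le> s"
  shows "norm (T s x - x) \<le> M * norm z * s"
  using gen_integral[OF assms] J_bound[OF assms(2), of z] by simp

lemma slope_bcont:
  assumes xz: "gen x z"
  shows "bcont (slope x z)"
proof -
  \<comment> \<open>Both factors 2 come from \<open>s \<le> (1 + s) * (1 - exp (- s))\<close>: it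
    gives \<open>s \<le> 2 * (1 - exp (- s))\<close> for \<open>s \<le> 1\<close> and
    \<open>1 \<le> 2 * (1 - exp (- s))\<close> for larger \<open>s\<close>. The first summand bounds
    short times, the second long ones.\<close>
  define C where "C = max (norm z) (2 * (M * norm z) + 2 * (M * norm x + norm x))"
  have bound: "norm (slope x z s) \<le> C" if s: "0 \<le> s" for s
  proof (cases "s = 0")
    case False
    then have s: "0 < s" using s by simp
    then have d: "0 < 1 - exp (- s)" by simp
    have "norm (T s x - x) \<le> (2 * (M * norm z) + 2 * (M * norm x + norm x)) * (1 - exp (- s))"
    proof (cases "s \<le> 1")
      case True
      have "norm (T s x - x) \<le> M * norm z * s" using s by (intro gen_norm_bound[OF xz]) simp
      also have "\<dots> \<le> M * norm z * (2 * (1 - exp (- s)))"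
      proof (intro mult_left_mono)
        have "(1 + s) * (1 - exp (- s)) \<le> 2 * (1 - exp (- s))" using True d by (intro mult_right_mono) auto
        then show "s \<le> 2 * (1 - exp (- s))" using one_minus_exp_bounds(2)[of s] s by linarith
      qed (use M_nonneg in simp)
      also have "\<dots> = (2 * (M * norm z)) * (1 - exp (- s))" by simp
      also have "\<dots> \<le> (2 * (M * norm z) + 2 * (M * norm x + norm x)) * (1 - exp (- s))"
        using d M_nonneg by (intro mult_right_mono) auto
      finally show ?thesis .
    next
      case False
      have "norm (T s x - x) \<le> M * norm x + norm x"
        using norm_triangle_ineq4[of "T s x" x] T_bound[of s x] s by linarith
      also have "\<dots> \<le> (M * norm x + norm x) * (2 * (1 - exp (- s)))"
      proof -
        have "s \<le> (1 + s) * (1 - exp (- s))" by (rule one_minus_exp_bounds) (use s in simp)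
        then have "1 \<le> (1 + s) / s * (1 - exp (- s))" using s by (simp add: field_simps)
        also have "\<dots> \<le> 2 * (1 - exp (- s))"
          using d s False by (intro mult_right_mono) (auto simp: field_simps)
        finally have "1 \<le> 2 * (1 - exp (- s))" .
        from mult_left_mono[OF this, of "M * norm x + norm x"] show ?thesis using M_nonneg by simp
      qed
      also have "\<dots> = (2 * (M * norm x + norm x)) * (1 - exp (- s))" by (simp only: mult_ac)
      also have "\<dots> \<le> (2 * (M * norm z) + 2 * (M * norm x + norm x)) * (1 - exp (- s))"
        using d M_nonneg by (intro mult_right_mono) auto
      finally show ?thesis .
    qed
    then have "norm (T s x - x) / (1 - exp (- s)) \<le> 2 * (M * norm z) + 2 * (M * norm x + norm x)"
      using d by (simp add: divide_le_eq)
    then show ?thesis using s d by (simp add: slope_def C_def)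
  qed (simp add: slope_def C_def)
  have conv: "sconv (\<lambda>n. slope x z (r n)) (slope x z s)"
    if r: "\<And>n. 0 \<le> r n" "r \<longlonglongrightarrow> s" for r s
  proof (cases "s = 0")
    case True
    \<comment> \<open>The generator limit runs over positive times, so zeros of \<open>r\<close> are
      replaced by dummy times; at these indices \<open>slope x z (r n) - z\<close> is 0.\<close>
    define h where "h n = (if r n = 0 then inverse (real (Suc n)) else r n)" for n
    have h: "0 < h n" for n using r(1)[of n] by (simp add: h_def)
    have "(\<lambda>n. r n + inverse (real (Suc n))) \<longlonglongrightarrow> 0"
      using tendsto_add[OF r(2) LIMSEQ_inverse_real_of_nat] True by simp
    then have h0: "h \<longlonglongrightarrow> 0"
      by (rule tendsto_0_sandwich) (use r(1) in \<open>auto simp: h_def\<close>)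
    then have "filterlim h (at_right 0) sequentially"
      using h less_imp_neq[OF h] by (auto simp: filterlim_at intro!: always_eventually)
    moreover have "((\<lambda>s::real. s / (1 - exp (- s))) \<longlongrightarrow> 1) (at_right 0)" by real_asymp
    ultimately have "(\<lambda>n. h n / (1 - exp (- h n))) \<longlonglongrightarrow> 1"
      by (rule filterlim_compose[rotated])
    moreover have "sconv (\<lambda>n. (1 / h n) *\<^sub>R (T (h n) x - x)) z" using xz h h0 by (simp add: gen_def)
    ultimately have "sconv (\<lambda>n. (h n / (1 - exp (- h n))) *\<^sub>R ((1 / h n) *\<^sub>R (T (h n) x - x))) (1 *\<^sub>R z)"
      by (intro sconv_scaleR)
    moreover have "(h n / (1 - exp (- h n))) *\<^sub>R ((1 / h n) *\<^sub>R (T (h n) x - x)) = slope x z (h n)" for n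
      using h[of n] by (simp add: slope_def)
    ultimately have "sconv (\<lambda>n. slope x z (h n) - z) 0" using sconv_diff[OF _ sconv_const[of z]] by fastforce
    then have "sconv (\<lambda>n. slope x z (r n) - z) 0"
      by (rule sconv_0_dominated) (auto simp: h_def slope_def)
    from sconv_add[OF this sconv_const[of z]] show ?thesis by (simp add: True slope_def)
  next
    case False
    then have s: "0 < s" using LIMSEQ_le_const[OF r(2), of 0] r(1) by force
    \<comment> \<open>Truncation at \<open>s / 2\<close> keeps the denominators away from 0 and
      changes only finitely many terms.\<close>
    define h where "h n = max (r n) (s / 2)" for n
    have h: "0 < h n" for n using s by (simp add: h_def)
    have "h \<longlonglongrightarrow> max s (s / 2)" unfolding h_def[abs_def] by (intro tendsto_intros r)
    then have hs: "h \<longlonglongrightarrow> s" using s by (simp add: max_def)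
    have "sconv (\<lambda>n. (1 / (1 - exp (- h n))) *\<^sub>R (T (h n) x - x)) ((1 / (1 - exp (- s))) *\<^sub>R (T s x - x))"
      using s by (intro sconv_scaleR sconv_diff sconv_const bcont_sconv[OF orbit_bcont] tendsto_intros hs)
        (auto intro: less_imp_le[OF h])
    then have hconv: "sconv (\<lambda>n. slope x z (h n)) (slope x z s)"
      using s h by (simp add: slope_def less_imp_neq[THEN not_sym])
    show ?thesis
    proof (rule sconvI[of _ C])
      show "norm (slope x z (r n)) \<le> C" for n using bound r(1) by simp
      fix p assume "p \<in> P"
      then have "(\<lambda>n. p (slope x z (h n) - slope x z s)) \<longlonglongrightarrow> 0" using hconv by (simp add: seq_conv_def)
      moreover have "eventually (\<lambda>n. s / 2 < r n) sequentially"
        by (rule order_tendstoD(1)[OF r(2)]) (use s in simp)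
      then have "eventually (\<lambda>n. p (slope x z (h n) - slope x z s) = p (slope x z (r n) - slope x z s)) sequentially"
        by eventually_elim (simp add: h_def)
      ultimately show "(\<lambda>n. p (slope x z (r n) - slope x z s)) \<longlonglongrightarrow> 0" by (rule Lim_transform_eventually)
    qed
  qed
  show ?thesis unfolding bcont_def using bound conv by blast
qed

section \<open>Difference quotients of the subordinated semigroup\<close>

lemma half_line_damped_\<nu>: "0 \<le> t \<Longrightarrow> 0 \<le> c \<Longrightarrow> half_line_measure (damped c (\<nu> t))"
  by (intro half_line_damped half_line_integrable[of _ _ 1] half_line_\<nu> half_line_sets)
    (auto intro!: continuous_intros)

text \<open>Damped measures are integrated over \<open>{0..}\<close>, the Levy integrals over
  \<open>{0<..}\<close>; the integrands that occur vanish at 0, which reconciles the two.\<close>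

lemma set_lint_origin:
  fixes F :: "real \<Rightarrow> 'e::euclidean_space"
  assumes "F 0 = 0"
  shows "(LINT s:{0..}|\<mu>. F s) = (LINT s:{0<..}|\<mu>. F s)"
    and "set_integrable \<mu> {0..} F \<longleftrightarrow> set_integrable \<mu> {0<..} F"
proof -
  have "indicat_real {0..} s *\<^sub>R F s = indicat_real {0<..} s *\<^sub>R F s" for s
    using assms by (cases "s = 0") (auto simp: indicator_def)
  then show "(LINT s:{0..}|\<mu>. F s) = (LINT s:{0<..}|\<mu>. F s)"
    "set_integrable \<mu> {0..} F \<longleftrightarrow> set_integrable \<mu> {0<..} F"
    unfolding set_lebesgue_integral_def set_integrable_def by (simp_all only:)
qed

lemma half_line_damped_\<mu>: "half_line_measure (damped 1 \<mu>)"
  using one_minus_exp_integrable[of 1] set_lint_origin(2)[of "\<lambda>s. 1 - exp (- s)"]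
  by (intro half_line_damped) (auto simp: sets_\<mu>)

text \<open>Multiplying \<open>exp (- l * s)\<close> by \<open>1 - exp (- s)\<close> gives
  \<open>exp (- l * s) - exp (- (l + 1) * s)\<close>.\<close>

lemma laplace_damped_\<nu>:
  assumes t: "0 < t" and l: "0 \<le> l"
  shows "laplace (damped (1 / t) (\<nu> t)) l = (exp (- t * f0 l) - exp (- t * f0 (l + 1))) / t"
proof -
  note \<nu> = half_line_\<nu>[of t]
  have "laplace (damped (1 / t) (\<nu> t)) l = (LINT s:{0..}|\<nu> t. (1 / t * (1 - exp (- s))) *\<^sub>R exp (- l * s))"
    unfolding laplace_def using t \<nu>
    by (intro damped_lint) (auto simp: half_line_measure_def intro!: continuous_intros)
  also have "\<dots> = (LINT s:{0..}|\<nu> t. (1 / t) * (exp (- l * s) - exp (- (l + 1) * s)))"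
    by (intro arg_cong[where f = "set_lebesgue_integral _ _"] ext) (simp add: algebra_simps exp_add[symmetric])
  also have "\<dots> = (1 / t) * (laplace (\<nu> t) l - laplace (\<nu> t) (l + 1))"
    unfolding laplace_def using t l half_line_exp_integrable[OF \<nu>, of l] half_line_exp_integrable[OF \<nu>, of "l + 1"]
    by simp
  finally show ?thesis using t l by (simp add: laplace_\<nu>)
qed

text \<open>In the increment of \<open>f0\<close> the constant \<open>a\<close> cancels and the
  linear part contributes \<open>b\<close>. This is the origin of the atom of mass \<open>b\<close>
  at 0 in the limit of the damped measures.\<close>

lemma laplace_damped_\<mu>:
  assumes l: "0 \<le> l"
  shows "b + laplace (damped 1 \<mu>) l = f0 (l + 1) - f0 l"
proof -
  have "laplace (damped 1 \<mu>) l = (LINT s:{0..}|\<mu>. (1 * (1 - exp (- s))) *\<^sub>R exp (- l * s))"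
    unfolding laplace_def by (intro damped_lint) (auto simp: sets_\<mu> intro!: continuous_intros)
  also have "\<dots> = (LINT s:{0<..}|\<mu>. (1 * (1 - exp (- s))) *\<^sub>R exp (- l * s))"
    by (rule set_lint_origin) simp
  also have "\<dots> = (LINT s:{0<..}|\<mu>. (1 - exp (- (l + 1) * s)) - (1 - exp (- l * s)))"
    by (intro arg_cong[where f = "set_lebesgue_integral _ _"] ext) (simp add: algebra_simps exp_add[symmetric])
  also have "\<dots> = (LINT s:{0<..}|\<mu>. 1 - exp (- (l + 1) * s)) - (LINT s:{0<..}|\<mu>. 1 - exp (- l * s))"
    by (intro set_integral_diff(2) one_minus_exp_integrable) (use l in auto)
  finally show ?thesis using l by (simp add: f0_eq algebra_simps)
qed

lemma exp_quotient_tendsto: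
  assumes r: "\<And>n. (0::real) < r n" "r \<longlonglongrightarrow> 0"
  shows "(\<lambda>n. (exp (- r n * \<alpha>) - exp (- r n * \<beta>)) / r n) \<longlonglongrightarrow> \<beta> - \<alpha>"
proof -
  have "((\<lambda>t. exp (- t * \<alpha>) - exp (- t * \<beta>)) has_real_derivative \<beta> - \<alpha>) (at 0)"
    by (auto intro!: derivative_eq_intros)
  then have "((\<lambda>h. (exp (- h * \<alpha>) - exp (- h * \<beta>)) / h) \<longlongrightarrow> \<beta> - \<alpha>) (at 0)"
    by (simp add: DERIV_def)
  moreover have "filterlim r (at 0) sequentially"
    using r(2) less_imp_neq[OF r(1)] by (auto simp: filterlim_at intro!: always_eventually)
  ultimately show ?thesis by (rule filterlim_compose)
qed

text \<open>The damping is undone by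
  \<open>(1 - exp (- s)) *\<^sub>R slope x z s = T s x - x\<close>. The existing integral of the
  bounded function \<open>slope x z\<close> thus yields integrability and value of the singular
  one.\<close>

lemma Phillips_integral:
  assumes xz: "gen x z" and \<phi>: "\<phi> \<in> \<Phi>"
  shows "set_integrable \<mu> {0<..} (\<lambda>s. \<phi> (x - T s x))"
    and "\<phi> (- vint (damped 1 \<mu>) (slope x z)) = (LINT s:{0<..}|\<mu>. \<phi> (x - T s x))"
proof -
  note G = slope_bcont[OF xz] and \<mu> = half_line_damped_\<mu>
  have cont: "continuous_on {0..} (\<lambda>s. \<phi> (slope x z s))" by (rule bcont_\<Phi>_continuous[OF G \<phi>])
  have eq: "(1 * (1 - exp (- s))) *\<^sub>R \<phi> (slope x z s) = \<phi> (T s x - x)" for s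
    using slope_eq[of s x z] by (simp flip: \<Phi>_scaleR[OF \<phi>])
  have neg: "\<phi> (x - T s x) = - \<phi> (T s x - x)" for s by (simp add: \<Phi>_diff[OF \<phi>])
  have "set_integrable \<mu> {0..} (\<lambda>s. \<phi> (T s x - x))"
    using bcont_\<Phi>_integrable[OF \<mu> G \<phi>] unfolding damped_set_integrable[OF zero_le_one sets_\<mu> cont] eq .
  then have int: "set_integrable \<mu> {0<..} (\<lambda>s. \<phi> (T s x - x))"
    using set_lint_origin(2)[of "\<lambda>s. \<phi> (T s x - x)"] linear_0[OF \<Phi>_real_linear[OF \<phi>]] by (simp add: T_0)
  then show "set_integrable \<mu> {0<..} (\<lambda>s. \<phi> (x - T s x))"
    unfolding neg set_integrable_def by simp
  have "\<phi> (vint (damped 1 \<mu>) (slope x z)) = (LINT s:{0..}|\<mu>. \<phi> (T s x - x))"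
    unfolding \<Phi>_vint[OF \<mu> G \<phi>] damped_lint[OF zero_le_one sets_\<mu> cont] eq ..
  also have "\<dots> = (LINT s:{0<..}|\<mu>. \<phi> (T s x - x))"
    by (rule set_lint_origin) (simp add: T_0 linear_0[OF \<Phi>_real_linear[OF \<phi>]])
  finally have "\<phi> (vint (damped 1 \<mu>) (slope x z)) = (LINT s:{0<..}|\<mu>. \<phi> (T s x - x))" .
  then show "\<phi> (- vint (damped 1 \<mu>) (slope x z)) = (LINT s:{0<..}|\<mu>. \<phi> (x - T s x))"
    unfolding neg using linear_neg[OF \<Phi>_real_linear[OF \<phi>]] int by (simp add: set_integral_uminus)
qed

text \<open>Since \<open>T s x - x = (1 - exp (- s)) slope\<^sub>x(s)\<close>, the difference quotients of \<open>S\<close> are integrals of the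
  bounded continuous function \<open>slope\<^sub>x\<close> against the finite measures \<open>(1 - exp (- s)) \<nu>\<^sub>t(ds) / t\<close>, whose
  Laplace transforms converge to that of \<open>b \<delta>\<^sub>0 + (1 - exp (- s)) \<mu>(ds)\<close>.\<close>
lemma gen_imp_S_gen:
  assumes xz: "gen x z"
  shows "S.gen x (b *\<^sub>R z + vint (damped 1 \<mu>) (slope x z) - a *\<^sub>R x)"
  unfolding S.gen_def
proof (intro allI impI)
  fix r :: "nat \<Rightarrow> real" assume "(\<forall>n. 0 < r n) \<and> r \<longlonglongrightarrow> 0"
  then have r: "\<And>n. 0 < r n" "r \<longlonglongrightarrow> 0" by auto
  note G = slope_bcont[OF xz]
  let ?\<rho> = "\<lambda>n. damped (1 / r n) (\<nu> (r n))"
  have \<rho>: "half_line_measure (?\<rho> n)" for n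
    using r(1)[of n] by (intro half_line_damped_\<nu>) auto
  have "sconv (\<lambda>n. vint (?\<rho> n) (slope x z)) (b *\<^sub>R slope x z 0 + vint (damped 1 \<mu>) (slope x z))"
  proof (rule vint_weak_limit[OF G \<rho> half_line_damped_\<mu>])
    fix l :: real assume l: "0 \<le> l"
    show "(\<lambda>n. laplace (?\<rho> n) l) \<longlonglongrightarrow> b + laplace (damped 1 \<mu>) l"
      unfolding laplace_damped_\<mu>[OF l] laplace_damped_\<nu>[OF r(1) l] by (rule exp_quotient_tendsto[OF r])
  qed
  \<comment> \<open>The killing term: \<open>\<nu> t\<close> has mass \<open>exp (- t * a)\<close>,
    so integrating \<open>T s x - x\<close> gives \<open>S t x - exp (- t * a) *\<^sub>R x\<close>.
    Divided by the time, the discrepancy tends to \<open>a *\<^sub>R x\<close>.\<close>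
  moreover have "(\<lambda>n. (1 - exp (- r n * a)) / r n) \<longlonglongrightarrow> a"
    using exp_quotient_tendsto[OF r, of 0 a] by simp
  ultimately have "sconv (\<lambda>n. vint (?\<rho> n) (slope x z) - ((1 - exp (- r n * a)) / r n) *\<^sub>R x)
      (b *\<^sub>R slope x z 0 + vint (damped 1 \<mu>) (slope x z) - a *\<^sub>R x)"
    by (intro sconv_diff sconv_scaleR sconv_const)
  moreover have "vint (?\<rho> n) (slope x z) - ((1 - exp (- r n * a)) / r n) *\<^sub>R x = (1 / r n) *\<^sub>R (S (r n) x - x)" for n
  proof (rule eq_by_\<Phi>)
    fix \<phi> assume \<phi>: "\<phi> \<in> \<Phi>"
    have rn: "0 < r n" by (rule r)
    note \<nu> = half_line_\<nu>[OF less_imp_le[OF rn]]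
    have cont: "continuous_on {0..} (\<lambda>s. \<phi> (slope x z s))" by (rule bcont_\<Phi>_continuous[OF G \<phi>])
    have eq: "(1 / r n * (1 - exp (- s))) *\<^sub>R \<phi> (slope x z s) = (1 / r n) *\<^sub>R \<phi> (T s x - x)" for s
      by (simp only: scaleR_scaleR[symmetric] \<Phi>_scaleR[OF \<phi>, symmetric] slope_eq)
    have "\<phi> (vint (?\<rho> n) (slope x z)) = (LINT s:{0..}|\<nu> (r n). (1 / r n) *\<^sub>R \<phi> (T s x - x))"
      unfolding \<Phi>_vint[OF \<rho> G \<phi>] eq[symmetric]
      by (rule damped_lint[OF _ half_line_sets[OF \<nu>] cont]) (use rn in simp)
    also have "\<dots> = (1 / r n) *\<^sub>R \<phi> (vint (\<nu> (r n)) (\<lambda>s. T s x - x))"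
      using \<Phi>_vint[OF \<nu> bcont_diff_const[OF orbit_bcont] \<phi>] by simp
    also have "vint (\<nu> (r n)) (\<lambda>s. T s x - x) = S (r n) x - exp (- r n * a) *\<^sub>R x"
      using vint_diff_const[OF \<nu> orbit_bcont] rn by (simp add: S_def Iop_def measure_\<nu>)
    finally have *: "\<phi> (vint (?\<rho> n) (slope x z)) = (1 / r n) *\<^sub>R (\<phi> (S (r n) x) - exp (- r n * a) *\<^sub>R \<phi> x)"
      by (simp add: \<Phi>_diff[OF \<phi>] \<Phi>_scaleR[OF \<phi>])
    show "\<phi> (vint (?\<rho> n) (slope x z) - ((1 - exp (- r n * a)) / r n) *\<^sub>R x) = \<phi> ((1 / r n) *\<^sub>R (S (r n) x - x))"
      by (simp add: \<Phi>_diff[OF \<phi>] \<Phi>_scaleR[OF \<phi>] * scaleR_diff_right scaleR_diff_left diff_divide_distrib)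
  qed
  ultimately show "sconv (\<lambda>n. (1 / r n) *\<^sub>R (S (r n) x - x)) (b *\<^sub>R z + vint (damped 1 \<mu>) (slope x z) - a *\<^sub>R x)"
    by (simp add: slope_def)
qed

text \<open>\<open>S t\<close> and \<open>J h\<close> are orbit integrals and commute; the
  sequential continuity of \<open>J h\<close> then carries the limit of the difference quotients
  through it.\<close>

lemma S_gen_average:
  assumes xz: "S.gen x z"
  shows "S.gen (c *\<^sub>R J h x) (c *\<^sub>R J h z)"
  unfolding S.gen_def
proof (intro allI impI)
  fix r :: "nat \<Rightarrow> real" assume r: "(\<forall>n. 0 < r n) \<and> r \<longlonglongrightarrow> 0"
  note seg = half_line_segment[of h]
  have "(1 / r n) *\<^sub>R (S (r n) (c *\<^sub>R J h x) - c *\<^sub>R J h x) = c *\<^sub>R J h ((1 / r n) *\<^sub>R (S (r n) x - x))" for n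
  proof -
    have rn: "0 \<le> r n" using r less_imp_le by blast
    have "S (r n) (J h x) = J h (S (r n) x)"
      unfolding S_def J_def by (rule Iop_commute[OF half_line_\<nu>[OF rn] seg])
    then show ?thesis
      using rn by (simp add: S.T_scaleR J_def Iop_scaleR[OF seg] Iop_diff[OF seg] scaleR_diff_right mult.commute)
  qed
  moreover have "sconv (\<lambda>n. (1 / r n) *\<^sub>R (S (r n) x - x)) z" using xz r by (simp add: S.gen_def)
  ultimately show "sconv (\<lambda>n. (1 / r n) *\<^sub>R (S (r n) (c *\<^sub>R J h x) - c *\<^sub>R J h x)) (c *\<^sub>R J h z)"
    using sconv_scaleR[OF Iop_sconv[OF seg] tendsto_const] by (simp add: J_def)
qed

text \<open>Averages lie in the domain of the generator of \<open>T\<close> for every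
  \<open>x\<close>. By commutation the generator of \<open>S\<close> maps them to the averages of
  \<open>z\<close>, so both components converge.\<close>

lemma S_gen_core:
  assumes xz: "S.gen x z"
  shows "\<exists>xs zs ws. (\<forall>n. gen (xs n) (ws n) \<and> S.gen (xs n) (zs n)) \<and> sconv xs x \<and> sconv zs z"
proof -
  define h where "h n = inverse (real (Suc n))" for n
  have h: "0 < h n" "h \<longlonglongrightarrow> 0" for n
    using LIMSEQ_inverse_real_of_nat by (auto simp: h_def[abs_def])
  show ?thesis
    by (intro exI[of _ "\<lambda>n. (1 / h n) *\<^sub>R J (h n) x"] exI[of _ "\<lambda>n. (1 / h n) *\<^sub>R J (h n) z"]
        exI[of _ "\<lambda>n. (1 / h n) *\<^sub>R (T (h n) x - x)"] conjI allI gen_average S_gen_average xz J_average_sconv h)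
qed

end

section \<open>Topological formulation\<close>

lemma uniformly_null_imp_sequential:
  assumes "uniformly_null \<tau> I y" "topspace \<tau> = UNIV" "\<And>n. r n \<in> I"
  shows "limitin \<tau> (\<lambda>n. y n (r n)) 0 sequentially"
  unfolding limitin_def
proof (intro conjI allI impI)
  fix U assume "openin \<tau> U \<and> 0 \<in> U"
  then have "eventually (\<lambda>n. \<forall>t\<in>I. y n t \<in> U) sequentially"
    using assms(1) unfolding uniformly_null_def by blast
  then show "eventually (\<lambda>n. y n (r n) \<in> U) sequentially"
    by (rule eventually_mono) (use assms(3) in blast)
qed (simp add: assms(2))

text \<open>For each \<open>n\<close> a time is selected that fails if any time does; convergence
  along this one selection already gives uniformity.\<close>

lemma uniformly_null_sequentialI:
  assumes "\<And>r. (\<And>n. r n \<in> I) \<Longrightarrow> limitin \<tau> (\<lambda>n. y n (r n)) 0 sequentially"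
  shows "uniformly_null \<tau> I y"
  unfolding uniformly_null_def
proof (intro allI impI)
  fix U assume U: "openin \<tau> U \<and> 0 \<in> U"
  show "eventually (\<lambda>n. \<forall>t\<in>I. y n t \<in> U) sequentially"
  proof (cases "I = {}")
    case False
    then obtain i where i: "i \<in> I" by blast
    have "\<exists>t. t \<in> I \<and> (y n t \<in> U \<longrightarrow> (\<forall>t\<in>I. y n t \<in> U))" for n using i by blast
    then have "\<exists>r. \<forall>n. r n \<in> I \<and> (y n (r n) \<in> U \<longrightarrow> (\<forall>t\<in>I. y n t \<in> U))"
      by (intro choice allI)
    then obtain r where r: "\<And>n. r n \<in> I" "\<And>n. y n (r n) \<in> U \<Longrightarrow> \<forall>t\<in>I. y n t \<in> U" by blast
    have "eventually (\<lambda>n. y n (r n) \<in> U) sequentially"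
      by (rule limitinD[OF assms[OF r(1)]]) (use U in simp_all)
    then show ?thesis by (rule eventually_mono) (rule r(2))
  qed simp
qed

locale mixed_space = linear_top smul \<tau>
  for smul :: "'k::{real_normed_field,euclidean_space} \<Rightarrow> 'a::banach \<Rightarrow> 'a" and \<tau> +
  assumes base: "neighbourhood_base_at 0 convex \<tau>"
    and coarser: "coarser_topology \<tau> euclidean"
    and nrm: "norming smul \<tau>"
begin

abbreviation "\<gamma> \<equiv> mixed_topology smul \<tau>"
abbreviation "P \<equiv> top_seminorms \<tau>"

lemma seq_conv_iff: "seq_conv P s l \<longleftrightarrow> bounded (range s) \<and> limitin \<tau> s l sequentially"
  by (simp add: seq_conv_def limitin_seminorms[OF coarser base])

lemma seq_conv_iff_mixed: "seq_conv P s l \<longleftrightarrow> limitin \<gamma> s l sequentially"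
  by (simp add: seq_conv_iff limitin_mixed_sequentially[OF coarser nrm])

lemma top_dual_mixed_seq_dual: "\<phi> \<in> top_dual smul \<gamma> \<Longrightarrow> \<phi> \<in> seq_dual smul P"
  using continuous_map_limit[of \<gamma> euclidean \<phi>]
  by (auto simp: top_dual_def seq_dual_def seq_conv_iff_mixed o_def)

lemma top_dual_mixed: "\<phi> \<in> top_dual smul \<tau> \<Longrightarrow> \<phi> \<in> top_dual smul \<gamma>"
  by (auto simp: top_dual_def continuous_map_def mixed_finer)

lemma pettis_eqI:
  assumes "has_pettis_integral smul \<gamma> M A g x"
  shows "pettis_integral smul \<gamma> M A g = x"
  unfolding pettis_integral_def
proof (rule the_equality[where a = x])
  fix y assume y: "has_pettis_integral smul \<gamma> M A g y"
  have "norm (y - x) \<le> 0"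
  proof (rule norming_bound[OF coarser nrm])
    fix \<phi> assume \<phi>: "\<phi> \<in> top_dual smul \<tau>"
    then have "\<phi> y = \<phi> x"
      using assms y top_dual_mixed[OF \<phi>] unfolding has_pettis_integral_def by metis
    then show "norm (\<phi> (y - x)) \<le> 0"
      using \<phi> linear_diff[OF bounded_linear.linear[OF top_dual_bounded_linear[OF coarser \<phi>]]] by simp
  qed
  then show "y = x" by simp
qed (rule assms)

text \<open>The bound on \<open>g\<close> supplies the norm boundedness contained in
  \<open>seq_conv\<close>, which \<open>\<tau>\<close>-convergence alone does not give.\<close>

lemma limitin_at_right_iff:
  fixes g :: "real \<Rightarrow> 'a"
  assumes "\<And>t. 0 < t \<Longrightarrow> norm (g t) \<le> C"
  shows "limitin \<tau> g l (at_right 0) \<longleftrightarrow> (\<forall>r. (\<forall>n. 0 < r n) \<and> r \<longlonglongrightarrow> 0 \<longrightarrow> seq_conv P (\<lambda>n. g (r n)) l)"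
proof -
  have "bounded (range (\<lambda>n. g (r n)))" if "\<forall>n. 0 < r n" for r :: "nat \<Rightarrow> real"
    using that assms by (auto simp: bounded_iff)
  then show ?thesis unfolding limitin_at_right_sequential seq_conv_iff by blast
qed

end

locale bicontinuous_subordination = mixed_space smul \<tau>
  for smul :: "'k::{real_normed_field,euclidean_space} \<Rightarrow> 'a::banach \<Rightarrow> 'a" and \<tau> +
  fixes T :: "real \<Rightarrow> 'a \<Rightarrow> 'a" and M :: real
    and f :: "real \<Rightarrow> real" and a b :: real and \<mu> :: "real measure" and \<nu> :: "real \<Rightarrow> real measure"
  assumes T: "locally_bicontinuous smul \<tau> T"
    and M: "0 \<le> M" "0 \<le> t \<Longrightarrow> norm (T t x) \<le> M * norm x"
    and Levy_triplet: "Levy_triplet f a b \<mu>"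
    and convolution: "associated_convolution_semigroup f \<nu>"
begin

lemma saks_space: "saks_space smul P"
proof
  show "normed_scaling smul" by (rule scaling)
  show "seminorm p" if "p \<in> P" for p using that by (rule top_seminorms_seminorm)
  show "\<exists>c>0. \<forall>x. p x \<le> c * norm x" if "p \<in> P" for p by (rule top_seminorms_bounded[OF coarser that])
  show "\<exists>l. seq_conv P s l"
    if s: "bounded (range s)" and "\<And>p e. p \<in> P \<Longrightarrow> 0 < e \<Longrightarrow> \<exists>N. \<forall>m\<ge>N. \<forall>n\<ge>N. p (s m - s n) < e" for s
    using T Cauchy_sequence_in_seminorms[of s, OF coarser base that(2)] s
    unfolding locally_bicontinuous_def bicontinuous_on_def seq_conv_iff by blast
  show "norm x \<le> C"
    if *: "\<And>\<phi>. \<phi> \<in> seq_dual smul P \<Longrightarrow> (\<And>y. norm (\<phi> y) \<le> norm y) \<Longrightarrow> norm (\<phi> x) \<le> C" for x C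
    by (rule norming_bound[OF coarser nrm]) (use * top_dual_mixed top_dual_mixed_seq_dual in blast)
qed

sublocale saks_space smul P
  by (rule saks_space)

lemma T_semigroup: "operator_semigroup smul T"
  using T by (simp add: locally_bicontinuous_def bicontinuous_on_def)

sublocale subordination smul P T M f a b \<mu> \<nu>
proof (intro subordination.intro saks_semigroup.intro saks_semigroup_axioms.intro
    subordination_axioms.intro saks_space Levy_triplet convolution M)
  show "0 \<le> t \<Longrightarrow> Vector_Spaces.linear smul smul (T t)" for t
    using T_semigroup by (simp add: operator_semigroup_def)
  show "T 0 x = x" for x using T_semigroup by (simp add: operator_semigroup_def)
  show "0 \<le> u \<Longrightarrow> 0 \<le> t \<Longrightarrow> T (u + t) x = T u (T t x)" for u t x
    using T_semigroup by (simp add: operator_semigroup_def)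
  show "seq_conv P (\<lambda>n. T (r n) x) x" if "\<And>n. 0 < r n" "r \<longlonglongrightarrow> 0" for r x
  proof -
    have "limitin \<tau> (\<lambda>t. T t x) x (at_right 0)"
      using T by (simp add: locally_bicontinuous_def bicontinuous_on_def)
    then show ?thesis using that limitin_at_right_iff[of "\<lambda>t. T t x" "M * norm x" x] M(2) by simp
  qed
  show "seq_conv P (\<lambda>n. T (r n) (s n - x)) 0"
    if s: "seq_conv P s x" and r: "\<And>n. 0 \<le> r n" "\<And>n. r n \<le> R" for s x R and r :: "nat \<Rightarrow> real"
    unfolding seq_conv_iff
  proof
    obtain C where C: "\<And>n. norm (s n) \<le> C" using s by (auto simp: seq_conv_def bounded_iff)
    have "norm (T (r n) (s n - x)) \<le> M * (C + norm x)" for n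
    proof -
      have "norm (s n - x) \<le> C + norm x" using norm_triangle_ineq4[of "s n" x] C[of n] by linarith
      then show ?thesis using M(2)[OF r(1)[of n], of "s n - x"] mult_left_mono[OF _ M(1)] order_trans by blast
    qed
    then show "bounded (range (\<lambda>n. T (r n) (s n - x)))" by (auto simp: bounded_iff)
    have "uniformly_null \<tau> {0..R} (\<lambda>n t. T t (s n - x))"
      using T s unfolding locally_bicontinuous_def bicontinuous_on_def seq_conv_iff
      by (elim conjE allE[of _ s] allE[of _ x]) auto
    then show "limitin \<tau> (\<lambda>n. T (r n) (s n - x)) 0 sequentially"
      by (rule uniformly_null_imp_sequential) (use r in auto)
  qed
qed

lemma generator_graph_T: "generator_graph \<gamma> T = {(x, y). gen x y}"
  by (simp add: generator_graph_def gen_def limitin_at_right_sequential seq_conv_iff_mixed)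

abbreviation "S' \<equiv> subordinated_semigroup smul \<gamma> \<nu> T"

lemma has_pettis_S:
  assumes "0 \<le> t"
  shows "has_pettis_integral smul \<gamma> (\<nu> t) {0..} (\<lambda>s. T s x) (S t x)"
  unfolding has_pettis_integral_def
  using \<Phi>_Iop[OF half_line_\<nu>[OF assms]] orbit_\<Phi>_integrable[OF half_line_\<nu>[OF assms]] top_dual_mixed_seq_dual
  by (simp add: S_def)

lemma S'_eq: "0 \<le> t \<Longrightarrow> S' t x = S t x"
  unfolding subordinated_semigroup_def by (rule pettis_eqI[OF has_pettis_S])

lemma generator_graph_S: "generator_graph \<gamma> S' = {(x, y). S.gen x y}"
  using S'_eq[OF less_imp_le]
  by (auto simp: generator_graph_def S.gen_def limitin_at_right_sequential seq_conv_iff_mixed)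

lemma has_pettis_Phillips:
  assumes "gen x z"
  shows "has_pettis_integral smul \<gamma> \<mu> {0<..} (\<lambda>t. x - T t x) (- vint (damped 1 \<mu>) (slope x z))"
  unfolding has_pettis_integral_def
  using Phillips_integral[OF assms top_dual_mixed_seq_dual] by blast

lemma well_defined_S: "0 \<le> t \<Longrightarrow> pettis_integrable smul \<gamma> (\<nu> t) {0..} (\<lambda>s. T s x)"
  unfolding pettis_integrable_def using has_pettis_S by blast

lemma well_defined_Phillips:
  "x \<in> Domain (generator_graph \<gamma> T) \<Longrightarrow> pettis_integrable smul \<gamma> \<mu> {0<..} (\<lambda>t. x - T t x)"
  unfolding pettis_integrable_def generator_graph_T using has_pettis_Phillips by blast

text \<open>As the generator is \<open>- A\<close>, one has \<open>z = - Ax\<close>. In this form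
  the graph consists of the pairs that \<open>gen_imp_S_gen\<close> places in the generator of
  \<open>S\<close>.\<close>

lemma neg_Phillips_graph:
  "neg_graph (Phillips_graph smul \<gamma> a b \<mu> T)
    = {(x, b *\<^sub>R z + vint (damped 1 \<mu>) (slope x z) - a *\<^sub>R x) | x z. gen x z}"
proof -
  define V where "V x z = b *\<^sub>R z + vint (damped 1 \<mu>) (slope x z) - a *\<^sub>R x" for x z
  define Q where "Q x = pettis_integral smul \<gamma> \<mu> {0<..} (\<lambda>t. x - T t x)" for x
  have eq: "- (a *\<^sub>R x + b *\<^sub>R (- z) + Q x) = V x z" if "gen x z" for x z
    by (simp add: Q_def V_def pettis_eqI[OF has_pettis_Phillips[OF that]])
  have "neg_graph (Phillips_graph smul \<gamma> a b \<mu> T) = {(x, - (a *\<^sub>R x + b *\<^sub>R (- z) + Q x)) | x z. gen x z}"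
  proof (intro antisym subsetI)
    fix u assume "u \<in> {(x, - (a *\<^sub>R x + b *\<^sub>R (- z) + Q x)) | x z. gen x z}"
    then obtain x z where u: "u = (x, - (a *\<^sub>R x + b *\<^sub>R (- z) + Q x))" and xz: "gen x z" by blast
    have "(x, - z) \<in> neg_graph (generator_graph \<gamma> T)"
      unfolding neg_graph_def generator_graph_T using xz by blast
    then have "(x, a *\<^sub>R x + b *\<^sub>R (- z) + Q x) \<in> Phillips_graph smul \<gamma> a b \<mu> T"
      unfolding Phillips_graph_def Q_def by blast
    then show "u \<in> neg_graph (Phillips_graph smul \<gamma> a b \<mu> T)"
      unfolding u neg_graph_def by blast
  qed (auto simp: neg_graph_def Phillips_graph_def generator_graph_T Q_def)
  also have "\<dots> = {(x, V x z) | x z. gen x z}"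
    using eq by (intro Collect_cong iff_exI) auto
  finally show ?thesis by (simp only: V_def)
qed

lemma generator_S_closure:
  "generator_graph \<gamma> S' = sequential_closure \<gamma> (neg_graph (Phillips_graph smul \<gamma> a b \<mu> T))"
proof (intro antisym subsetI)
  fix u assume "u \<in> generator_graph \<gamma> S'"
  then obtain x z where u: "u = (x, z)" and xz: "S.gen x z" by (auto simp: generator_graph_S)
  obtain xs zs ws where *: "\<And>n. gen (xs n) (ws n)" "\<And>n. S.gen (xs n) (zs n)" "seq_conv P xs x" "seq_conv P zs z"
    using S_gen_core[OF xz] by blast
  \<comment> \<open>On \<open>xs n\<close>, in the domain of the generator of \<open>T\<close>, the
    generator of \<open>S\<close> is given by the Phillips formula; single-valuedness identifies
    \<open>zs n\<close> with that value.\<close>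
  have mem: "(xs n, zs n) \<in> neg_graph (Phillips_graph smul \<gamma> a b \<mu> T)" for n
    using S.gen_unique[OF *(2)[of n] gen_imp_S_gen[OF *(1)[of n]]] *(1)[of n]
    by (auto simp: neg_Phillips_graph)
  have lim: "limitin (prod_topology \<gamma> \<gamma>) (\<lambda>n. (xs n, zs n)) (x, z) sequentially"
    using *(3,4) by (simp add: limitin_pairwise seq_conv_iff_mixed o_def)
  show "u \<in> sequential_closure \<gamma> (neg_graph (Phillips_graph smul \<gamma> a b \<mu> T))"
    unfolding sequential_closure_def u
  proof (intro InterI, elim CollectE conjE)
    fix C assume "sequentially_closedin (prod_topology \<gamma> \<gamma>) C" "neg_graph (Phillips_graph smul \<gamma> a b \<mu> T) \<subseteq> C"
    then have "(\<forall>n. (xs n, zs n) \<in> C) \<and> limitin (prod_topology \<gamma> \<gamma>) (\<lambda>n. (xs n, zs n)) (x, z) sequentially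
        \<longrightarrow> (x, z) \<in> C"
      unfolding sequentially_closedin_def by (elim conjE allE)
    then show "(x, z) \<in> C" using mem lim \<open>_ \<subseteq> C\<close> by blast
  qed
next
  \<comment> \<open>The generator graph of \<open>S'\<close> is shown to be one of the sets whose
    intersection is the sequential closure.\<close>
  have "sequentially_closedin (prod_topology \<gamma> \<gamma>) (generator_graph \<gamma> S')"
    unfolding sequentially_closedin_def
  proof (intro conjI allI impI; (elim conjE)?)
    fix s l assume s: "\<forall>n. s n \<in> generator_graph \<gamma> S'" and l: "limitin (prod_topology \<gamma> \<gamma>) s l sequentially"
    have "S.gen (fst l) (snd l)"
    proof (rule S.gen_closed)
      show "S.gen (fst (s n)) (snd (s n))" for n using s by (auto simp: generator_graph_S split_def)
      show "seq_conv P (\<lambda>n. fst (s n)) (fst l)" "seq_conv P (\<lambda>n. snd (s n)) (snd l)"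
        using l by (simp_all add: limitin_pairwise seq_conv_iff_mixed o_def)
    qed
    then show "l \<in> generator_graph \<gamma> S'" by (simp add: generator_graph_S split_def)
  qed simp
  moreover have "neg_graph (Phillips_graph smul \<gamma> a b \<mu> T) \<subseteq> generator_graph \<gamma> S'"
    using gen_imp_S_gen by (auto simp: neg_Phillips_graph generator_graph_S)
  moreover fix u assume "u \<in> sequential_closure \<gamma> (neg_graph (Phillips_graph smul \<gamma> a b \<mu> T))"
  ultimately show "u \<in> generator_graph \<gamma> S'" unfolding sequential_closure_def by blast
qed

lemma onorm_S'_le: "0 \<le> t \<Longrightarrow> onorm (S' t) \<le> M"
  using S.T_bound by (intro onorm_bound M) (simp add: S'_eq)

lemma uniformly_bounded_S': "uniformly_bounded S'"
  unfolding uniformly_bounded_def by (rule bdd_aboveI[of _ M]) (auto intro: onorm_S'_le)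

lemma operator_semigroup_S': "operator_semigroup smul S'"
proof -
  have eq: "S' t = S t" if "0 \<le> t" for t using that by (intro ext S'_eq)
  have "bounded_linear (S t)" if "0 \<le> t" for t
    using S.T_add[OF that] S.T_scaleR[OF that] S.T_bound[OF that]
    by (intro bounded_linear_intro[of _ M]) (auto simp: mult.commute)
  then show ?thesis
    unfolding operator_semigroup_def using S.T_linear S.T_0 S.T_plus by (auto simp: eq)
qed

text \<open>Only the equicontinuity clause depends on the family of time sets. It enters through
  selections of times, so that the local and the global case share the rest.\<close>

lemma bicontinuous_on_S':
  assumes \<I>: "\<And>s x I r. seq_conv P s x \<Longrightarrow> I \<in> \<I> \<Longrightarrow> (\<And>n. r n \<in> I) \<Longrightarrow> seq_conv P (\<lambda>n. S' (r n) (s n - x)) 0"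
  shows "bicontinuous_on \<I> smul \<tau> S'"
  unfolding bicontinuous_on_def
proof (intro conjI operator_semigroup_S' coarser nrm)
  show "\<forall>s. bounded (range s) \<and> Cauchy_sequence_in \<tau> s \<longrightarrow> (\<exists>l. limitin \<tau> s l sequentially)"
    using T by (simp add: locally_bicontinuous_def bicontinuous_on_def)
  have "onorm (S' t) \<le> max M 1 * exp (0 * t)" if "0 \<le> t" for t using onorm_S'_le[OF that] by simp
  then show "\<exists>M\<ge>1. \<exists>\<omega>. \<forall>t\<ge>0. onorm (S' t) \<le> M * exp (\<omega> * t)"
    by (intro exI[of _ "max M 1"] conjI exI[of _ "0::real"]) auto
  show "\<forall>x. limitin \<tau> (\<lambda>t. S' t x) x (at_right 0)"
  proof
    fix x
    have "seq_conv P (\<lambda>n. S' (r n) x) x" if "\<forall>n. 0 < r n" "r \<longlonglongrightarrow> 0" for r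
      using S.T_cont[of r x] that by (simp add: S'_eq less_imp_le)
    then show "limitin \<tau> (\<lambda>t. S' t x) x (at_right 0)"
      using S.T_bound by (subst limitin_at_right_iff[of _ "M * norm x"]) (auto simp: S'_eq)
  qed
  show "\<forall>s x. bounded (range s) \<and> limitin \<tau> s x sequentially \<longrightarrow>
      (\<forall>I\<in>\<I>. uniformly_null \<tau> I (\<lambda>n t. S' t (s n - x)))"
    using \<I> by (auto simp: seq_conv_iff intro!: uniformly_null_sequentialI)
qed

lemma locally_bicontinuous_S': "locally_bicontinuous smul \<tau> S'"
  unfolding locally_bicontinuous_def
proof (rule bicontinuous_on_S')
  fix s x I and r :: "nat \<Rightarrow> real"
  assume s: "seq_conv P s x" and I: "I \<in> {K. compact K \<and> K \<subseteq> {0..}}" and r: "\<And>n. r n \<in> I"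
  have "bounded I" using I by (simp add: compact_imp_bounded)
  then obtain R where "\<And>t. t \<in> I \<Longrightarrow> norm t \<le> R" by (auto simp: bounded_iff)
  then have "r n \<le> R" for n using r[of n] by force
  moreover have "0 \<le> r n" for n using I r by auto
  ultimately show "seq_conv P (\<lambda>n. S' (r n) (s n - x)) 0"
    using S.T_equi[OF s, of r R] by (simp add: S'_eq)
qed

lemma bicontinuous_S':
  assumes "bicontinuous smul \<tau> T"
  shows "bicontinuous smul \<tau> S'"
  unfolding bicontinuous_def
proof (rule bicontinuous_on_S')
  fix s x I and r :: "nat \<Rightarrow> real"
  assume s: "seq_conv P s x" and "I \<in> {{0..}}" and "\<And>n. r n \<in> I"
  then have r: "0 \<le> r n" for n by auto
  have w: "seq_conv P (\<lambda>n. s n - x) 0" using sconv_diff[OF s sconv_const[of x]] by simp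
  have null: "uniformly_null \<tau> {0..} (\<lambda>n t. T t (s n - x))"
    using assms s by (simp add: bicontinuous_def bicontinuous_on_def seq_conv_iff)
  have "seq_conv P (\<lambda>n. S (r n) (s n - x)) 0"
  proof (rule S_null_global[OF w r])
    fix q :: "nat \<Rightarrow> real" assume q: "\<And>n. 0 \<le> q n"
    obtain C where C: "0 \<le> C" "\<And>n. norm (s n - x) \<le> C" using sconv_boundedE[OF w] by metis
    have "norm (T (q n) (s n - x)) \<le> M * C" for n
      using M(2)[OF q[of n], of "s n - x"] mult_left_mono[OF C(2)[of n] M(1)] by linarith
    moreover have "limitin \<tau> (\<lambda>n. T (q n) (s n - x)) 0 sequentially"
      by (rule uniformly_null_imp_sequential[OF null]) (use q in auto)
    ultimately show "seq_conv P (\<lambda>n. T (q n) (s n - x)) 0" by (auto simp: seq_conv_iff bounded_iff)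
  qed
  then show "seq_conv P (\<lambda>n. S' (r n) (s n - x)) 0" using r by (simp add: S'_eq)
qed

end

theorem theorem5p13:
  fixes smul :: "'k::{real_normed_field,euclidean_space} \<Rightarrow> 'a::banach \<Rightarrow> 'a"
    and \<tau> :: "'a topology"
    and T :: "real \<Rightarrow> 'a \<Rightarrow> 'a"
    and f :: "real \<Rightarrow> real"
    and a b :: real
    and \<mu> :: "real measure"
    and \<nu> :: "real \<Rightarrow> real measure"
  assumes "normed_scaling smul"
    and "locally_convex_topology smul \<tau>"
    and "Hausdorff_space \<tau>"
    and "coarser_topology \<tau> euclidean"
    and "norming smul \<tau>"
    and "C_sequential (mixed_topology smul \<tau>)"
    and "uniformly_bounded T"
    and "Bernstein_function f"
    and "Levy_triplet f a b \<mu>"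
    and "associated_convolution_semigroup f \<nu>"
  shows
    "let \<gamma> = mixed_topology smul \<tau>;
         S = subordinated_semigroup smul \<gamma> \<nu> T;
         well_defined =
           ((\<forall>t\<ge>0. \<forall>x. pettis_integrable smul \<gamma> (\<nu> t) {0..} (\<lambda>s. T s x)) \<and>
            (\<forall>x \<in> Domain (generator_graph \<gamma> T).
               pettis_integrable smul \<gamma> \<mu> {0<..} (\<lambda>t. x - T t x)));
         generated =
           (generator_graph \<gamma> S =
              sequential_closure \<gamma> (neg_graph (Phillips_graph smul \<gamma> a b \<mu> T)))
     in (locally_bicontinuous smul \<tau> T \<longrightarrow>
           well_defined \<and> uniformly_bounded S \<and> locally_bicontinuous smul \<tau> S \<and> generated) \<and>
        (bicontinuous smul \<tau> T \<longrightarrow>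
           well_defined \<and> uniformly_bounded S \<and> bicontinuous smul \<tau> S \<and> generated)"
proof -
  obtain K where K: "\<And>t. 0 \<le> t \<Longrightarrow> onorm (T t) \<le> K"
    using assms(7) by (auto simp: uniformly_bounded_def bdd_above_def)
  \<comment> \<open>\<open>max K 0\<close> secures the nonnegativity that the locale asks of the
    bound.\<close>
  have sub: "bicontinuous_subordination smul \<tau> T (max K 0) f a b \<mu> \<nu>" if T: "locally_bicontinuous smul \<tau> T"
  proof
    fix t x assume t: "(0::real) \<le> t"
    have "bounded_linear (T t)"
      using T t by (simp add: locally_bicontinuous_def bicontinuous_on_def operator_semigroup_def)
    then have "norm (T t x) \<le> onorm (T t) * norm x" by (rule onorm)
    also have "\<dots> \<le> max K 0 * norm x" using K[OF t] by (intro mult_right_mono) auto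
    finally show "norm (T t x) \<le> max K 0 * norm x" .
  qed (use assms T in \<open>auto simp: locally_convex_topology_def\<close>)
  note thms = bicontinuous_subordination.well_defined_S
    bicontinuous_subordination.well_defined_Phillips bicontinuous_subordination.uniformly_bounded_S'
    bicontinuous_subordination.locally_bicontinuous_S' bicontinuous_subordination.bicontinuous_S'
    bicontinuous_subordination.generator_S_closure
  show ?thesis
    unfolding Let_def
    using thms[OF sub] thms[OF sub[OF bicontinuous_imp_locally_bicontinuous]] by blast
qed

end
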